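(* A permutation $w\in S_n$ is smooth if and only if there exists an ordering $t_1\prec t_2\prec\cdots\prec t_k$ of all the elements of $\mathbf{C}_{\mathcal{T}}(w)$ such that $$e\to t_1\to t_1t_2\to\cdots\to t_1t_2\cdots t_k=w$$ is a saturated chain in Bruhat order. Furthermore, if $w$ is smooth, then every compatible order $t_1\prec t_2\prec\cdots\prec t_k$ on $\mathbf{C}_{\mathcal{T}}(w)$ has this property.
   Context: $n\ge 1$ is fixed and $S_n$ is the symmetric group on $[n]=\{1,\dots,n\}$ with identity $e$. Products of permutations are composed as functions, $(uv)(x)=u(v(x))$. $\leq$ denotes the (strong) Bruhat order on $S_n$, and $x\to y$ denotes a covering relation in Bruhat order (equivalently, $x\le y$ and $\ell(y)=\ell(x)+1$, where $\ell$ is Coxeter length); a saturated chain is a sequence in which every consecutive pair is a covering relation. A permutation $w\in S_n$ is smooth if the Schubert variety $X_w$ (in the flag variety of $\mathbb{C}^n$) is smooth. It is known that $w$ is smooth if and only if $w$ avoids the patterns $3412$ and $4231$, and if and only if $\ell(w)=|\mathbf{C}_{\mathcal{T}}(w)|$, with $\mathbf{C}_{\mathcal{T}}(w)$ defined below. $T_{i,j}$ ($1\le i<j\le n$) is the transposition swapping $i$ and $j$, and $\mathcal{T}=\{T_{i,j}:1\le i<j\le n\}$. For $i<j<k$ put $R_{i,j,k}=T_{i,j}T_{j,k}$ and $L_{i,j,k}=T_{j,k}T_{i,j}$ (3-cycles), and $\mathcal{C}^{2,3}=\mathcal{T}\cup\{R_{i,j,k},L_{i,j,k}:i<j<k\}$.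 For $w\in S_n$, $\mathbf{C}(w)=\{\tau\in\mathcal{C}^{2,3}:\tau\le w\}$ and $\mathbf{C}_{\mathcal{T}}(w)=\{\tau\in\mathcal{T}:\tau\le w\}$. A subset $A\subseteq\mathcal{C}^{2,3}$ is admissible if: (1) $A$ is downward closed in $\mathcal{C}^{2,3}$ with respect to Bruhat order; (2) whenever $R_{i,j,l},L_{i,k,l}\in A$ with $i<j<l$ and $i<k<l$, then $T_{i,l}\in A$; (3) whenever $T_{i,j},T_{j,k}\in A$ with $i<j<k$, at least one of $R_{i,j,k},L_{i,j,k}$ is in $A$. It is known that $\mathbf{C}(w)$ is admissible when $w$ is smooth. For an admissible set $A$, a linear order $\prec$ on $A_{\mathcal{T}}=A\cap\mathcal{T}$ is compatible (with $A$) if whenever $T_{i,j},T_{j,k}\in A$ for some $i<j<k$: if $T_{i,k}\in A$, then $T_{i,j}\prec T_{i,k}\prec T_{j,k}$ or $T_{j,k}\prec T_{i,k}\prec T_{i,j}$; and if $T_{i,k}\notin A$, then $R_{i,j,k}\in A$ if and only if $T_{i,j}\prec T_{j,k}$. For smooth $w$, a compatible order on $\mathbf{C}_{\mathcal{T}}(w)$ means a linear order on $\mathbf{C}_{\mathcal{T}}(w)$ compatible with $A=\mathbf{C}(w)$. *)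

theory Defs
  imports
    Complex_Main
    "HOL-Library.Function_Algebras"
    "HOL-Combinatorics.Permutations"
    "Jordan_Normal_Form.Determinant"
begin

section \<open>Length and Bruhat order on the symmetric group\<close>

text \<open>
  Elements of $S_n$ are the functions \<open>w\<close> with \<open>w permutes {1..n}\<close>; the product $uv$ is \<open>u \<circ> v\<close>.
\<close>

type_synonym perm = "nat \<Rightarrow> nat"

abbreviation T :: "nat \<Rightarrow> nat \<Rightarrow> perm" where
  "T \<equiv> Transposition.transpose"

definition perm_prod :: "perm list \<Rightarrow> perm" where
  "perm_prod ts = foldr (\<circ>) ts id"

definition simple_reflections :: "nat \<Rightarrow> perm set" where
  "simple_reflections n = {T i (Suc i) | i. 1 \<le> i \<and> i < n}"

definition transpositions :: "nat \<Rightarrow> perm set" where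
  "transpositions n = {T i j | i j. 1 \<le> i \<and> i < j \<and> j \<le> n}"

definition coxeter_length :: "nat \<Rightarrow> perm \<Rightarrow> nat" where
  "coxeter_length n w =
     (LEAST k. \<exists>ss. length ss = k \<and> set ss \<subseteq> simple_reflections n \<and> perm_prod ss = w)"

definition bruhat_step :: "nat \<Rightarrow> perm \<Rightarrow> perm \<Rightarrow> bool" where
  "bruhat_step n x y \<longleftrightarrow>
     x permutes {1..n} \<and> (\<exists>t \<in> transpositions n. y = x \<circ> t) \<and>
     coxeter_length n x < coxeter_length n y"

definition bruhat_le :: "nat \<Rightarrow> perm \<Rightarrow> perm \<Rightarrow> bool" where
  "bruhat_le n x y \<longleftrightarrow>
     x permutes {1..n} \<and> y permutes {1..n} \<and> (bruhat_step n)\<^sup>*\<^sup>* x y"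

definition bruhat_covers :: "nat \<Rightarrow> perm \<Rightarrow> perm \<Rightarrow> bool" where
  "bruhat_covers n x y \<longleftrightarrow>
     bruhat_le n x y \<and> x \<noteq> y \<and>
     (\<forall>z. bruhat_le n x z \<and> bruhat_le n z y \<longrightarrow> z = x \<or> z = y)"

abbreviation saturated_chain :: "nat \<Rightarrow> perm list \<Rightarrow> bool" where
  "saturated_chain n \<equiv> successively (bruhat_covers n)"

section \<open>Transpositions and 3-cycles below a permutation\<close>

definition R3 :: "nat \<Rightarrow> nat \<Rightarrow> nat \<Rightarrow> perm" where
  "R3 i j k = T i j \<circ> T j k"

definition L3 :: "nat \<Rightarrow> nat \<Rightarrow> nat \<Rightarrow> perm" where
  "L3 i j k = T j k \<circ> T i j"

definition C23 :: "nat \<Rightarrow> perm set" where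
  "C23 n = transpositions n \<union>
     (\<Union>{{R3 i j k, L3 i j k} | i j k. 1 \<le> i \<and> i < j \<and> j < k \<and> k \<le> n})"

definition C_below :: "nat \<Rightarrow> perm \<Rightarrow> perm set" where
  "C_below n w = {\<tau> \<in> C23 n. bruhat_le n \<tau> w}"

definition CT_below :: "nat \<Rightarrow> perm \<Rightarrow> perm set" where
  "CT_below n w = {\<tau> \<in> transpositions n. bruhat_le n \<tau> w}"

definition strict_linear_order_on :: "'a set \<Rightarrow> ('a \<Rightarrow> 'a \<Rightarrow> bool) \<Rightarrow> bool" where
  "strict_linear_order_on S r \<longleftrightarrow> irreflp_on S r \<and> transp_on S r \<and> totalp_on S r"

text \<open>
  Compatibility is usually considered for admissible \<open>A\<close>; \<open>C_below n w\<close> is admissible for smooth \<open>w\<close>,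
  and admissibility is deliberately not part of the predicate.
\<close>

definition compatible_order :: "nat \<Rightarrow> perm set \<Rightarrow> (perm \<Rightarrow> perm \<Rightarrow> bool) \<Rightarrow> bool" where
  "compatible_order n A prec \<longleftrightarrow>
     strict_linear_order_on (A \<inter> transpositions n) prec \<and>
     (\<forall>i j k. 1 \<le> i \<and> i < j \<and> j < k \<and> k \<le> n \<and> T i j \<in> A \<and> T j k \<in> A \<longrightarrow>
        (T i k \<in> A \<longrightarrow>
           (prec (T i j) (T i k) \<and> prec (T i k) (T j k)) \<or>
           (prec (T j k) (T i k) \<and> prec (T i k) (T i j))) \<and>
        (T i k \<notin> A \<longrightarrow> (R3 i j k \<in> A \<longleftrightarrow> prec (T i j) (T j k))))"

definition partial_products :: "perm list \<Rightarrow> perm list" where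
  "partial_products ts = map (\<lambda>m. perm_prod (take m ts)) [0..<Suc (length ts)]"

text \<open>
  With \<open>ts = [t\<^sub>1, \<dots>, t\<^sub>k]\<close>: $e \to t_1 \to t_1 t_2 \to \cdots \to t_1 \cdots t_k = w$
  is a saturated chain.
\<close>

definition chain_property :: "nat \<Rightarrow> perm \<Rightarrow> perm list \<Rightarrow> bool" where
  "chain_property n w ts \<longleftrightarrow>
     saturated_chain n (partial_products ts) \<and> perm_prod ts = w"

section \<open>The flag variety and its affine charts\<close>

text \<open>
  Matrices and vectors are indexed from 0. A flag is the family of its subspaces; every complete
  flag of $\mathbb{C}^n$ is a $GL_n$-translate of the standard one, so that \<open>flag_variety n\<close> is
  $GL_n/B$ with \<open>flag_of n g\<close> in the role of the coset $gB$.
\<close>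

type_synonym flag = "nat \<Rightarrow> complex vec set"

definition GL :: "nat \<Rightarrow> complex mat set" where
  "GL n = {g \<in> carrier_mat n n. invertible_mat g}"

definition borel_subgroup :: "nat \<Rightarrow> complex mat set" where
  "borel_subgroup n = {b \<in> GL n. upper_triangular b}"

definition std_flag :: "nat \<Rightarrow> flag" where
  "std_flag n d = {x \<in> carrier_vec n. \<forall>k<n. d \<le> k \<longrightarrow> x $ k = 0}"

definition flag_of :: "nat \<Rightarrow> complex mat \<Rightarrow> flag" where
  "flag_of n g = (\<lambda>d. (\<lambda>x. g *\<^sub>v x) ` std_flag n d)"

definition flag_variety :: "nat \<Rightarrow> flag set" where
  "flag_variety n = flag_of n ` GL n"

text \<open>
  The affine space with coordinates $a_{ij}$, $0 \le j < i < n$, consists of the functions supported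
  on these index pairs. The charts $a \mapsto g\,u(a)\,B$, with $u(a)$ lower unitriangular and
  \<open>g \<in> GL n\<close>, are open embeddings of it that cover the flag variety.
\<close>

type_synonym coords = "nat \<times> nat \<Rightarrow> complex"

definition affine_space :: "nat \<Rightarrow> coords set" where
  "affine_space n = {a. \<forall>i j. \<not> (j < i \<and> i < n) \<longrightarrow> a (i, j) = 0}"

definition lower_unipotent :: "nat \<Rightarrow> coords \<Rightarrow> complex mat" where
  "lower_unipotent n a =
     mat n n (\<lambda>(i, j). if i = j then 1 else if j < i then a (i, j) else 0)"

definition chart :: "nat \<Rightarrow> complex mat \<Rightarrow> coords \<Rightarrow> flag" where
  "chart n g a = flag_of n (g * lower_unipotent n a)"

definition chart_part :: "nat \<Rightarrow> complex mat \<Rightarrow> flag set \<Rightarrow> coords set" where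
  "chart_part n g Z = {a \<in> affine_space n. chart n g a \<in> Z}"

inductive polynomial_coord_fun :: "(coords \<Rightarrow> complex) \<Rightarrow> bool" where
  const: "polynomial_coord_fun (\<lambda>a. c)"
| coord: "polynomial_coord_fun (\<lambda>a. a p)"
| add: "polynomial_coord_fun f \<Longrightarrow> polynomial_coord_fun g \<Longrightarrow> polynomial_coord_fun (\<lambda>a. f a + g a)"
| mult: "polynomial_coord_fun f \<Longrightarrow> polynomial_coord_fun g \<Longrightarrow> polynomial_coord_fun (\<lambda>a. f a * g a)"

definition algebraic_set :: "nat \<Rightarrow> coords set \<Rightarrow> bool" where
  "algebraic_set n V \<longleftrightarrow>
     (\<exists>P. (\<forall>f \<in> P. polynomial_coord_fun f) \<and> V = {a \<in> affine_space n. \<forall>f \<in> P. f a = 0})"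

definition zariski_closed :: "nat \<Rightarrow> flag set \<Rightarrow> bool" where
  "zariski_closed n Z \<longleftrightarrow>
     Z \<subseteq> flag_variety n \<and> (\<forall>g \<in> GL n. algebraic_set n (chart_part n g Z))"

definition zariski_closure :: "nat \<Rightarrow> flag set \<Rightarrow> flag set" where
  "zariski_closure n S = \<Inter>{Z. zariski_closed n Z \<and> S \<subseteq> Z}"

section \<open>Schubert varieties and smoothness\<close>

definition perm_mat :: "nat \<Rightarrow> perm \<Rightarrow> complex mat" where
  "perm_mat n w = mat n n (\<lambda>(i, j). if w (Suc j) = Suc i then 1 else 0)"

definition schubert_cell :: "nat \<Rightarrow> perm \<Rightarrow> flag set" where
  "schubert_cell n w = {flag_of n (b * perm_mat n w) | b. b \<in> borel_subgroup n}"

definition schubert_variety :: "nat \<Rightarrow> perm \<Rightarrow> flag set" where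
  "schubert_variety n w = zariski_closure n (schubert_cell n w)"

definition coord_scale :: "complex \<Rightarrow> coords \<Rightarrow> coords" where
  "coord_scale c v = (\<lambda>p. c * v p)"

interpretation coord_space: vector_space coord_scale
  by standard (auto simp: coord_scale_def fun_eq_iff algebra_simps)

text \<open>
  The Zariski tangent space of a subvariety \<open>Z\<close> at its point \<open>flag_of n g\<close>, computed at the
  origin of the chart centred at that point: the common kernel of the differentials at $0$ of all
  polynomials vanishing on \<open>Z\<close> in that chart. Its dimension depends only on the point, not on \<open>g\<close>.
\<close>

definition tangent_space :: "nat \<Rightarrow> flag set \<Rightarrow> complex mat \<Rightarrow> coords set" where
  "tangent_space n Z g =
     {v \<in> affine_space n. \<forall>f. polynomial_coord_fun f \<and> (\<forall>a \<in> chart_part n g Z. f a = 0) \<longrightarrow>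
        ((\<lambda>s. f (coord_scale s v)) has_field_derivative 0) (at 0)}"

definition tangent_dim :: "nat \<Rightarrow> flag set \<Rightarrow> complex mat \<Rightarrow> nat" where
  "tangent_dim n Z g = coord_space.dim (tangent_space n Z g)"

text \<open>
  For an irreducible variety the dimension is the minimum of the dimensions of its Zariski tangent
  spaces. This applies to Schubert varieties, which are closures of orbits of the connected group
  $B$; the next two definitions are meant for irreducible closed \<open>Z\<close> only.
\<close>

definition variety_dim :: "nat \<Rightarrow> flag set \<Rightarrow> nat" where
  "variety_dim n Z = (INF g \<in> {g \<in> GL n. flag_of n g \<in> Z}. tangent_dim n Z g)"

definition smooth_variety :: "nat \<Rightarrow> flag set \<Rightarrow> bool" where
  "smooth_variety n Z \<longleftrightarrow>
     (\<forall>g \<in> GL n. flag_of n g \<in> Z \<longrightarrow> tangent_dim n Z g = variety_dim n Z)"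

definition smooth_perm :: "nat \<Rightarrow> perm \<Rightarrow> bool" where
  "smooth_perm n w \<longleftrightarrow> smooth_variety n (schubert_variety n w)"

end

theory Submission
  imports Defs "HOL-Computational_Algebra.Fundamental_Theorem_Algebra"
begin

text \<open>
  Put $m(i) = \min(\max_{k \le i} w(k), \max_{k \le i} w^{-1}(k))$. By the rank criterion for the
  Bruhat order, $T_{i,j} \le w$ iff $j \le m(i)$, so $|C_T(w)| = \sum_i (m(i) - i)$, and this is at
  least $\ell(w)$.

  Smoothness means equality. The dimension of the Zariski tangent space of $X_w$ is constant on
  Bruhat cells and does not increase along the Bruhat order. It is $\ell(w)$ at $w$, and at $e$ it is
  $|C_T(w)|$: the lower bound comes from the lines through $e$ in the directions of the transpositions
  below $w$, the upper bound from differentiating the minors that vanish on $X_w$. So all tangent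
  spaces have the same dimension iff $|C_T(w)| = \ell(w)$. In particular, a saturated chain as in the
  theorem, which has $\ell(w)$ steps, forces smoothness.

  Conversely, let $|C_T(w)| = \ell(w)$ and let $p$ be the first index moved by $w$. With $r = m(p)$,
  either $w$ or $w^{-1}$ is $c\,w'$, where $c = T_{p,p+1} \cdots T_{p,r}$ and $w'$ fixes $p$, has the
  same $m(i)$ for $i > p$ and satisfies the same equality. Exchanging neighbouring disjoint
  transpositions and replacing $T_{i,j}, T_{i,k}, T_{j,k}$ by $T_{j,k}, T_{i,k}, T_{i,j}$ affects
  neither the product nor the property of being a saturated chain; in a compatible order, such moves
  collect all $T_{p,j}$ at one end of the list, and the rest is a compatible order for $w'$ (or its
  inverse).
\<close>

section \<open>Inversions and the Bruhat order\<close>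

text \<open>The collecting moves work because compatibility makes every initial segment of the list,
  restricted to pairs inside {p..r}, the inversion set of a permutation of {p..r}. Reading the list
  is then a bubble sort of {p..r}, and the T_{p,j} met so far can be kept in the order reached. The
  3-cycles decide to which end they move: for k > r, each T_{j,k} comes after T_{p,j} if w(p) is the
  smaller of w(p) and w^{-1}(p), and before it otherwise. The obstacle is to control the 3-cycles of
  w' as well as this choice. Both rest on the bound of m(m(i)) by the larger of the two maxima
  defining m(i). It is condition (3) of admissibility in numerical form, and follows from |C_T(w)| =
  ell(w) by the same induction. On the geometric side, tangent spaces are computed in charts that
  depend on the matrix representing a flag. Constancy on a cell therefore needs the transition
  between such charts, a rational map given by LU decomposition, and semicontinuity uses explicit
  lines leading from a cell into a larger one.\<close>

definition index_pairs :: "nat \<Rightarrow> (nat \<times> nat) set" where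
  "index_pairs n = {(i, j). 1 \<le> i \<and> i < j \<and> j \<le> n}"

definition inv_count :: "nat \<Rightarrow> perm \<Rightarrow> nat" where
  "inv_count n w = card {(i, j) \<in> index_pairs n. w j < w i}"

abbreviation perm_inv :: "perm \<Rightarrow> perm" where
  "perm_inv \<equiv> Hilbert_Choice.inv"

lemma finite_index_pairs [simp]: "finite (index_pairs n)"
  by (rule finite_subset[of _ "{1..n} \<times> {1..n}"]) (auto simp: index_pairs_def)

lemma inv_count_eq_sum:
  "inv_count n w = (\<Sum>(i, j) \<in> index_pairs n. of_bool (w j < w i))"
  unfolding inv_count_def card_eq_sum
  by (rule sum.mono_neutral_cong_left) auto

lemma transp_permutes: "1 \<le> a \<Longrightarrow> a \<le> n \<Longrightarrow> 1 \<le> b \<Longrightarrow> b \<le> n \<Longrightarrow> T a b permutes {1..n}"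
  by (rule permutes_swap_id) auto

lemma permutes_comp_T:
  "x permutes {1..n} \<Longrightarrow> 1 \<le> a \<Longrightarrow> a < b \<Longrightarrow> b \<le> n \<Longrightarrow> x \<circ> T a b permutes {1..n}"
  by (rule permutes_compose[OF transp_permutes]) simp_all

lemma comp_T_T: "x \<circ> T a b \<circ> T a b = x"
  by (auto simp: fun_eq_iff)

lemma permutes_neq: "x permutes S \<Longrightarrow> a \<noteq> b \<Longrightarrow> x a \<noteq> x b"
  by (metis permutes_inverses(2))

lemma permutes_atLeastAtMost: "x permutes {1..n::nat} \<Longrightarrow> 1 \<le> a \<and> a \<le> n \<Longrightarrow> 1 \<le> x a \<and> x a \<le> n"
  using permutes_in_image[of x "{1..n}" a] by auto

lemma permutes_inv_atLeastAtMost: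
  "x permutes {1..n::nat} \<Longrightarrow> 1 \<le> a \<and> a \<le> n \<Longrightarrow> 1 \<le> perm_inv x a \<and> perm_inv x a \<le> n"
  using permutes_atLeastAtMost[of "perm_inv x" n a] permutes_inv by auto

text \<open>The pairs other than \<open>(a, b)\<close>, \<open>(a, c)\<close>, \<open>(c, b)\<close>
  with a < c < b are permuted among themselves by the swap without reversing any of them, so their
  inversions are only relabelled. The pair \<open>(a, b)\<close> becomes an inversion, and an
  intermediate c contributes two new ones exactly when its value lies between \<open>w a\<close> and
  \<open>w b\<close>, with no net change otherwise.\<close>

lemma inv_count_comp_T:
  assumes ab: "1 \<le> a" "a < b" "b \<le> n" and less: "w a < w b"
    and w: "w permutes {1..n}"
  shows "inv_count n (w \<circ> T a b) = inv_count n w + 1 + 2 * card {c \<in> {a<..<b}. w a < w c \<and> w c < w b}"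
proof -
  let ?t = "T a b"
  let ?M = "{a<..<b}"
  let ?S = "Pair a ` ?M"
  let ?R = "(\<lambda>c. (c, b)) ` ?M"
  define U where "U = index_pairs n - ({(a, b)} \<union> ?S \<union> ?R)"
  have split: "index_pairs n = U \<union> ({(a, b)} \<union> (?S \<union> ?R))"
    using ab by (auto simp: U_def index_pairs_def)
  have fU: "finite U" by (simp add: U_def)
  have sum_split: "(\<Sum>p \<in> index_pairs n. g p) = (\<Sum>p \<in> U. g p) + (g (a, b) + (\<Sum>c \<in> ?M. g (a, c) + g (c, b)))"
    for g :: "nat \<times> nat \<Rightarrow> nat"
  proof -
    have "(\<Sum>p \<in> index_pairs n. g p) = (\<Sum>p \<in> U. g p) + (\<Sum>p \<in> {(a, b)} \<union> (?S \<union> ?R). g p)"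
      by (subst split, rule sum.union_disjoint) (use fU in \<open>auto simp: U_def\<close>)
    also have "(\<Sum>p \<in> {(a, b)} \<union> (?S \<union> ?R). g p) = g (a, b) + (\<Sum>p \<in> ?S \<union> ?R. g p)"
      by (subst sum.union_disjoint) auto
    also have "(\<Sum>p \<in> ?S \<union> ?R. g p) = (\<Sum>p \<in> ?S. g p) + (\<Sum>p \<in> ?R. g p)"
      by (subst sum.union_disjoint) auto
    also have "(\<Sum>p \<in> ?S. g p) = (\<Sum>c \<in> ?M. g (a, c))"
      by (subst sum.reindex) (auto simp: inj_on_def)
    also have "(\<Sum>p \<in> ?R. g p) = (\<Sum>c \<in> ?M. g (c, b))"
      by (subst sum.reindex) (auto simp: inj_on_def)
    finally show ?thesis by (simp add: sum.distrib)
  qed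
  let ?g = "\<lambda>(i, j). of_bool (w j < w i) :: nat"
  let ?h = "\<lambda>(i, j). of_bool ((w \<circ> ?t) j < (w \<circ> ?t) i) :: nat"
  have maps: "map_prod ?t ?t p \<in> U" if "p \<in> U" for p
  proof -
    obtain i j where p: "p = (i, j)" by (cases p)
    have "1 \<le> i" "i < j" "j \<le> n" "(i, j) \<noteq> (a, b)" "i = a \<longrightarrow> \<not> (a < j \<and> j < b)" "j = b \<longrightarrow> \<not> (a < i \<and> i < b)"
      using that by (auto simp: p U_def index_pairs_def)
    then show ?thesis
      unfolding U_def index_pairs_def p
      using ab by (auto simp: Transposition.transpose_def split: if_splits)
  qed
  have bij: "bij_betw (map_prod ?t ?t) U U"
    by (rule bij_betwI[where g = "map_prod ?t ?t"]) (use maps in \<open>auto simp: map_prod.compositionality\<close>)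
  have sumU: "(\<Sum>p \<in> U. ?h p) = (\<Sum>p \<in> U. ?g p)"
  proof -
    have "(\<Sum>p \<in> U. ?g p) = (\<Sum>p \<in> U. ?g (map_prod ?t ?t p))"
      using sum.reindex_bij_betw[OF bij, of ?g] by simp
    also have "\<dots> = (\<Sum>p \<in> U. ?h p)"
      by (intro sum.cong) auto
    finally show ?thesis by simp
  qed
  have M: "(\<Sum>c \<in> ?M. ?h (a, c) + ?h (c, b)) = (\<Sum>c \<in> ?M. ?g (a, c) + ?g (c, b))
      + 2 * card {c \<in> ?M. w a < w c \<and> w c < w b}"
  proof -
    have "(\<Sum>c \<in> ?M. ?h (a, c) + ?h (c, b)) =
        (\<Sum>c \<in> ?M. (?g (a, c) + ?g (c, b)) + 2 * of_bool (w a < w c \<and> w c < w b))"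
    proof (rule sum.cong[OF refl])
      fix c assume "c \<in> ?M"
      then have "?t c = c" "w c \<noteq> w a" "w c \<noteq> w b" using permutes_neq[OF w] by auto
      then show "?h (a, c) + ?h (c, b) = (?g (a, c) + ?g (c, b)) + 2 * of_bool (w a < w c \<and> w c < w b)"
        using less by (cases "w a < w c"; cases "w c < w b") auto
    qed
    also have "\<dots> = (\<Sum>c \<in> ?M. ?g (a, c) + ?g (c, b)) + 2 * (\<Sum>c \<in> ?M. of_bool (w a < w c \<and> w c < w b))"
      by (simp add: sum.distrib sum_distrib_left)
    also have "(\<Sum>c \<in> ?M. of_bool (w a < w c \<and> w c < w b)) = card {c \<in> ?M. w a < w c \<and> w c < w b}"
      unfolding card_eq_sum by (rule sum.mono_neutral_cong_right) auto
    finally show ?thesis .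
  qed
  show ?thesis
    unfolding inv_count_eq_sum sum_split sumU M using less by simp
qed

section \<open>Coxeter length as the number of inversions\<close>

lemma inv_count_comp_T_Suc:
  assumes "1 \<le> i" "i < n" and w: "w permutes {1..n}"
  shows "inv_count n (w \<circ> T i (Suc i)) \<le> Suc (inv_count n w)"
    and "w (Suc i) < w i \<Longrightarrow> inv_count n w = Suc (inv_count n (w \<circ> T i (Suc i)))"
proof -
  have *: "inv_count n (v \<circ> T i (Suc i)) = Suc (inv_count n v)" if "v i < v (Suc i)" "v permutes {1..n}" for v :: perm
    using inv_count_comp_T[of i "Suc i" n v] that assms by simp
  show **: "inv_count n w = Suc (inv_count n (w \<circ> T i (Suc i)))" if "w (Suc i) < w i"
    using *[of "w \<circ> T i (Suc i)"] that assms permutes_comp_T[OF w, of i "Suc i"] by (simp add: comp_T_T)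
  show "inv_count n (w \<circ> T i (Suc i)) \<le> Suc (inv_count n w)"
    using *[of w] ** permutes_neq[OF w, of i "Suc i"] w by (cases "w i < w (Suc i)") auto
qed

lemma perm_prod_Nil [simp]: "perm_prod [] = id"
  by (simp add: perm_prod_def)

lemma perm_prod_Cons [simp]: "perm_prod (t # ts) = t \<circ> perm_prod ts"
  by (simp add: perm_prod_def)

lemma perm_prod_append [simp]: "perm_prod (ts @ us) = perm_prod ts \<circ> perm_prod us"
  by (induction ts) (auto simp: comp_assoc)

lemma strict_mono_permutes_eq_id:
  assumes w: "w permutes {1..n::nat}" and mono: "\<And>i. 1 \<le> i \<Longrightarrow> i < n \<Longrightarrow> w i < w (Suc i)"
  shows "w = id"
proof -
  have mono': "w i < w j" if "1 \<le> i" "i < j" "j \<le> n" for i j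
    using that
  proof (induction j)
    case (Suc j)
    then show ?case using mono[of j] by (cases "i = j") auto
  qed simp
  have ge: "i \<le> w i" if "1 \<le> i" "i \<le> n" for i
    using that
  proof (induction i)
    case (Suc i)
    then show ?case using mono[of i] permutes_atLeastAtMost[OF w, of "Suc i"] by (cases i) auto
  qed simp
  have le: "w i \<le> i" if "1 \<le> i" "i \<le> n" for i
  proof -
    \<comment> \<open>Downward induction from n; d is the distance to the top.\<close>
    have "i = n - d \<Longrightarrow> 1 \<le> i \<Longrightarrow> w i \<le> i" for d i
    proof (induction d arbitrary: i)
      case 0
      then show ?case using permutes_atLeastAtMost[OF w, of n] by auto
    next
      case (Suc d)
      show ?case
      proof (cases "i < n")
        case True
        then have "Suc i = n - d" using Suc.prems by auto
        then show ?thesis using Suc.IH[of "Suc i"] mono[of i] True Suc.prems by auto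
      next
        case False
        then show ?thesis using Suc.prems by auto
      qed
    qed
    from this[of i "n - i"] show ?thesis using that by auto
  qed
  have "w i = i" for i
    using ge[of i] le[of i] permutes_not_in[OF w, of i] by (cases "1 \<le> i \<and> i \<le> n") auto
  then show ?thesis by (auto simp: fun_eq_iff)
qed

lemma inv_count_id [simp]: "inv_count n id = 0"
proof -
  have "{(i, j) \<in> index_pairs n. id j < id i} = {}" by (auto simp: index_pairs_def)
  then show ?thesis unfolding inv_count_def by (metis card.empty)
qed

text \<open>Bubble sort: removing a descent by a simple reflection lowers the number of inversions
  by exactly one, and a permutation without descents is the identity.\<close>

lemma exists_reduced_word:
  assumes "w permutes {1..n}"
  shows "\<exists>ss. length ss = inv_count n w \<and> set ss \<subseteq> simple_reflections n \<and> perm_prod ss = w"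
  using assms
proof (induction "inv_count n w" arbitrary: w rule: less_induct)
  case less
  show ?case
  proof (cases "\<exists>i. 1 \<le> i \<and> i < n \<and> w (Suc i) < w i")
    case True
    then obtain i where i: "1 \<le> i" "i < n" "w (Suc i) < w i" by blast
    let ?v = "w \<circ> T i (Suc i)"
    have c: "inv_count n w = Suc (inv_count n ?v)"
      using inv_count_comp_T_Suc(2)[OF i(1,2) less.prems i(3)] .
    have v: "?v permutes {1..n}" using less.prems i by (intro permutes_comp_T) auto
    from less.hyps[OF _ v] c obtain ss where ss:
      "length ss = inv_count n ?v" "set ss \<subseteq> simple_reflections n" "perm_prod ss = ?v" by auto
    have "T i (Suc i) \<in> simple_reflections n"
      unfolding simple_reflections_def using i by blast
    then show ?thesis using ss c
      by (intro exI[of _ "ss @ [T i (Suc i)]"]) (auto simp: comp_T_T)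
  next
    case False
    have "w = id"
      by (rule strict_mono_permutes_eq_id[OF less.prems])
         (use False permutes_neq[OF less.prems] in \<open>metis n_not_Suc_n linorder_neqE_nat\<close>)
    then show ?thesis by (intro exI[of _ "[]"]) auto
  qed
qed

lemma simple_word_inv_count:
  assumes "set ss \<subseteq> simple_reflections n"
  shows "perm_prod ss permutes {1..n} \<and> inv_count n (perm_prod ss) \<le> length ss"
  using assms
proof (induction ss rule: rev_induct)
  case (snoc s ss)
  then obtain i where i: "s = T i (Suc i)" "1 \<le> i" "i < n" by (auto simp: simple_reflections_def)
  have IH: "perm_prod ss permutes {1..n}" "inv_count n (perm_prod ss) \<le> length ss" using snoc by auto
  have eq: "perm_prod (ss @ [s]) = perm_prod ss \<circ> T i (Suc i)" by (simp add: i)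
  have "perm_prod ss \<circ> T i (Suc i) permutes {1..n}"
    using permutes_comp_T[OF IH(1) i(2), of "Suc i"] i(3) by simp
  moreover have "inv_count n (perm_prod ss \<circ> T i (Suc i)) \<le> length (ss @ [s])"
    using inv_count_comp_T_Suc(1)[OF i(2,3) IH(1)] IH(2) by simp
  ultimately show ?case unfolding eq by blast
qed (auto simp: permutes_id)

lemma coxeter_length_eq_inv_count:
  assumes "w permutes {1..n}"
  shows "coxeter_length n w = inv_count n w"
  unfolding coxeter_length_def
  by (rule Least_equality) (use exists_reduced_word[OF assms] simple_word_inv_count in blast)+

text \<open>Replaces the comparison of lengths by a comparison of two values. If
  \<open>x b < x a\<close>, the inversion count is applied to \<open>x \<circ> T a b\<close>, from
  which the same transposition leads up to x.\<close>

lemma bruhat_step_iff: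
  "bruhat_step n x y \<longleftrightarrow>
     x permutes {1..n} \<and> (\<exists>a b. 1 \<le> a \<and> a < b \<and> b \<le> n \<and> y = x \<circ> T a b \<and> x a < x b)"
proof -
  have "coxeter_length n x < coxeter_length n (x \<circ> T a b) \<longleftrightarrow> x a < x b"
    if x: "x permutes {1..n}" and ab: "1 \<le> a" "a < b" "b \<le> n" for a b
  proof -
    have l: "coxeter_length n (x \<circ> T a b) = inv_count n (x \<circ> T a b)"
      by (rule coxeter_length_eq_inv_count) (rule permutes_comp_T[OF x ab])
    show ?thesis
    proof (cases "x a < x b")
      case True
      then show ?thesis using inv_count_comp_T[of a b n x] ab l x coxeter_length_eq_inv_count[OF x] by simp
    next
      case False
      then have "x b < x a" using permutes_neq[OF x, of a b] ab by auto
      then show ?thesis using inv_count_comp_T[of a b n "x \<circ> T a b"] ab l coxeter_length_eq_inv_count[OF x] permutes_comp_T[OF x ab]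
        by (simp add: comp_T_T)
    qed
  qed
  then show ?thesis unfolding bruhat_step_def transpositions_def by blast
qed

lemma bruhat_step_inv_count: "bruhat_step n x y \<Longrightarrow> inv_count n x < inv_count n y"
  by (auto simp: bruhat_step_iff inv_count_comp_T)

lemma bruhat_step_permutes: "bruhat_step n x y \<Longrightarrow> x permutes {1..n} \<and> y permutes {1..n}"
  by (metis bruhat_step_iff permutes_comp_T)

lemma bruhat_steps_inv_count: "(bruhat_step n)\<^sup>*\<^sup>* x y \<Longrightarrow> x = y \<or> inv_count n x < inv_count n y"
  by (induction rule: rtranclp_induct) (auto dest: bruhat_step_inv_count)

section \<open>The Bruhat order and its covering relation\<close>

lemma bruhat_le_refl [simp]: "x permutes {1..n} \<Longrightarrow> bruhat_le n x x"
  by (simp add: bruhat_le_def)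

lemma bruhat_le_trans: "bruhat_le n x y \<Longrightarrow> bruhat_le n y z \<Longrightarrow> bruhat_le n x z"
  by (auto simp: bruhat_le_def)

lemma bruhat_step_le: "bruhat_step n x y \<Longrightarrow> bruhat_le n x y"
  using bruhat_step_permutes by (auto simp: bruhat_le_def)

lemma bruhat_le_comp_T:
  "x permutes {1..n} \<Longrightarrow> 1 \<le> a \<Longrightarrow> a < b \<Longrightarrow> b \<le> n \<Longrightarrow> x a < x b \<Longrightarrow> bruhat_le n x (x \<circ> T a b)"
  by (intro bruhat_step_le) (auto simp: bruhat_step_iff)

lemma bruhat_le_inv_count: "bruhat_le n x y \<Longrightarrow> x = y \<or> inv_count n x < inv_count n y"
  by (auto simp: bruhat_le_def dest: bruhat_steps_inv_count)

text \<open>A cover is a single Bruhat step \<open>x \<circ> T a b\<close>. If its length grew by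
  more than one, some c between a and b would have its value between \<open>x a\<close> and
  \<open>x b\<close>, and the step would factor into three smaller ascents, producing an element
  strictly in between.\<close>

lemma bruhat_covers_inv_count:
  assumes "bruhat_covers n x y"
  shows "inv_count n y = Suc (inv_count n x)"
proof -
  have le: "bruhat_le n x y" "x \<noteq> y" and no: "\<And>z. bruhat_le n x z \<Longrightarrow> bruhat_le n z y \<Longrightarrow> z = x \<or> z = y"
    using assms by (auto simp: bruhat_covers_def)
  then have p: "x permutes {1..n}" "y permutes {1..n}" by (auto simp: bruhat_le_def)
  from le obtain z where z: "bruhat_step n x z" "(bruhat_step n)\<^sup>*\<^sup>* z y"
    by (auto simp: bruhat_le_def elim: converse_rtranclpE)
  have "bruhat_le n x z" "bruhat_le n z y" "z \<noteq> x"
    using bruhat_step_le[OF z(1)] bruhat_step_permutes[OF z(1)] bruhat_step_inv_count[OF z(1)] z(2) p(2)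
    by (auto simp: bruhat_le_def)
  then have "z = y" using no by blast
  then obtain a b where ab: "1 \<le> a" "a < b" "b \<le> n" "y = x \<circ> T a b" "x a < x b"
    using z by (auto simp: bruhat_step_iff)
  have "{c \<in> {a<..<b}. x a < x c \<and> x c < x b} = {}"
  proof (rule ccontr)
    assume "\<not> ?thesis"
    then obtain c where c: "a < c" "c < b" "x a < x c" "x c < x b" by auto
    let ?z = "x \<circ> T a c"
    have 1: "bruhat_le n x ?z" using p ab c by (intro bruhat_le_comp_T) auto
    then have zp: "?z permutes {1..n}" by (simp add: bruhat_le_def)
    have 2: "bruhat_le n ?z (?z \<circ> T c b)" using zp ab c by (intro bruhat_le_comp_T) auto
    have "?z \<circ> T c b permutes {1..n}" using 2 by (simp add: bruhat_le_def)
    then have 3: "bruhat_le n (?z \<circ> T c b) (?z \<circ> T c b \<circ> T a c)"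
      by (rule bruhat_le_comp_T) (use ab c in \<open>simp_all add: Transposition.transpose_def\<close>)
    \<comment> \<open>The three ascents are by \<open>T a c\<close>, \<open>T c b\<close> and again
      \<open>T a c\<close>; this identity says that they end at y.\<close>
    have "T a c \<circ> T c b \<circ> T a c = T a b"
      by (rule transpose_comp_triple) (use c in auto)
    then have "?z \<circ> T c b \<circ> T a c = y"
      unfolding ab(4) by (metis comp_assoc)
    then have "bruhat_le n ?z y" using 2 3 bruhat_le_trans by metis
    then have "?z = x \<or> ?z = y" using no 1 by blast
    moreover have "?z a \<noteq> x a" using c by simp
    then have "?z \<noteq> x" by (rule contrapos_nn) (erule fun_cong)
    moreover have "?z a \<noteq> y a" unfolding ab(4) using c by simp
    then have "?z \<noteq> y" by (rule contrapos_nn) (erule fun_cong)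
    ultimately show False by blast
  qed
  then show ?thesis using inv_count_comp_T[OF ab(1-3,5) p(1)] ab by simp
qed

text \<open>Bruhat order strictly increases the number of inversions, so a gap of one leaves no room
  for a third element.\<close>

lemma bruhat_covers_comp_T:
  assumes "x permutes {1..n}" "1 \<le> a" "a < b" "b \<le> n" "inv_count n (x \<circ> T a b) = Suc (inv_count n x)"
  shows "bruhat_covers n x (x \<circ> T a b)"
proof -
  have "x a < x b"
  proof (rule ccontr)
    assume "\<not> ?thesis"
    then have "x b < x a" using permutes_neq[OF assms(1), of a b] assms by auto
    then show False using inv_count_comp_T[of a b n "x \<circ> T a b"] assms permutes_comp_T[OF assms(1-4)]
      by (simp add: comp_T_T)
  qed
  then have "bruhat_le n x (x \<circ> T a b)" by (rule bruhat_le_comp_T[OF assms(1-4)])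
  moreover have "x \<noteq> x \<circ> T a b" using assms(5) by (metis n_not_Suc_n)
  moreover have "z = x \<or> z = x \<circ> T a b" if "bruhat_le n x z" "bruhat_le n z (x \<circ> T a b)" for z
  proof (rule ccontr)
    assume "\<not> ?thesis"
    then show False
      using bruhat_le_inv_count[OF that(1)] bruhat_le_inv_count[OF that(2)] assms(5) by auto
  qed
  ultimately show ?thesis unfolding bruhat_covers_def by blast
qed

section \<open>The rank criterion\<close>

text \<open>The rank of the corner of the permutation matrix formed by the first p columns and the
  rows after the q-th. The same number reappears as a rank condition on flags.\<close>

definition rk :: "perm \<Rightarrow> nat \<Rightarrow> nat \<Rightarrow> nat" where
  "rk w p q = card {k \<in> {1..p}. q < w k}"

text \<open>Two dots of the permutation matrix move to the other two corners of a rectangle; the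
  count changes, by one, exactly for the corners \<open>(p, q)\<close> inside that
  rectangle.\<close>

lemma rk_comp_T:
  assumes "1 \<le> a" "a < b" "x a < x b"
  shows "rk (x \<circ> T a b) p q = rk x p q + of_bool (a \<le> p \<and> p < b \<and> x a \<le> q \<and> q < x b)"
proof (cases "b \<le> p")
  case True
  have "bij_betw (T a b) {k \<in> {1..p}. q < (x \<circ> T a b) k} {k \<in> {1..p}. q < x k}"
    by (rule bij_betwI[where g = "T a b"]) (use assms True in \<open>auto simp: Transposition.transpose_def\<close>)
  then show ?thesis using True by (simp add: rk_def bij_betw_same_card)
next
  case False
  show ?thesis
  proof (cases "a \<le> p")
    case True
    let ?C = "{k \<in> {1..p} - {a}. q < x k}"
    have "{k \<in> {1..p}. q < (x \<circ> T a b) k} = ?C \<union> {k. k = a \<and> q < x b}"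
      "{k \<in> {1..p}. q < x k} = ?C \<union> {k. k = a \<and> q < x a}"
      using True False assms by (auto simp: Transposition.transpose_def)
    moreover have "card (?C \<union> {k. k = a \<and> P}) = card ?C + of_bool P" for P
      by (cases P) simp_all
    ultimately have "rk (x \<circ> T a b) p q = card ?C + of_bool (q < x b)" "rk x p q = card ?C + of_bool (q < x a)"
      unfolding rk_def by simp_all
    then show ?thesis using True False assms by simp
  next
    case aF: False
    have "{k \<in> {1..p}. q < (x \<circ> T a b) k} = {k \<in> {1..p}. q < x k}"
      using False aF assms by (auto simp: Transposition.transpose_def)
    then show ?thesis using aF by (simp add: rk_def)
  qed
qed

lemma bruhat_le_rk_le: "bruhat_le n x y \<Longrightarrow> rk x p q \<le> rk y p q"
proof -
  have "(bruhat_step n)\<^sup>*\<^sup>* x y \<Longrightarrow> rk x p q \<le> rk y p q"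
  proof (induction rule: rtranclp_induct)
    case (step y z)
    then obtain a b where ab: "1 \<le> a" "a < b" "z = y \<circ> T a b" "y a < y b"
      by (auto simp: bruhat_step_iff)
    show ?case unfolding ab(3) rk_comp_T[OF ab(1,2,4)] using step.IH by simp
  qed simp
  then show "bruhat_le n x y \<Longrightarrow> rk x p q \<le> rk y p q" by (simp add: bruhat_le_def)
qed

lemma rk_split: "q \<le> q' \<Longrightarrow> rk w p q = rk w p q' + card {k \<in> {1..p}. q < w k \<and> w k \<le> q'}"
proof -
  assume "q \<le> q'"
  then have eq: "{k \<in> {1..p}. q < w k} = {k \<in> {1..p}. q' < w k} \<union> {k \<in> {1..p}. q < w k \<and> w k \<le> q'}" by auto
  show ?thesis unfolding rk_def eq by (rule card_Un_disjoint) auto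
qed

text \<open>Greedy ascent. At the first position a where x and y differ, the ranks force
  \<open>x a < y a\<close>. Swapping a with the first later b whose value lies in the interval from
  \<open>x a\<close> (excluded) to \<open>y a\<close> (included) raises x by one Bruhat step without
  breaking the rank inequalities; the number of inversions is bounded, so the process ends at
  y.\<close>

lemma bruhat_le_if_rk_le:
  assumes "x permutes {1..n}" "y permutes {1..n}"
    and "\<And>p q. rk x p q \<le> rk y p q"
  shows "bruhat_le n x y"
  using assms
proof (induction "n * n - inv_count n x" arbitrary: x rule: less_induct)
  case less
  note x = less.prems(1) and y = less.prems(2) and rk = less.prems(3)
  show ?case
  proof (cases "x = y")
    case True
    then show ?thesis using x by simp
  next
    case False
    then obtain a where a: "x a \<noteq> y a" "\<And>k. k < a \<Longrightarrow> x k = y k"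
      using exists_least_iff[of "\<lambda>k. x k \<noteq> y k"] by (metis ext)
    have an: "1 \<le> a" "a \<le> n" using a(1) x y by (metis atLeastAtMost_iff permutes_not_in)+
    have split: "{k \<in> {1..p}. P (w k)} = {k \<in> {1..<a}. P (w k)} \<union> {k \<in> {a..p}. P (w k)}"
      if "a \<le> p" for P p and w :: perm using that an by auto
    have cardsplit: "card {k \<in> {1..p}. P (w k)} = card {k \<in> {1..<a}. P (w k)} + card {k \<in> {a..p}. P (w k)}"
      if "a \<le> p" for P p and w :: perm
      unfolding split[OF that] by (rule card_Un_disjoint) auto
    have same: "{k \<in> {1..<a}. P (x k)} = {k \<in> {1..<a}. P (y k)}" for P
      using a(2) by auto
    have xya: "x a < y a"
    proof (rule ccontr)
      assume "\<not> ?thesis"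
      then have lt: "y a < x a" using a(1) by auto
      \<comment> \<open>At the corner \<open>(a, y a)\<close> the position a would be counted for x
        but not for y, while all earlier positions agree.\<close>
      have "{k \<in> {a..a}. y a < x k} = {a}" "{k \<in> {a..a}. y a < y k} = {}" using lt by auto
      then have "card {k \<in> {a..a}. y a < y k} < card {k \<in> {a..a}. y a < x k}" by simp
      then show False
        using rk[of a "y a"] cardsplit[OF order_refl, of "\<lambda>v. y a < v" x] cardsplit[OF order_refl, of "\<lambda>v. y a < v" y]
          arg_cong[OF same[of "\<lambda>v. y a < v"], of card]
        unfolding rk_def by linarith
    qed
    define B where "B = {j. a < j \<and> j \<le> n \<and> x a < x j \<and> x j \<le> y a}"
    have "B \<noteq> {}"
    proof -
      define j where "j = perm_inv x (y a)"
      have xj: "x j = y a" using x by (simp add: j_def permutes_inverses)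
      have "j \<noteq> a" using xj a(1) by auto
      moreover have "\<not> j < a" using a(2)[of j] xj permutes_neq[OF y, of j a] by auto
      ultimately have "a < j" by auto
      moreover have "j \<le> n"
        using permutes_inv_atLeastAtMost[OF x permutes_atLeastAtMost[OF y]] an by (simp add: j_def)
      ultimately have "j \<in> B" using xj xya by (simp add: B_def)
      then show ?thesis by auto
    qed
    define b where "b = (LEAST j. j \<in> B)"
    have "b \<in> B" using \<open>B \<noteq> {}\<close> unfolding b_def by (metis LeastI ex_in_conv)
    then have b: "a < b" "b \<le> n" "x a < x b" "x b \<le> y a" by (auto simp: B_def)
    have bmin: "\<not> (a < j \<and> j < b \<and> x a < x j \<and> x j \<le> y a)" for j
      using not_less_Least[of j "\<lambda>j. j \<in> B"] b by (auto simp: B_def b_def)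
    let ?x = "x \<circ> T a b"
    have x': "?x permutes {1..n}" using x an b by (intro permutes_comp_T) auto
    have "rk ?x p q \<le> rk y p q" for p q
    proof (cases "a \<le> p \<and> p < b \<and> x a \<le> q \<and> q < x b")
      case True
      have q: "q \<le> y a" using True b by auto
      let ?P = "\<lambda>v. q < v \<and> v \<le> y a"
      \<comment> \<open>By minimality of b, x takes no value in the interval from q to
        \<open>y a\<close> at the positions a to p, whereas y takes \<open>y a\<close> at a.
        Comparing both ranks with those at level \<open>y a\<close> leaves one unit to spare at
        level q.\<close>
      have "card {k \<in> {a..p}. ?P (x k)} = 0"
      proof -
        have "\<not> ?P (x k)" if "a \<le> k" "k \<le> p" for k
          using bmin[of k] True that by (cases "k = a") auto
        then have "{k \<in> {a..p}. ?P (x k)} = {}" by auto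
        then show ?thesis by simp
      qed
      moreover have "a \<in> {k \<in> {a..p}. ?P (y k)}" using True b by auto
      then have "card {k \<in> {a..p}. ?P (y k)} > 0" unfolding card_gt_0_iff by force
      ultimately have "card {k \<in> {1..p}. ?P (x k)} < card {k \<in> {1..p}. ?P (y k)}"
        using cardsplit[of p ?P x] cardsplit[of p ?P y] arg_cong[OF same[of ?P], of card] True by linarith
      moreover have "rk x p (y a) \<le> rk y p (y a)" using rk .
      ultimately have "rk x p q < rk y p q"
        using rk_split[OF q, of x p] rk_split[OF q, of y p] by simp
      then show ?thesis using rk_comp_T[of a b x p q] True an b by simp
    next
      case False
      then show ?thesis using rk_comp_T[of a b x p q] rk[of p q] an b by auto
    qed
    moreover have "inv_count n x < inv_count n ?x"
      using inv_count_comp_T[of a b n x] an b x by auto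
    moreover have "inv_count n ?x \<le> n * n"
    proof -
      have "inv_count n ?x \<le> card ({1..n} \<times> {1..n})"
        unfolding inv_count_def by (rule card_mono) (auto simp: index_pairs_def)
      then show ?thesis by simp
    qed
    ultimately have "bruhat_le n ?x y"
      by (intro less.hyps) (use x' y in auto)
    moreover have "bruhat_le n x ?x" using x an b by (intro bruhat_le_comp_T) auto
    ultimately show ?thesis using bruhat_le_trans by blast
  qed
qed

lemma bruhat_le_iff_rk:
  assumes "x permutes {1..n}" "y permutes {1..n}"
  shows "bruhat_le n x y \<longleftrightarrow> (\<forall>p q. rk x p q \<le> rk y p q)"
  using bruhat_le_if_rk_le[OF assms] bruhat_le_rk_le by blast

section \<open>Transpositions and 3-cycles below a permutation\<close>

text \<open>The index 0 is included to have a nonempty set for every i; a permutation of {1..n}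
  fixes 0, so the maximum is not affected.\<close>

definition pmax :: "perm \<Rightarrow> nat \<Rightarrow> nat" where
  "pmax w i = Max (w ` {..i})"

text \<open>The function m of the overview. It is nondecreasing and satisfies m(i) \<ge> i, that is,
  it is a Hessenberg function.\<close>

definition hess :: "perm \<Rightarrow> nat \<Rightarrow> nat" where
  "hess w i = min (pmax w i) (pmax (perm_inv w) i)"

lemma le_pmax_iff: "j \<le> pmax w i \<longleftrightarrow> (\<exists>k\<le>i. j \<le> w k)"
  unfolding pmax_def by (subst Max_ge_iff) auto

lemma pmax_le_iff: "pmax w i \<le> j \<longleftrightarrow> (\<forall>k\<le>i. w k \<le> j)"
  unfolding pmax_def by (subst Max_le_iff) auto

lemma le_pmax: "k \<le> i \<Longrightarrow> w k \<le> pmax w i"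
  using le_pmax_iff by blast

lemma pmax_mono: "i \<le> i' \<Longrightarrow> pmax w i \<le> pmax w i'"
  unfolding pmax_le_iff by (auto intro: le_pmax)

lemma permutes_fix_zero: "w permutes {1..n::nat} \<Longrightarrow> w 0 = 0"
  by (rule permutes_not_in) auto

lemma le_pmax_self:
  assumes w: "w permutes {1..n::nat}"
  shows "i \<le> pmax w i"
proof (rule ccontr)
  assume "\<not> ?thesis"
  then have "w k < i" if "k \<le> i" for k using le_pmax[OF that, of w] by simp
  then have "w ` {..i} \<subseteq> {..<i}" by auto
  then have "card (w ` {..i}) \<le> i" by (metis card_lessThan card_mono finite_lessThan)
  moreover have "card (w ` {..i}) = Suc i"
    using card_image[OF permutes_inj_on[OF w, of "{..i}"]] by simp
  ultimately show False by simp
qed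

lemma pmax_le_n:
  assumes "w permutes {1..n::nat}" "i \<le> n"
  shows "pmax w i \<le> n"
  unfolding pmax_le_iff
proof (intro allI impI)
  fix k assume "k \<le> i"
  then show "w k \<le> n"
    using permutes_atLeastAtMost[OF assms(1), of k] permutes_fix_zero[OF assms(1)] assms(2)
    by (cases "k = 0") auto
qed

lemma hess_mono: "i \<le> i' \<Longrightarrow> hess w i \<le> hess w i'"
  unfolding hess_def using pmax_mono[of i i' w] pmax_mono[of i i' "perm_inv w"] by linarith

lemma le_hess_self: "w permutes {1..n::nat} \<Longrightarrow> i \<le> hess w i"
  unfolding hess_def using le_pmax_self permutes_inv by fastforce

lemma hess_le_n: "w permutes {1..n::nat} \<Longrightarrow> i \<le> n \<Longrightarrow> hess w i \<le> n"
  unfolding hess_def using pmax_le_n[of w n i] by linarith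

lemma perm_inv_inv: "w permutes S \<Longrightarrow> perm_inv (perm_inv w) = w"
  using permutes_inv_inv .

lemma hess_inv: "w permutes S \<Longrightarrow> hess (perm_inv w) i = hess w i"
  unfolding hess_def by (subst perm_inv_inv) auto

text \<open>Among the q values at most q, those not placed at the first p positions are placed after
  p. Hence the first p positions contain the p - q large values present already for the identity,
  plus one for each small value displaced beyond p. The excess is thus a rank of the inverse
  permutation.\<close>

lemma rk_exact:
  assumes w: "w permutes {1..n::nat}" and "q \<le> p"
  shows "rk w p q = (p - q) + card {k \<in> {1..q}. p < perm_inv w k}"
proof -
  let ?A = "{k \<in> {1..p}. w k \<le> q}" and ?B = "{k \<in> {1..q}. p < perm_inv w k}"
  have "{1..p} = {k \<in> {1..p}. q < w k} \<union> ?A" by auto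
  then have "card {1..p} = card {k \<in> {1..p}. q < w k} + card ?A"
    by (metis (no_types, lifting) card_Un_disjoint disjoint_iff finite_Un finite_atLeastAtMost leD mem_Collect_eq)
  then have 1: "p = rk w p q + card ?A" by (simp add: rk_def)
  have pos: "1 \<le> w k \<longleftrightarrow> 1 \<le> k" for k
    using permutes_atLeastAtMost[OF w, of k] permutes_fix_zero[OF w] permutes_not_in[OF w, of k]
    by (cases "k = 0"; cases "k \<le> n") auto
  have "{1..q} = w ` ?A \<union> ?B"
  proof (intro equalityI subsetI)
    fix k assume k: "k \<in> {1..q}"
    then have "w (perm_inv w k) = k" using permutes_inverses(1)[OF w] by simp
    then show "k \<in> w ` ?A \<union> ?B" using k pos[of "perm_inv w k"] by (cases "p < perm_inv w k") force+
  next
    fix k assume "k \<in> w ` ?A \<union> ?B"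
    then show "k \<in> {1..q}" using pos by auto
  qed
  moreover have "w ` ?A \<inter> ?B = {}" using permutes_inverses(2)[OF w] by auto
  ultimately have "card {1..q} = card (w ` ?A) + card ?B"
    by (metis (no_types, lifting) card_Un_disjoint finite_Un finite_atLeastAtMost)
  moreover have "card (w ` ?A) = card ?A" by (rule card_image) (rule permutes_inj_on[OF w])
  ultimately have "q = card ?A + card ?B" by simp
  then show ?thesis using 1 assms(2) by linarith
qed

text \<open>On one side of the diagonal w has larger rank than the identity according to the maxima
  of w, on the other side (\<open>rk_excess_iff2\<close>) according to those of its inverse. This is
  why \<open>hess\<close> combines both.\<close>

lemma rk_excess_iff1:
  assumes "w permutes {1..n}" "p \<le> q"
  shows "p - q < rk w p q \<longleftrightarrow> q < pmax w p"
proof -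
  have "0 < rk w p q \<longleftrightarrow> (\<exists>k\<in>{1..p}. q < w k)" by (auto simp: rk_def card_gt_0_iff)
  also have "\<dots> \<longleftrightarrow> (\<exists>k\<le>p. Suc q \<le> w k)"
    using permutes_fix_zero[OF assms(1)] by (metis Suc_le_eq atLeastAtMost_iff less_one not_less not_less_zero)
  finally show ?thesis using assms(2) le_pmax_iff[of "Suc q" w p] by (simp add: Suc_le_eq)
qed

lemma rk_excess_iff2:
  assumes "w permutes {1..n}" "q \<le> p"
  shows "p - q < rk w p q \<longleftrightarrow> p < pmax (perm_inv w) q"
proof -
  have "p - q < rk w p q \<longleftrightarrow> 0 < card {k \<in> {1..q}. p < perm_inv w k}"
    unfolding rk_exact[OF assms] by simp
  also have "\<dots> \<longleftrightarrow> (\<exists>k\<in>{1..q}. p < perm_inv w k)" by (auto simp: card_gt_0_iff)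
  also have "\<dots> \<longleftrightarrow> (\<exists>k\<le>q. Suc p \<le> perm_inv w k)"
    using permutes_fix_zero[OF permutes_inv[OF assms(1)]]
    by (metis Suc_le_eq atLeastAtMost_iff less_one not_less not_less_zero)
  finally show ?thesis using le_pmax_iff[of "Suc p" "perm_inv w" q] by (simp add: Suc_le_eq)
qed

lemma rk_ge: "w permutes {1..n} \<Longrightarrow> p - q \<le> rk w p q"
  using rk_exact[of w n q p] by (cases "q \<le> p") auto

lemma rk_id: "rk id p q = p - q"
proof -
  have "{k \<in> {1..p}. q < id k} = {Suc q..p}" by auto
  then show ?thesis by (simp add: rk_def)
qed

lemma rk_T: "1 \<le> i \<Longrightarrow> i < j \<Longrightarrow> rk (T i j) p q = p - q + of_bool (i \<le> p \<and> p < j \<and> i \<le> q \<and> q < j)"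
  using rk_comp_T[of i j id p q] by (simp add: rk_id)

text \<open>\<open>R3 i j k\<close> arises from \<open>T i j\<close> by the ascent at the positions
  j < k with values i < k, which adds a second rectangle, disjoint from the first, on which the rank
  exceeds that of the identity.\<close>

lemma rk_R3:
  assumes "1 \<le> i" "i < j" "j < k"
  shows "rk (R3 i j k) p q = p - q + of_bool (i \<le> p \<and> p < j \<and> i \<le> q \<and> q < j)
     + of_bool (j \<le> p \<and> p < k \<and> i \<le> q \<and> q < k)"
proof -
  have "T i j j < T i j k" using assms by simp
  then show ?thesis using rk_comp_T[of j k "T i j" p q] rk_T[of i j p q] assms by (simp add: R3_def)
qed

text \<open>The rank of \<open>T i j\<close> exceeds that of the identity, by one, on a square.
  Since the maxima are nondecreasing, the conditions there follow from those at the two corners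
  \<open>(i, j - 1)\<close> and \<open>(j - 1, i)\<close>.\<close>

lemma T_le_iff:
  assumes w: "w permutes {1..n}" and ij: "1 \<le> i" "i < j" "j \<le> n"
  shows "bruhat_le n (T i j) w \<longleftrightarrow> j \<le> hess w i"
proof -
  have "bruhat_le n (T i j) w \<longleftrightarrow> (\<forall>p q. rk (T i j) p q \<le> rk w p q)"
    by (rule bruhat_le_iff_rk[OF transp_permutes w]) (use ij in auto)
  also have "\<dots> \<longleftrightarrow> (\<forall>p q. i \<le> p \<and> p < j \<and> i \<le> q \<and> q < j \<longrightarrow> p - q < rk w p q)"
    using rk_ge[OF w] ij by (auto simp: rk_T Suc_le_eq)
  also have "\<dots> \<longleftrightarrow> j \<le> hess w i"
  proof
    assume L: "\<forall>p q. i \<le> p \<and> p < j \<and> i \<le> q \<and> q < j \<longrightarrow> p - q < rk w p q"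
    have "j - 1 < pmax w i" using L[rule_format, of i "j - 1"] rk_excess_iff1[OF w, of i "j - 1"] ij by auto
    moreover have "j - 1 < pmax (perm_inv w) i"
      using L[rule_format, of "j - 1" i] rk_excess_iff2[OF w, of i "j - 1"] ij by auto
    ultimately have "j \<le> pmax w i" "j \<le> pmax (perm_inv w) i" by linarith+
    then show "j \<le> hess w i" by (simp add: hess_def)
  next
    assume R: "j \<le> hess w i"
    show "\<forall>p q. i \<le> p \<and> p < j \<and> i \<le> q \<and> q < j \<longrightarrow> p - q < rk w p q"
    proof (intro allI impI)
      fix p q assume pq: "i \<le> p \<and> p < j \<and> i \<le> q \<and> q < j"
      show "p - q < rk w p q"
      proof (cases "p \<le> q")
        case True
        then show ?thesis using rk_excess_iff1[OF w True] pmax_mono[of i p w] R pq by (simp add: hess_def)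
      next
        case False
        then have "q \<le> p" by simp
        then show ?thesis using rk_excess_iff2[OF w, of q p] pmax_mono[of i q "perm_inv w"] R pq
          by (simp add: hess_def)
      qed
    qed
  qed
  finally show ?thesis .
qed

lemma R3_permutes: "1 \<le> i \<Longrightarrow> i < j \<Longrightarrow> j < k \<Longrightarrow> k \<le> n \<Longrightarrow> R3 i j k permutes {1..n}"
  unfolding R3_def by (rule permutes_compose) (rule transp_permutes; simp)+

text \<open>The two rectangles of \<open>R3 i j k\<close> form an L-shaped region, and monotonicity
  of the maxima reduces the conditions on it to its corners \<open>(i, j - 1)\<close>,
  \<open>(j, k - 1)\<close> and \<open>(k - 1, i)\<close>.\<close>

lemma R3_le_iff:
  assumes w: "w permutes {1..n}" and ij: "1 \<le> i" "i < j" "j < k" "k \<le> n"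
  shows "bruhat_le n (R3 i j k) w \<longleftrightarrow> j \<le> pmax w i \<and> k \<le> pmax w j \<and> k \<le> pmax (perm_inv w) i"
proof -
  let ?A = "\<lambda>p q. i \<le> p \<and> p < j \<and> i \<le> q \<and> q < j" and ?B = "\<lambda>p q. j \<le> p \<and> p < k \<and> i \<le> q \<and> q < k"
  have "bruhat_le n (R3 i j k) w \<longleftrightarrow> (\<forall>p q. rk (R3 i j k) p q \<le> rk w p q)"
    by (rule bruhat_le_iff_rk[OF R3_permutes w]) (use ij in auto)
  also have "\<dots> \<longleftrightarrow> (\<forall>p q. ?A p q \<or> ?B p q \<longrightarrow> p - q < rk w p q)"
  proof -
    have "rk (R3 i j k) p q \<le> rk w p q \<longleftrightarrow> (?A p q \<or> ?B p q \<longrightarrow> p - q < rk w p q)" for p q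
      unfolding rk_R3[OF ij(1-3)] using rk_ge[OF w, of p q] by (cases "?A p q"; cases "?B p q") auto
    then show ?thesis by simp
  qed
  also have "\<dots> \<longleftrightarrow> j \<le> pmax w i \<and> k \<le> pmax w j \<and> k \<le> pmax (perm_inv w) i"
  proof
    assume L: "\<forall>p q. ?A p q \<or> ?B p q \<longrightarrow> p - q < rk w p q"
    have "j - 1 < pmax w i" using L[rule_format, of i "j - 1"] rk_excess_iff1[OF w, of i "j - 1"] ij by auto
    moreover have "k - 1 < pmax w j" using L[rule_format, of j "k - 1"] rk_excess_iff1[OF w, of j "k - 1"] ij by auto
    moreover have "k - 1 < pmax (perm_inv w) i"
      using L[rule_format, of "k - 1" i] rk_excess_iff2[OF w, of i "k - 1"] ij by linarith
    ultimately show "j \<le> pmax w i \<and> k \<le> pmax w j \<and> k \<le> pmax (perm_inv w) i" by linarith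
  next
    assume R: "j \<le> pmax w i \<and> k \<le> pmax w j \<and> k \<le> pmax (perm_inv w) i"
    show "\<forall>p q. ?A p q \<or> ?B p q \<longrightarrow> p - q < rk w p q"
    proof (intro allI impI)
      fix p q assume pq: "?A p q \<or> ?B p q"
      show "p - q < rk w p q"
      proof (cases "p \<le> q")
        case True
        then show ?thesis
          using rk_excess_iff1[OF w True] pmax_mono[of i p w] pmax_mono[of j p w] R pq by auto
      next
        case False
        then have "q \<le> p" by simp
        then show ?thesis using rk_excess_iff2[OF w, of q p] pmax_mono[of i q "perm_inv w"] R pq ij by auto
      qed
    qed
  qed
  finally show ?thesis .
qed

text \<open>No bound by n is imposed: beyond n the value of \<open>hess w\<close> at i is i, so
  there are no pairs.\<close>

definition hess_pairs :: "perm \<Rightarrow> (nat \<times> nat) set" where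
  "hess_pairs w = {(i, j). 1 \<le> i \<and> i < j \<and> j \<le> hess w i}"

definition hess_sum :: "nat \<Rightarrow> perm \<Rightarrow> nat" where
  "hess_sum n w = (\<Sum>i = 1..n. hess w i - i)"

section \<open>Counting the transpositions below a permutation\<close>

lemma T_eq_iff: "i < j \<Longrightarrow> k < l \<Longrightarrow> T i j = T k l \<longleftrightarrow> i = k \<and> j = (l::nat)"
  by (metis not_less_iff_gr_or_eq transpose_apply_first transpose_apply_second transpose_eq_imp_eq transpose_apply_other)

lemma pmax_above:
  assumes w: "w permutes {1..n::nat}" and "n \<le> i"
  shows "pmax w i = i"
proof (rule antisym)
  show "pmax w i \<le> i" unfolding pmax_le_iff
  proof (intro allI impI)
    fix k assume "k \<le> i"
    then show "w k \<le> i"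
      using permutes_atLeastAtMost[OF w, of k] permutes_not_in[OF w, of k] assms(2)
      by (cases "1 \<le> k \<and> k \<le> n") auto
  qed
qed (rule le_pmax_self[OF w])

lemma hess_pairs_le:
  assumes w: "w permutes {1..n::nat}" and "(i, j) \<in> hess_pairs w"
  shows "1 \<le> i \<and> i < j \<and> j \<le> n"
proof -
  have "hess w i \<le> n"
  proof (cases "i \<le> n")
    case False
    then have "hess w i \<le> i" using pmax_above[OF w, of i] by (simp add: hess_def)
    then show ?thesis using assms(2) by (auto simp: hess_pairs_def)
  qed (rule hess_le_n[OF w])
  then show ?thesis using assms(2) by (auto simp: hess_pairs_def)
qed

lemma CT_below_eq:
  assumes w: "w permutes {1..n}"
  shows "CT_below n w = (\<lambda>(i, j). T i j) ` hess_pairs w"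
proof (intro equalityI subsetI)
  fix t assume "t \<in> CT_below n w"
  then obtain i j where "t = T i j" "1 \<le> i" "i < j" "j \<le> n" "bruhat_le n (T i j) w"
    by (auto simp: CT_below_def transpositions_def)
  then show "t \<in> (\<lambda>(i, j). T i j) ` hess_pairs w"
    using T_le_iff[OF w, of i j] by (auto simp: hess_pairs_def)
next
  fix t assume "t \<in> (\<lambda>(i, j). T i j) ` hess_pairs w"
  then obtain i j where ij: "t = T i j" "(i, j) \<in> hess_pairs w" by auto
  then have "1 \<le> i" "i < j" "j \<le> n" using hess_pairs_le[OF w] by auto
  then show "t \<in> CT_below n w"
    using T_le_iff[OF w, of i j] ij by (auto simp: CT_below_def transpositions_def hess_pairs_def)
qed

lemma inj_on_T_pairs: "inj_on (\<lambda>(i, j). T i j) (hess_pairs w)"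
  by (auto simp: inj_on_def hess_pairs_def T_eq_iff)

lemma hess_pairs_Sigma:
  assumes w: "w permutes {1..n}"
  shows "hess_pairs w = (SIGMA i:{1..n}. {i<..hess w i})"
proof (intro equalityI subrelI)
  fix i j assume "(i, j) \<in> hess_pairs w"
  then show "(i, j) \<in> (SIGMA i:{1..n}. {i<..hess w i})"
    using hess_pairs_le[OF w, of i j] by (simp add: hess_pairs_def)
qed (auto simp: hess_pairs_def)

lemma card_CT_below:
  assumes w: "w permutes {1..n}"
  shows "card (CT_below n w) = hess_sum n w"
proof -
  have "card (CT_below n w) = card (hess_pairs w)"
    unfolding CT_below_eq[OF w] by (rule card_image[OF inj_on_T_pairs])
  also have "\<dots> = hess_sum n w"
    unfolding hess_pairs_Sigma[OF w] hess_sum_def by (subst card_SigmaI) auto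
  finally show ?thesis .
qed

section \<open>Splitting off a cycle\<close>

text \<open>The cycle c of the overview, given by its values so that its effect on inversions and
  maxima can be read off; \<open>pair_prod_cyc\<close> writes it as a product of
  transpositions.\<close>

definition cyc :: "nat \<Rightarrow> nat \<Rightarrow> perm" where
  "cyc p r x = (if x = p then r else if p < x \<and> x \<le> r then x - 1 else x)"

definition cyc_inv :: "nat \<Rightarrow> nat \<Rightarrow> perm" where
  "cyc_inv p r x = (if x = r then p else if p \<le> x \<and> x < r then Suc x else x)"

lemma cyc_cyc_inv: "p \<le> r \<Longrightarrow> cyc p r (cyc_inv p r x) = x" "p \<le> r \<Longrightarrow> cyc_inv p r (cyc p r x) = x"
  by (auto simp: cyc_def cyc_inv_def)

lemma cyc_permutes: "p \<le> r \<Longrightarrow> r \<le> n \<Longrightarrow> cyc p r permutes {p..n}"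
  by (rule bij_imp_permutes) (auto intro!: bij_betwI[where g = "cyc_inv p r"] simp: cyc_def cyc_inv_def)

lemma perm_inv_cyc: "p \<le> r \<Longrightarrow> perm_inv (cyc p r) = cyc_inv p r"
  by (rule inv_equality) (auto simp: cyc_cyc_inv)

lemma cyc_inv_permutes: "p \<le> r \<Longrightarrow> r \<le> n \<Longrightarrow> cyc_inv p r permutes {p..n}"
  using permutes_inv[OF cyc_permutes] perm_inv_cyc by metis

lemma permutes_1: "w permutes {p..n::nat} \<Longrightarrow> 1 \<le> p \<Longrightarrow> w permutes {1..n}"
  by (rule permutes_subset) auto

lemma permutes_ge: "w permutes {p..n::nat} \<Longrightarrow> p \<le> x \<Longrightarrow> p \<le> w x"
  using permutes_in_image[of w "{p..n}" x] permutes_not_in[of w "{p..n}" x] by (cases "x \<le> n") auto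

lemma permutes_le: "w permutes {p..n::nat} \<Longrightarrow> x \<le> n \<Longrightarrow> w x \<le> n"
  using permutes_in_image[of w "{p..n}" x] permutes_not_in[of w "{p..n}" x] by (cases "p \<le> x") auto

lemma permutes_below: "w permutes {p..n::nat} \<Longrightarrow> x < p \<Longrightarrow> w x = x"
  by (rule permutes_not_in) auto

lemma inv_count_inv:
  assumes w: "w permutes {1..n}"
  shows "inv_count n (perm_inv w) = inv_count n w"
proof -
  let ?I = "\<lambda>v :: perm. {(i, j) \<in> index_pairs n. v j < v i}"
  have "bij_betw (\<lambda>(i, j). (w j, w i)) (?I w) (?I (perm_inv w))"
    by (rule bij_betwI[where g = "\<lambda>(i, j). (perm_inv w j, perm_inv w i)"])
       (use w permutes_atLeastAtMost[OF w] permutes_inv_atLeastAtMost[OF w] in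
         \<open>auto simp: index_pairs_def permutes_inverses\<close>)
  then show ?thesis unfolding inv_count_def by (simp add: bij_betw_same_card)
qed

text \<open>The cycle preserves the order of all values except p, and u has the value p at p. So the
  inversions of u survive, and the new ones are the pairs \<open>(p, j)\<close> with
  \<open>u j\<close> in {p<..r}, of which there are r - p.\<close>

lemma inv_count_cyc_comp:
  assumes u: "u permutes {Suc p..n}" and p: "1 \<le> p" "p \<le> r" "r \<le> n"
  shows "inv_count n (cyc p r \<circ> u) = (r - p) + inv_count n u"
proof -
  let ?w = "cyc p r \<circ> u"
  let ?I = "\<lambda>v :: perm. {(i, j) \<in> index_pairs n. v j < v i}"
  let ?J = "perm_inv u ` {p<..r}"
  have up: "u p = p" using permutes_below[OF u] by simp
  have ge: "p < u x \<longleftrightarrow> p < x" for x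
    using permutes_ge[OF u, of x] permutes_below[OF u, of x] by (cases "p < x") auto
  have lt: "cyc p r x < cyc p r y \<longleftrightarrow> x < y" if "x \<noteq> p" "y \<noteq> p" for x y
    using that by (auto simp: cyc_def)
  have ne: "u x = p \<longleftrightarrow> x = p" for x
    using up permutes_neq[OF u, of x p] by auto
  have "?I ?w = ?I u \<union> Pair p ` ?J"
  proof (intro equalityI subrelI)
    fix i j assume ij: "(i, j) \<in> ?I ?w"
    show "(i, j) \<in> ?I u \<union> Pair p ` ?J"
    proof (cases "i = p")
      case True
      then have j: "p < j" "j \<le> n" "cyc p r (u j) < r" using ij up by (auto simp: index_pairs_def cyc_def)
      then have "u j \<in> {p<..r}" using ge[of j] by (auto simp: cyc_def split: if_splits)
      then have "j \<in> ?J" by (intro image_eqI[of _ _ "u j"]) (simp_all add: permutes_inverses(2)[OF u])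
      then show ?thesis using True by auto
    next
      case False
      have "j \<noteq> p"
      proof
        assume "j = p"
        then have "u i = i" "i < p" using ij permutes_below[OF u, of i] by (auto simp: index_pairs_def)
        then show False using ij \<open>j = p\<close> up p by (auto simp: cyc_def)
      qed
      then show ?thesis using False ij lt[of "u j" "u i"] ne by auto
    qed
  next
    fix i j assume "(i, j) \<in> ?I u \<union> Pair p ` ?J"
    then show "(i, j) \<in> ?I ?w"
    proof
      assume ij: "(i, j) \<in> ?I u"
      have "i \<noteq> p" using ij up ge[of j] by (auto simp: index_pairs_def)
      moreover have "j \<noteq> p" using ij up ge[of i] by (auto simp: index_pairs_def permutes_below[OF u])
      ultimately show ?thesis using ij lt[of "u j" "u i"] ne by auto
    next
      assume "(i, j) \<in> Pair p ` ?J"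
      then obtain v where v: "i = p" "j = perm_inv u v" "p < v" "v \<le> r" by auto
      have "u j = v" using v permutes_inverses(1)[OF u] by simp
      moreover have "p < j" using v(3) ge[of j] calculation by simp
      moreover have "j \<le> n" using v permutes_le[OF permutes_inv[OF u], of v] p by auto
      ultimately show ?thesis using v p up by (auto simp: index_pairs_def cyc_def)
    qed
  qed
  moreover have "?I u \<inter> Pair p ` ?J = {}"
    using up permutes_below[OF u] by (auto simp: index_pairs_def) (metis ge less_asym)
  moreover have "card (Pair p ` ?J) = r - p"
  proof -
    have "card (Pair p ` ?J) = card ?J" by (rule card_image) (simp add: inj_on_def)
    also have "\<dots> = card {p<..r}" by (rule card_image) (rule permutes_inj_on[OF permutes_inv[OF u]])
    finally show ?thesis by simp
  qed
  moreover have "finite (?I u)" by (rule finite_subset[OF _ finite_index_pairs[of n]]) auto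
  ultimately show ?thesis
    unfolding inv_count_def by (subst \<open>?I ?w = _\<close>, subst card_Un_disjoint) auto
qed

lemma cyc_inv_comp_permutes:
  assumes w: "w permutes {p..n}" and p: "p \<le> n"
  shows "cyc_inv p (w p) \<circ> w permutes {Suc p..n}"
proof -
  have r: "p \<le> w p" "w p \<le> n" using permutes_ge[OF w, of p] permutes_le[OF w, of p] p by auto
  have "cyc_inv p (w p) \<circ> w permutes {p..n}"
    by (rule permutes_compose[OF w cyc_inv_permutes[OF r]])
  then have "cyc_inv p (w p) \<circ> w permutes ({p..n} - {p})"
    by (rule permutes_superset) (simp add: cyc_inv_def, auto)?
  moreover have "{p..n} - {p} = {Suc p..n}" by auto
  ultimately show ?thesis by simp
qed

lemma comp_cyc_inv_cancel: "p \<le> r \<Longrightarrow> cyc p r \<circ> (cyc_inv p r \<circ> w) = w"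
  by (auto simp: fun_eq_iff cyc_cyc_inv)

lemma perm_inv_cyc_inv_comp:
  assumes "w permutes S" "p \<le> r" "r \<le> n"
  shows "perm_inv (cyc_inv p r \<circ> w) = perm_inv w \<circ> cyc p r"
proof (rule inv_equality)
  show "(perm_inv w \<circ> cyc p r) ((cyc_inv p r \<circ> w) x) = x" for x
    using assms by (simp add: cyc_cyc_inv permutes_inverses)
  show "(cyc_inv p r \<circ> w) ((perm_inv w \<circ> cyc p r) x) = x" for x
    using assms by (simp add: cyc_cyc_inv permutes_inverses)
qed

lemma pmax_below:
  assumes w: "w permutes {p..n}" and "i < p"
  shows "pmax w i = i"
proof (rule antisym)
  show "pmax w i \<le> i" unfolding pmax_le_iff using permutes_below[OF w] assms(2) by auto
  show "i \<le> pmax w i" using le_pmax[of i i w] permutes_below[OF w assms(2)] by simp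
qed

lemma pmax_first:
  assumes w: "w permutes {p..n}"
  shows "pmax w p = w p"
proof (rule antisym)
  have "w k \<le> w p" if "k \<le> p" for k
    using permutes_below[OF w, of k] permutes_ge[OF w, of p] that by (cases "k = p") auto
  then show "pmax w p \<le> w p" unfolding pmax_le_iff by blast
qed (rule le_pmax, simp)

lemma hess_below: "w permutes {p..n} \<Longrightarrow> i < p \<Longrightarrow> hess w i = i"
  using pmax_below[of w p n i] pmax_below[of "perm_inv w" p n i] permutes_inv[of w] by (simp add: hess_def)

lemma hess_first: "w permutes {p..n} \<Longrightarrow> hess w p = min (w p) (perm_inv w p)"
  using pmax_first[of w p n] pmax_first[of "perm_inv w" p n] permutes_inv[of w] by (simp add: hess_def)

text \<open>
  The assumption \<open>w p \<le> perm_inv w p\<close> is harmless: otherwise \<open>w\<close> is replaced by its inverse, which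
  changes neither \<open>hess w\<close> nor the number of inversions.
\<close>

locale split_off =
  fixes n p :: nat and w :: perm
  assumes p: "1 \<le> p" "p \<le> n" and w: "w permutes {p..n}" and le: "w p \<le> perm_inv w p"
begin

abbreviation "r \<equiv> w p"
definition w' :: perm where "w' = cyc_inv p (w p) \<circ> w"

lemma w'_apply: "w' x = cyc_inv p r (w x)"
  by (simp add: w'_def)

lemma r: "p \<le> r" "r \<le> n"
  using permutes_ge[OF w, of p] permutes_le[OF w, of p] p by auto

lemma w': "w' permutes {Suc p..n}"
  unfolding w'_def by (rule cyc_inv_comp_permutes[OF w p(2)])

lemma w1: "w permutes {1..n}" using permutes_1[OF w] p by simp
lemma w'1: "w' permutes {1..n}" using permutes_1[OF w'] p by simp

lemma w_eq: "w = cyc p r \<circ> w'"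
  unfolding w'_def by (rule comp_cyc_inv_cancel[OF r(1), symmetric])

lemma inv_w': "perm_inv w' = perm_inv w \<circ> cyc p r"
  unfolding w'_def by (rule perm_inv_cyc_inv_comp[OF w r])

lemma inv_count_w: "inv_count n w = (r - p) + inv_count n w'"
  using inv_count_cyc_comp[OF w' p(1) r] unfolding w_eq[symmetric] .

lemma hess_p: "hess w p = r"
  using hess_first[OF w] le by simp

text \<open>The inverse cycle raises only values in {p..<r}, and to at most r; since r =
  \<open>w p\<close> with p < i, it is already counted in the maximum of w.\<close>

lemma pmax_w'_le:
  assumes "p < i"
  shows "pmax w' i \<le> pmax w i"
  unfolding pmax_le_iff
proof (intro allI impI)
  fix k assume k: "k \<le> i"
  have "r \<le> pmax w i" "w k \<le> pmax w i" "i \<le> pmax w i"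
    using le_pmax[of p i w] le_pmax[of k i w] k assms le_pmax_self[OF w1] by auto
  then show "w' k \<le> pmax w i" using assms by (auto simp: w'_apply cyc_inv_def)
qed

text \<open>The cycle lowers each index in {p<..i} by one, hence the sharper bound at i - 1; the
  exceptional index p is sent to r, where the inverse of w has the value p. The gain of one index is
  decisive for \<open>tight_hess_hess_le\<close> and \<open>tight_decreasing\<close>.\<close>

lemma pmax_inv_w'_le':
  assumes "p < i" "i \<le> r"
  shows "pmax (perm_inv w') i \<le> pmax (perm_inv w) (i - 1)"
  unfolding pmax_le_iff
proof (intro allI impI)
  fix k assume k: "k \<le> i"
  show "perm_inv w' k \<le> pmax (perm_inv w) (i - 1)"
  proof (cases "k = p")
    case True
    have "perm_inv w r = p" using permutes_inverses(2)[OF w] by simp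
    then show ?thesis using True le_pmax_self[OF permutes_inv[OF w1], of "i - 1"] assms
      unfolding inv_w' by (simp add: cyc_def)
  next
    case False
    then have "cyc p r k \<le> i - 1" using k assms by (auto simp: cyc_def)
    then show ?thesis unfolding inv_w' using le_pmax[of "cyc p r k" "i - 1" "perm_inv w"] by simp
  qed
qed

lemma pmax_inv_w'_le:
  assumes "p < i"
  shows "pmax (perm_inv w') i \<le> pmax (perm_inv w) i"
proof (cases "i \<le> r")
  case True
  then show ?thesis using pmax_inv_w'_le'[OF assms True] pmax_mono[of "i - 1" i "perm_inv w"] by linarith
next
  case False
  show ?thesis unfolding pmax_le_iff
  proof (intro allI impI)
    fix k assume k: "k \<le> i"
    then have "cyc p r k \<le> i" using False assms by (auto simp: cyc_def)
    then show "perm_inv w' k \<le> pmax (perm_inv w) i"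
      unfolding inv_w' using le_pmax[of "cyc p r k" i "perm_inv w"] by simp
  qed
qed

lemma hess_w'_le: "p < i \<Longrightarrow> hess w' i \<le> hess w i"
  using pmax_w'_le[of i] pmax_inv_w'_le[of i] by (auto simp: hess_def)

lemma hess_w'_below: "i \<le> p \<Longrightarrow> hess w' i = i"
  using hess_below[OF w', of i] by simp

lemma hess_sum_w': "hess_sum n w = (r - p) + hess_sum n w' + (\<Sum>i \<in> {p<..n}. hess w i - hess w' i)"
proof -
  have "{1..n} = {1..<p} \<union> {p} \<union> {p<..n}" using p by auto
  then have split: "(\<Sum>i = 1..n. g i) = (\<Sum>i \<in> {1..<p}. g i) + g p + (\<Sum>i \<in> {p<..n}. g i)" for g :: "nat \<Rightarrow> nat"
    by (simp only:) (subst sum.union_disjoint; auto)+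
  have *: "hess w i - i = (hess w' i - i) + (hess w i - hess w' i)" if "p < i" for i
    using hess_w'_le[OF that] le_hess_self[OF w'1, of i] by simp
  have "hess_sum n w = (r - p) + (\<Sum>i \<in> {p<..n}. hess w i - i)"
    unfolding hess_sum_def split using hess_below[OF w] hess_p by simp
  also have "(\<Sum>i \<in> {p<..n}. hess w i - i) = (\<Sum>i \<in> {p<..n}. hess w' i - i) + (\<Sum>i \<in> {p<..n}. hess w i - hess w' i)"
    by (subst sum.distrib[symmetric], rule sum.cong[OF refl], rule *) auto
  also have "(\<Sum>i \<in> {p<..n}. hess w' i - i) = hess_sum n w'"
    unfolding hess_sum_def split using hess_w'_below by simp
  finally show ?thesis by simp
qed

end

text \<open>Induction on the number of points left to move: either w or its inverse satisfies the
  hypothesis of \<open>split_off\<close>, so it suffices that P passes from an inverse to w and from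
  \<open>w'\<close> to w.\<close>

lemma split_off_induct [consumes 2, case_names id inverse step]:
  assumes "w permutes {p..n}" "1 \<le> p"
    and id: "\<And>p. P p id"
    and inverse: "\<And>p w. w permutes {p..n} \<Longrightarrow> 1 \<le> p \<Longrightarrow> P p (perm_inv w) \<Longrightarrow> P p w"
    and step: "\<And>p w. split_off n p w \<Longrightarrow> P (Suc p) (cyc_inv p (w p) \<circ> w) \<Longrightarrow> P p w"
  shows "P p w"
  using assms(1,2)
proof (induction "Suc n - p" arbitrary: p w)
  case 0
  then have "{p..n} = {}" by auto
  then have "w = id" using 0 by simp
  show ?case unfolding \<open>w = id\<close> by (rule id)
next
  case (Suc d)
  then have p: "p \<le> n" by simp
  have *: "P p v" if v: "v permutes {p..n}" "v p \<le> perm_inv v p" for v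
  proof -
    have "split_off n p v" using v Suc.prems p by unfold_locales auto
    moreover have "P (Suc p) (cyc_inv p (v p) \<circ> v)"
      by (rule Suc.hyps(1)) (use Suc cyc_inv_comp_permutes[OF v(1) p] in auto)
    ultimately show ?thesis by (rule step)
  qed
  show ?case
  proof (cases "w p \<le> perm_inv w p")
    case True
    then show ?thesis using * Suc.prems by blast
  next
    case False
    then have "P p (perm_inv w)"
      by (intro *) (use Suc.prems permutes_inv perm_inv_inv[OF Suc.prems(1)] in auto)
    then show ?thesis using inverse Suc.prems by blast
  qed
qed

lemma hess_sum_inv: "w permutes {1..n} \<Longrightarrow> hess_sum n (perm_inv w) = hess_sum n w"
  by (simp add: hess_sum_def hess_inv)

text \<open>Splitting off a cycle removes exactly r - p inversions and at least r - p from the sum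
  of m(i) - i.\<close>

lemma inv_count_le_hess_sum:
  assumes "w permutes {p..n}" "1 \<le> p"
  shows "inv_count n w \<le> hess_sum n w"
  using assms
proof (induction rule: split_off_induct)
  case (inverse p w)
  then show ?case using permutes_1 hess_sum_inv inv_count_inv by metis
next
  case (step p w)
  then interpret split_off n p w by simp
  show ?case using step.IH hess_sum_w' inv_count_w unfolding w'_def by linarith
qed (simp only: inv_count_id)

section \<open>The extremal case |C_T(w)| = ell(w)\<close>

definition tight :: "nat \<Rightarrow> perm \<Rightarrow> bool" where
  "tight n w \<longleftrightarrow> hess_sum n w = inv_count n w"

lemma tight_inv: "w permutes {1..n} \<Longrightarrow> tight n (perm_inv w) \<longleftrightarrow> tight n w"
  by (simp add: tight_def hess_sum_inv inv_count_inv)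

context split_off begin

text \<open>Equality for w forces equality in the inequality for \<open>w'\<close> and makes every
  loss \<open>hess w i - hess w' i\<close> vanish.\<close>

lemma tight_w':
  assumes "tight n w"
  shows "tight n w'" "p < i \<Longrightarrow> hess w' i = hess w i"
proof -
  have le: "inv_count n w' \<le> hess_sum n w'" by (rule inv_count_le_hess_sum[OF w']) simp
  show "tight n w'" using le assms hess_sum_w' inv_count_w unfolding tight_def by linarith
  have "(\<Sum>i \<in> {p<..n}. hess w i - hess w' i) = 0"
    using le assms hess_sum_w' inv_count_w unfolding tight_def by linarith
  then have "hess w i - hess w' i = 0" if "p < i" "i \<le> n" for i using that by simp
  then show "hess w' i = hess w i" if "p < i"
  proof (cases "i \<le> n")
    case False
    then show ?thesis
      using pmax_above[OF w1, of i] pmax_above[OF permutes_inv[OF w1], of i]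
        pmax_above[OF w'1, of i] pmax_above[OF permutes_inv[OF w'1], of i] by (simp add: hess_def)
  qed (use hess_w'_le that in fastforce)
qed

end

text \<open>For pairs \<open>(i, j)\<close>, \<open>(j, k)\<close> below w this says that k is at
  most one of the two maxima at i. So if \<open>T i k\<close> is not below w, exactly one of the
  maxima reaches k, and with it exactly one of the two 3-cycles lies below w. This makes the type of
  a triple stable under passing to \<open>w'\<close> and decides to which end the transpositions
  with first index p can be moved.\<close>

lemma tight_hess_hess_le:
  assumes "w permutes {p..n}" "1 \<le> p" "tight n w"
  shows "hess w (hess w i) \<le> max (pmax w i) (pmax (perm_inv w) i)"
  using assms
proof (induction arbitrary: i rule: split_off_induct)
  case (id p)
  have "pmax id i = i" for i by (rule pmax_below[of id "Suc i"]) (auto simp: permutes_id)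
  moreover have "hess id i \<le> pmax id i" for i unfolding hess_def by (rule min.cobounded1)
  ultimately have "hess id (hess id i) \<le> pmax id i"
    by (metis le_trans)
  then show ?case by (rule max.coboundedI1)
next
  case (inverse p w)
  then have "w permutes {1..n}" using permutes_1 by blast
  then have "tight n (perm_inv w)" using inverse tight_inv by blast
  from inverse.IH[OF this, of i] show ?case
    using hess_inv[OF inverse.hyps(1)] perm_inv_inv[OF inverse.hyps(1)] by (simp add: max.commute)
next
  case (step p w)
  then interpret split_off n p w by simp
  note tw = tight_w'[OF step.prems]
  note IH = step.IH[folded w'_def, OF tw(1)]
  show ?case
  proof (cases "p < i")
    case True
    have "hess w i > p" using le_hess_self[OF w1, of i] True by simp
    then have "hess w (hess w i) = hess w' (hess w' i)" using tw(2) True by simp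
    then show ?thesis using IH[of i] pmax_w'_le[OF True] pmax_inv_w'_le[OF True] by linarith
  next
    case False
    show ?thesis
    proof (cases "i < p")
      case True
      then have "hess w (hess w i) = i" using hess_below[OF w] by simp
      then show ?thesis using le_pmax_self[OF w1, of i] by simp
    next
      case F2: False
      then have i: "i = p" using False by simp
      let ?s = "perm_inv w p"
      have g: "pmax (perm_inv w) p = ?s" by (rule pmax_first[OF permutes_inv[OF w]])
      have "hess w r \<le> ?s"
      proof (rule ccontr)
        assume "\<not> ?thesis"
        then have gr: "?s < hess w r" by simp
        \<comment> \<open>The first index at which the maximum of the inverse of w exceeds s. For
          \<open>w'\<close> the maximum up to y is bounded by that of w up to y - 1, hence still by
          s.\<close>
        define y where "y = (LEAST y. ?s < pmax (perm_inv w) y)"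
        have "?s < pmax (perm_inv w) r" using gr by (simp add: hess_def)
        then have y: "?s < pmax (perm_inv w) y" "y \<le> r"
          unfolding y_def by (rule LeastI, rule Least_le)
        have ymin: "\<not> ?s < pmax (perm_inv w) z" if "z < y" for z
          using not_less_Least[of z "\<lambda>y. ?s < pmax (perm_inv w) y"] that by (simp add: y_def)
        have "p < y"
        proof (rule ccontr)
          assume "\<not> ?thesis"
          then show False using y(1) g pmax_mono[of y p "perm_inv w"] by simp
        qed
        then have "pmax (perm_inv w') y \<le> ?s"
          using pmax_inv_w'_le'[of y] y(2) ymin[of "y - 1"] by fastforce
        then have h: "hess w y \<le> ?s" using tw(2)[OF \<open>p < y\<close>] by (simp add: hess_def)
        \<comment> \<open>One of the two maxima defining \<open>hess w y\<close> exceeds s, so their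
          minimum, which is at most s, is the other one.\<close>
        then have "pmax w y \<le> ?s" using y(1) by (simp add: hess_def min_def split: if_splits)
        then have "pmax w' y \<le> ?s" using pmax_w'_le[OF \<open>p < y\<close>] by simp
        then have "hess w' (hess w' y) \<le> ?s"
          using IH[of y] \<open>pmax (perm_inv w') y \<le> ?s\<close> by simp
        moreover have "r \<le> hess w y" using hess_mono[of p y w] \<open>p < y\<close> hess_p by simp
        moreover have "p < hess w y" using le_hess_self[OF w1, of y] \<open>p < y\<close> by simp
        ultimately have "hess w r \<le> ?s"
          using tw(2) \<open>p < y\<close> hess_mono[of r "hess w y" w] by simp
        then show False using gr by simp
      qed
      then show ?thesis unfolding i hess_p g by simp
    qed
  qed
qed

text \<open>Needed when the cycle stands at the end of a chain: \<open>chain_back\<close> appends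
  T_{p,r}, ..., T_{p,p+1}, and these are ascents because the inverse of \<open>w'\<close> decreases
  on {p<..r}. Both halves are stated together so that the claim is symmetric under inversion; in the
  induction either half may be needed for \<open>w'\<close>.\<close>

lemma tight_decreasing:
  assumes "w permutes {p..n}" "1 \<le> p" "tight n w"
  shows "(w p \<le> perm_inv w p \<longrightarrow> (\<forall>x y. p \<le> x \<and> x < y \<and> y \<le> w p \<longrightarrow> perm_inv w y < perm_inv w x)) \<and>
         (perm_inv w p \<le> w p \<longrightarrow> (\<forall>x y. p \<le> x \<and> x < y \<and> y \<le> perm_inv w p \<longrightarrow> w y < w x))"
  using assms
proof (induction rule: split_off_induct)
  case (inverse p w)
  then have "w permutes {1..n}" using permutes_1 by blast
  then have "tight n (perm_inv w)" using inverse tight_inv by blast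
  from inverse.IH[OF this] show ?case
    unfolding perm_inv_inv[OF inverse.hyps(1)] by blast
next
  case (step p w)
  then interpret split_off n p w by simp
  let ?s = "perm_inv w p"
  let ?v = "perm_inv w"
  note tw = tight_w'[OF step.prems]
  note IH = step.IH[folded w'_def, OF tw(1)]
  have vr: "?v r = p" using permutes_inverses(2)[OF w] by simp
  have dec: "?v y < ?v x" if xy: "p \<le> x" "x < y" "y \<le> r" for x y
  proof (cases "y = r")
    case True
    have "?v x \<noteq> ?v y" using permutes_neq[OF permutes_inv[OF w], of x y] xy by simp
    then show ?thesis using True vr permutes_ge[OF permutes_inv[OF w] xy(1)] by simp
  next
    case False
    have rp: "p < r" using xy by simp
    have v': "perm_inv w' (Suc x) = ?v x" if "p \<le> x" "x < r" for x
      unfolding inv_w' using that by (simp add: cyc_def)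
    let ?F = "w' (Suc p)"
    have s': "perm_inv w' (Suc p) = ?s" using v'[of p] rp by simp
    have h': "hess w' (Suc p) = min ?F ?s" using hess_first[OF w'] s' by simp
    have dec': "perm_inv w' (Suc y) < perm_inv w' (Suc x)"
    proof (cases "?F \<le> ?s")
      case True
      \<comment> \<open>The value of \<open>hess w'\<close> at p + 1 is F here, and it is at least r
        by monotonicity of \<open>hess w\<close>; so the induction hypothesis covers all of
        {p<..r}.\<close>
      have "r \<le> ?F" using h' True tw(2)[of "Suc p"] hess_mono[of p "Suc p" w] hess_p by simp
      then show ?thesis using IH True xy False unfolding s' by simp
    next
      case F: False
      \<comment> \<open>The maximum of w exceeds s at these indices, so \<open>hess w\<close> being
        at most s has to come from the maximum of the inverse. Consequently all values in {p..r}
        occur at positions up to s, where \<open>w'\<close> is known to decrease.\<close>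
      have gs: "pmax ?v i \<le> ?s" if "p \<le> i" "i \<le> r" for i
        using that
      proof (induction i rule: dec_induct)
        case base
        then show ?case using pmax_first[OF permutes_inv[OF w]] by simp
      next
        case (step i)
        have "hess w (Suc i) \<le> pmax (perm_inv w') (Suc i)" using tw(2)[of "Suc i"] step by (simp add: hess_def)
        also have "\<dots> \<le> ?s" using pmax_inv_w'_le'[of "Suc i"] step by fastforce
        finally have "hess w (Suc i) \<le> ?s" .
        moreover have "?s < pmax w (Suc i)"
          using F le_pmax[of "Suc p" "Suc i" w'] pmax_w'_le[of "Suc i"] step by simp
        ultimately show ?case by (simp add: hess_def min_def split: if_splits)
      qed
      have le_s: "?v k \<le> ?s" if "p \<le> k" "k \<le> r" for k
        using gs[OF that] le_pmax[of k k ?v] by simp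
      let ?a = "perm_inv w' (Suc x)" and ?b = "perm_inv w' (Suc y)"
      have ab: "?a \<le> ?s" "?b \<le> ?s" using v' le_s xy False by auto
      have ge: "Suc p \<le> ?a" "Suc p \<le> ?b" using permutes_ge[OF permutes_inv[OF w']] xy by auto
      have wab: "w' ?a = Suc x" "w' ?b = Suc y" using permutes_inverses(1)[OF w'] by auto
      have dw: "w' d < w' c" if "Suc p \<le> c" "c < d" "d \<le> ?s" for c d
        using IH F that unfolding s' by simp
      show ?thesis
      proof (rule ccontr)
        assume "\<not> ?thesis"
        then consider "?a < ?b" | "?a = ?b" by linarith
        then show False
        proof cases
          case 1
          then show False using dw[of ?a ?b] ge ab wab xy by simp
        next
          case 2
          then show False using wab xy by simp
        qed
      qed
    qed
    then show ?thesis using v'[of x] v'[of y] xy False by simp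
  qed
  moreover have "w y < w x" if "?s \<le> r" and xy: "p \<le> x" "x < y" "y \<le> ?s" for x y
  proof -
    have s: "?s = r" using that le by simp
    \<comment> \<open>For s = r the decreasing map \<open>perm_inv w\<close> sends {p..r} to itself,
      so w is decreasing there as well.\<close>
    have maps: "?v k \<in> {p..r}" if "k \<in> {p..r}" for k
      using that dec[of p k] s permutes_ge[OF permutes_inv[OF w], of k] by (cases "k = p") auto
    have "inj_on ?v {p..r}" by (rule permutes_inj_on[OF permutes_inv[OF w]])
    then have "?v ` {p..r} = {p..r}"
      by (intro endo_inj_surj) (use maps in auto)
    then have "w k \<in> {p..r}" if "k \<in> {p..r}" for k
      using that permutes_inverses(1)[OF w] by (metis imageE)
    then have wxy: "w x \<in> {p..r}" "w y \<in> {p..r}" using xy s by auto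
    have vw: "?v (w x) = x" "?v (w y) = y" using permutes_inverses(2)[OF w] by auto
    show ?thesis
    proof (rule ccontr)
      assume "\<not> ?thesis"
      then have "w x < w y" using permutes_neq[OF w, of x y] xy by auto
      then show False using dec[of "w x" "w y"] wxy vw xy by simp
    qed
  qed
  ultimately show ?case by blast
qed simp

section \<open>Chains of transpositions\<close>

definition pair_prod :: "(nat \<times> nat) list \<Rightarrow> perm" where
  "pair_prod ps = perm_prod (map (\<lambda>(a, b). T a b) ps)"

text \<open>Only ascents are required, not covers. This is a condition on single values and is easy
  to preserve; covers are recovered by counting steps.\<close>

fun inc_chain :: "perm \<Rightarrow> (nat \<times> nat) list \<Rightarrow> bool" where
  "inc_chain x [] \<longleftrightarrow> True"
| "inc_chain x ((a, b) # ps) \<longleftrightarrow> x a < x b \<and> inc_chain (x \<circ> T a b) ps"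

lemma pair_prod_Nil [simp]: "pair_prod [] = id"
  by (simp only: pair_prod_def list.map perm_prod_Nil)

lemma pair_prod_Cons: "pair_prod ((a, b) # ps) = T a b \<circ> pair_prod ps"
  by (simp only: pair_prod_def list.map perm_prod_Cons prod.case)

lemma pair_prod_append: "pair_prod (ps @ qs) = pair_prod ps \<circ> pair_prod qs"
  by (simp only: pair_prod_def map_append perm_prod_append)

lemma inc_chain_append: "inc_chain x (ps @ qs) \<longleftrightarrow> inc_chain x ps \<and> inc_chain (x \<circ> pair_prod ps) qs"
proof (induction ps arbitrary: x)
  case (Cons e ps)
  obtain a b where e: "e = (a, b)" by (cases e)
  have "x \<circ> T a b \<circ> pair_prod ps = x \<circ> pair_prod ((a, b) # ps)"
    by (simp only: pair_prod_Cons comp_assoc)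
  then show ?case unfolding e append_Cons inc_chain.simps Cons.IH by (simp only: conj_assoc)
qed (simp only: append_Nil inc_chain.simps pair_prod_Nil comp_id simp_thms)

lemma inc_chain_inv_count:
  assumes "x permutes {1..n}" "set ps \<subseteq> index_pairs n" "inc_chain x ps"
  shows "x \<circ> pair_prod ps permutes {1..n} \<and> inv_count n x + length ps \<le> inv_count n (x \<circ> pair_prod ps)"
  using assms
proof (induction ps arbitrary: x)
  case (Cons e ps)
  obtain a b where e: "e = (a, b)" by (cases e)
  have ab: "1 \<le> a" "a < b" "b \<le> n" "x a < x b" using Cons.prems by (auto simp: e index_pairs_def)
  have "x \<circ> T a b permutes {1..n}" by (rule permutes_comp_T[OF Cons.prems(1) ab(1-3)])
  moreover have "set ps \<subseteq> index_pairs n" "inc_chain (x \<circ> T a b) ps" using Cons.prems(2,3) unfolding e by simp_all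
  ultimately have IH: "x \<circ> T a b \<circ> pair_prod ps permutes {1..n}"
    "inv_count n (x \<circ> T a b) + length ps \<le> inv_count n (x \<circ> T a b \<circ> pair_prod ps)"
    using Cons.IH by blast+
  have "inv_count n x + 1 \<le> inv_count n (x \<circ> T a b)"
    using inv_count_comp_T[OF ab Cons.prems(1)] by simp
  then have "inv_count n x + length ((a, b) # ps) \<le> inv_count n (x \<circ> T a b \<circ> pair_prod ps)"
    using IH(2) unfolding list.size by linarith
  then show ?case using IH(1) unfolding e pair_prod_Cons comp_assoc[symmetric] by blast
qed (simp only: pair_prod_Nil comp_id list.size, simp)

text \<open>Each ascent adds at least one inversion, and the total does not exceed the number of
  steps; so each ascent adds exactly one and is a cover.\<close>

lemma inc_chain_chain_property:
  assumes ps: "set ps \<subseteq> index_pairs n" and inc: "inc_chain id ps"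
    and len: "inv_count n (pair_prod ps) \<le> length ps"
  shows "chain_property n (pair_prod ps) (map (\<lambda>(a, b). T a b) ps)"
proof -
  let ?f = "\<lambda>m. pair_prod (take m ps)"
  have f: "?f m permutes {1..n}" "inv_count n (?f m) = m" if m: "m \<le> length ps" for m
  proof -
    have eq: "pair_prod ps = ?f m \<circ> pair_prod (drop m ps)"
      by (metis append_take_drop_id pair_prod_append)
    have inc': "inc_chain id (take m ps)" "inc_chain (?f m) (drop m ps)"
      using inc inc_chain_append[of id "take m ps" "drop m ps"] unfolding append_take_drop_id id_comp by blast+
    have sub: "set (take m ps) \<subseteq> index_pairs n" "set (drop m ps) \<subseteq> index_pairs n"
      using ps set_take_subset set_drop_subset by fast+
    have 1: "?f m permutes {1..n}" "m \<le> inv_count n (?f m)"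
      using inc_chain_inv_count[OF permutes_id sub(1) inc'(1)] m unfolding id_comp inv_count_id by auto
    have "inv_count n (?f m) + (length ps - m) \<le> length ps"
      using inc_chain_inv_count[OF 1(1) sub(2) inc'(2)] len unfolding eq[symmetric] by simp
    then show "?f m permutes {1..n}" "inv_count n (?f m) = m" using 1 m by auto
  qed
  have "bruhat_covers n (?f m) (?f (Suc m))" if m: "m < length ps" for m
  proof -
    obtain a b where ab: "ps ! m = (a, b)" by (cases "ps ! m")
    have "(a, b) \<in> index_pairs n" using ps m ab by (metis nth_mem subsetD)
    then have ab': "1 \<le> a" "a < b" "b \<le> n" by (auto simp: index_pairs_def)
    have eq: "?f (Suc m) = ?f m \<circ> T a b"
      unfolding take_Suc_conv_app_nth[OF m] pair_prod_append ab by (simp only: pair_prod_Cons pair_prod_Nil comp_id)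
    have "inv_count n (?f m \<circ> T a b) = Suc (inv_count n (?f m))"
      using f(2)[of m] f(2)[of "Suc m"] m unfolding eq by simp
    then show ?thesis
      unfolding eq by (intro bruhat_covers_comp_T[OF f(1) ab']) (use m in auto)
  qed
  moreover have "partial_products (map (\<lambda>(a, b). T a b) ps) = map ?f [0..<Suc (length ps)]"
    by (simp add: partial_products_def pair_prod_def take_map del: upt_Suc)
  ultimately show ?thesis
    unfolding chain_property_def by (simp add: successively_conv_nth pair_prod_def del: upt_Suc)
qed

lemma chain_property_length:
  assumes "chain_property n w ts"
  shows "inv_count n w = length ts"
proof -
  let ?f = "\<lambda>m. perm_prod (take m ts)"
  have "successively (bruhat_covers n) (map ?f [0..<Suc (length ts)])"
    using assms unfolding chain_property_def partial_products_def by blast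
  then have cov: "bruhat_covers n (?f m) (?f (Suc m))" if "m < length ts" for m
    using that by (simp add: successively_conv_nth del: upt_Suc)
  have "inv_count n (?f m) = m" if "m \<le> length ts" for m
    using that
  proof (induction m)
    case (Suc m)
    then show ?case using bruhat_covers_inv_count[OF cov[of m]] by simp
  qed (simp only: take_0 perm_prod_Nil inv_count_id)
  from this[of "length ts"] show ?thesis using assms by (simp add: chain_property_def)
qed

section \<open>Reordering chains\<close>

text \<open>The quantifier over all starting points x makes this a congruence for concatenation, so
  a move may be applied anywhere inside a list.\<close>

definition list_equiv :: "(nat \<times> nat) list \<Rightarrow> (nat \<times> nat) list \<Rightarrow> bool" where
  "list_equiv us vs \<longleftrightarrow> pair_prod us = pair_prod vs \<and> (\<forall>x. inc_chain x us \<longleftrightarrow> inc_chain x vs)"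

text \<open>The moves are symmetric under reversal. Keeping this in the relation lets one collection
  lemma serve both ends of a list: for the front it is applied to the reversed list.\<close>

definition rev_equiv :: "(nat \<times> nat) list \<Rightarrow> (nat \<times> nat) list \<Rightarrow> bool" where
  "rev_equiv us vs \<longleftrightarrow> list_equiv us vs \<and> list_equiv (rev us) (rev vs)"

lemma list_equiv_append: "list_equiv us vs \<Longrightarrow> list_equiv us' vs' \<Longrightarrow> list_equiv (us @ us') (vs @ vs')"
  unfolding list_equiv_def by (simp only: pair_prod_append inc_chain_append) blast

lemma rev_equiv_append: "rev_equiv us vs \<Longrightarrow> rev_equiv us' vs' \<Longrightarrow> rev_equiv (us @ us') (vs @ vs')"
  unfolding rev_equiv_def by (simp only: rev_append list_equiv_append simp_thms)

lemma rev_equiv_refl [simp]: "rev_equiv us us"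
  by (simp add: rev_equiv_def list_equiv_def)

lemma rev_equiv_trans [trans]: "rev_equiv us vs \<Longrightarrow> rev_equiv vs ws \<Longrightarrow> rev_equiv us ws"
  unfolding rev_equiv_def list_equiv_def by metis

lemma list_equiv_commute:
  assumes "{a, b} \<inter> {c, d} = {}"
  shows "list_equiv [(a, b), (c, d)] [(c, d), (a, b)]"
proof -
  have "T a b \<circ> T c d = T c d \<circ> T a b"
    using assms by (auto simp: fun_eq_iff Transposition.transpose_def)
  moreover have "T a b c = c" "T a b d = d" "T c d a = a" "T c d b = b" using assms by auto
  ultimately show ?thesis by (auto simp: list_equiv_def pair_prod_Cons)
qed

lemma rev_equiv_commute: "{a, b} \<inter> {c, d} = {} \<Longrightarrow> rev_equiv [(a, b), (c, d)] [(c, d), (a, b)]"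
  using list_equiv_commute[of a b c d] list_equiv_commute[of c d a b] by (simp add: rev_equiv_def Int_commute)

text \<open>Both lists multiply to \<open>T i k\<close>, and started at x both consist of ascents
  exactly when \<open>x i < x j\<close> and \<open>x j < x k\<close>.\<close>

lemma rev_equiv_flip:
  assumes "i < j" "j < k"
  shows "rev_equiv [(i, j), (i, k), (j, k)] [(j, k), (i, k), (i, j)]"
proof -
  have ne: "i \<noteq> j" "j \<noteq> k" "i \<noteq> k" using assms by auto
  have t: "T i j k = k" "T j k i = i" "T i k j = j" using ne by auto
  have "T i j \<circ> (T i k \<circ> T j k) = T j k \<circ> (T i k \<circ> T i j)"
    using ne by (auto simp: fun_eq_iff Transposition.transpose_def)
  then have "list_equiv [(i, j), (i, k), (j, k)] [(j, k), (i, k), (i, j)]"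
    using ne t by (auto simp: list_equiv_def pair_prod_Cons)
  then show ?thesis by (simp add: rev_equiv_def list_equiv_def)
qed

lemma rev_equiv_block:
  assumes "p \<noteq> a" "p \<noteq> b" "a \<notin> set ys" "b \<notin> set ys"
  shows "rev_equiv (map (Pair p) ys @ [(a, b)]) ((a, b) # map (Pair p) ys)"
  using assms
proof (induction ys)
  case (Cons y ys)
  have IH: "rev_equiv (map (Pair p) ys @ [(a, b)]) ((a, b) # map (Pair p) ys)" using Cons by simp
  have 1: "rev_equiv (map (Pair p) (y # ys) @ [(a, b)]) ((p, y) # (a, b) # map (Pair p) ys)"
    using rev_equiv_append[OF rev_equiv_refl[of "[(p, y)]"] IH] by simp
  have "{p, y} \<inter> {a, b} = {}" using Cons.prems by auto
  then have 2: "rev_equiv ((p, y) # (a, b) # map (Pair p) ys) ((a, b) # map (Pair p) (y # ys))"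
    using rev_equiv_append[OF rev_equiv_commute rev_equiv_refl[of "map (Pair p) ys"]] by simp
  show ?case by (rule rev_equiv_trans[OF 1 2])
qed simp

text \<open>
  The transpositions in \<open>us\<close> reverse the natural order of \<open>{p..r}\<close> pair by pair; \<open>precedes us\<close> is the
  order reached so far.
\<close>

definition precedes :: "(nat \<times> nat) list \<Rightarrow> nat \<Rightarrow> nat \<Rightarrow> bool" where
  "precedes us y y' \<longleftrightarrow> (if y < y' then (y, y') \<notin> set us else (y', y) \<in> set us)"

text \<open>By \<open>bc1\<close> and \<open>bc2\<close> every initial segment is biclosed on
  {p..r}, hence an inversion set. The invariant is that the pairs \<open>(p, y)\<close> met so far
  stand in one block at the end, sorted by the order reached. A new \<open>(p, b)\<close> is
  appended. A new \<open>(a, b)\<close> with a \<noteq> p commutes past the block if neither a nor b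
  occurs in it; if both do, they are neighbours, and the flip moves \<open>(a, b)\<close> to the
  left while exchanging \<open>(p, a)\<close> and \<open>(p, b)\<close>.\<close>

lemma collect_first_index:
  assumes Q: "\<And>i j. (i, j) \<in> set qs \<Longrightarrow> p \<le> i \<and> i < j"
    and clique: "\<And>i j. p \<le> i \<Longrightarrow> i < j \<Longrightarrow> j \<le> r \<Longrightarrow> (i, j) \<in> set qs"
    and r: "\<And>j. (p, j) \<in> set qs \<Longrightarrow> j \<le> r"
    and dist: "distinct qs"
    and bc1: "\<And>us vs i j k. qs = us @ vs \<Longrightarrow> p \<le> i \<Longrightarrow> i < j \<Longrightarrow> j < k \<Longrightarrow> k \<le> r \<Longrightarrow>
        (i, k) \<in> set us \<Longrightarrow> (i, j) \<in> set us \<or> (j, k) \<in> set us"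
    and bc2: "\<And>us vs i j k. qs = us @ vs \<Longrightarrow> p \<le> i \<Longrightarrow> i < j \<Longrightarrow> j < k \<Longrightarrow> k \<le> r \<Longrightarrow>
        (i, j) \<in> set us \<Longrightarrow> (j, k) \<in> set us \<Longrightarrow> (i, k) \<in> set us"
    and path: "\<And>us vs j k. qs = us @ vs \<Longrightarrow> (p, j) \<in> set us \<Longrightarrow> (j, k) \<in> set qs \<Longrightarrow> r < k \<Longrightarrow> (j, k) \<in> set us"
  shows "rev_equiv qs (filter (\<lambda>e. fst e \<noteq> p) qs @ map (Pair p) (rev [Suc p..<Suc r]))"
proof -
  let ?F = "filter (\<lambda>e. fst e \<noteq> p)"
  have main: "\<exists>ys. rev_equiv us (?F us @ map (Pair p) ys) \<and> distinct ys \<and> set ys = {j. (p, j) \<in> set us} \<and>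
      sorted_wrt (precedes us) ys" if "qs = us @ vs" for us vs
    using that
  proof (induction us arbitrary: vs rule: rev_induct)
    case Nil
    then show ?case by (intro exI[of _ "[]"]) auto
  next
    case (snoc e us)
    obtain a b where e: "e = (a, b)" by (cases e)
    have qs: "qs = us @ (e # vs)" "qs = (us @ [e]) @ vs" using snoc.prems by auto
    have eQ: "(a, b) \<in> set qs" "(a, b) \<notin> set us" "p \<le> a" "a < b"
      using qs dist Q[of a b] e by auto
    have usQ: "z \<in> set qs" if "z \<in> set us" for z using that qs by auto
    from snoc.IH[OF qs(1)] obtain ys where ys: "rev_equiv us (?F us @ map (Pair p) ys)" "distinct ys"
      "set ys = {j. (p, j) \<in> set us}" "sorted_wrt (precedes us) ys" by blast
    have ys_r: "p < y \<and> y \<le> r" if "y \<in> set ys" for y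
      using that ys(3) usQ[of "(p, y)"] Q[of p y] r[of y] by auto
    note bc1' = bc1[OF qs(1)] bc1[OF qs(2)] and bc2' = bc2[OF qs(1)] bc2[OF qs(2)]
    show ?case
    proof (cases "a = p")
      case True
      \<comment> \<open>The new b comes last in the order reached: \<open>bc2\<close> shows this
        against smaller y, \<open>bc1\<close> against larger ones.\<close>
      have prec: "precedes (us @ [e]) y b" if y: "y \<in> set ys" for y
      proof (cases "y < b")
        case True
        then show ?thesis
          using bc2'(1)[of p y b] ys_r[OF y] r[of b] eQ y ys(3) e \<open>a = p\<close>
          by (auto simp: precedes_def)
      next
        case False
        then have "b < y" using y ys(3) eQ(2) \<open>a = p\<close> by (cases "b = y") auto
        then show ?thesis
          using bc1'(1)[of p b y] ys_r[OF y] eQ y ys(3) e \<open>a = p\<close>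
          by (auto simp: precedes_def)
      qed
      have "sorted_wrt (precedes (us @ [e])) ys"
        by (rule sorted_wrt_mono_rel[OF _ ys(4)]) (use ys_r e \<open>a = p\<close> in \<open>auto simp: precedes_def split: if_splits\<close>)
      then have "sorted_wrt (precedes (us @ [e])) (ys @ [b])" using prec by (simp add: sorted_wrt_append)
      moreover have "rev_equiv (us @ [e]) (?F (us @ [e]) @ map (Pair p) (ys @ [b]))"
        using rev_equiv_append[OF ys(1) rev_equiv_refl[of "[e]"]] e \<open>a = p\<close> by simp
      moreover have "b \<notin> set ys" using ys(3) eQ(2) \<open>a = p\<close> by auto
      moreover have "set (ys @ [b]) = {j. (p, j) \<in> set (us @ [e])}" using ys(3) e \<open>a = p\<close> by auto
      ultimately show ?thesis using ys(2)
        by (intro exI[of _ "ys @ [b]"] conjI) simp_all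
    next
      case False
      then have pa: "p < a" using eQ by auto
      \<comment> \<open>If exactly one of a and b had been collected, neither move would apply. The
        closure conditions exclude this, with \<open>path\<close> for b beyond r.\<close>
      have iff: "a \<in> set ys \<longleftrightarrow> b \<in> set ys"
      proof
        assume a: "a \<in> set ys"
        then have "b \<le> r" using path[OF qs(1), of a b] eQ ys(3) by fastforce
        then show "b \<in> set ys" using bc2'(2)[of p a b] a ys(3) pa eQ e False by auto
      next
        assume "b \<in> set ys"
        then show "a \<in> set ys" using bc1'(1)[of p a b] ys(3) pa eQ ys_r[of b] by auto
      qed
      have F: "?F (us @ [e]) = ?F us @ [e]" using e False by simp
      have app: "rev_equiv (us @ [e]) (?F us @ map (Pair p) ys @ [e])"
        using rev_equiv_append[OF ys(1) rev_equiv_refl[of "[e]"]] by simp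
      show ?thesis
      proof (cases "a \<in> set ys")
        case aF: False
        have "rev_equiv (?F us @ (map (Pair p) ys @ [e])) (?F us @ (e # map (Pair p) ys))"
          unfolding e by (rule rev_equiv_append[OF rev_equiv_refl rev_equiv_block]) (use aF iff pa eQ in auto)
        then have "rev_equiv (us @ [e]) (?F (us @ [e]) @ map (Pair p) ys)"
          using rev_equiv_trans[OF app] F by simp
        moreover have "sorted_wrt (precedes (us @ [e])) ys"
          by (rule sorted_wrt_mono_rel[OF _ ys(4)]) (use aF iff e in \<open>auto simp: precedes_def split: if_splits\<close>)
        moreover have "set ys = {j. (p, j) \<in> set (us @ [e])}" using ys(3) e False by auto
        ultimately show ?thesis using ys(2) by blast
      next
        case True
        have bys: "b \<in> set ys" and br: "b \<le> r" using True iff ys_r by auto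
        obtain y1 y2' where y1: "ys = y1 @ a # y2'" using True by (meson split_list)
        have "b \<notin> set y1"
        proof
          assume "b \<in> set y1"
          then have "precedes us b a" using ys(4) unfolding y1 by (auto simp: sorted_wrt_append)
          then show False using eQ by (auto simp: precedes_def)
        qed
        then have "b \<in> set y2'" using bys eQ y1 by auto
        then obtain y2 y3 where y2: "y2' = y2 @ b # y3" by (meson split_list)
        \<comment> \<open>A c strictly between a and b in the block would violate biclosedness of
          the initial segment enlarged by \<open>(a, b)\<close>, whatever the size of c relative to
          a and b.\<close>
        have "y2 = []"
        proof (rule ccontr)
          assume "y2 \<noteq> []"
          then obtain c where c: "c \<in> set y2" by (cases y2) auto
          have bef: "precedes us a c" "precedes us c b"
            using ys(4) c unfolding y1 y2 by (auto simp: sorted_wrt_append)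
          have ne: "c \<noteq> a" "c \<noteq> b" using ys(2) c unfolding y1 y2 by auto
          have cr: "p < c" "c \<le> r" using ys_r[of c] c unfolding y1 y2 by auto
          consider "c < a" | "a < c" "c < b" | "b < c" using ne by linarith
          then show False
          proof cases
            case 1
            then show False using bc2'(2)[of c a b] bef cr br eQ e ne by (auto simp: precedes_def)
          next
            case 2
            then show False using bc1'(2)[of a c b] bef cr br pa eQ e ne by (auto simp: precedes_def)
          next
            case 3
            then show False using bc2'(2)[of a b c] bef cr br pa eQ e ne by (auto simp: precedes_def)
          qed
        qed
        then have ys_eq: "ys = y1 @ a # b # y3" using y1 y2 by simp
        have d: "a \<notin> set y1" "b \<notin> set y1" "a \<notin> set y3" "b \<notin> set y3" using ys(2) unfolding ys_eq by auto
        let ?P = "map (Pair p)"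
        have "rev_equiv ((?P y1 @ [(p, a), (p, b)]) @ (?P y3 @ [e])) ((?P y1 @ [(p, a), (p, b)]) @ (e # ?P y3))"
          unfolding e by (rule rev_equiv_append[OF rev_equiv_refl rev_equiv_block]) (use d pa eQ in auto)
        also have "(?P y1 @ [(p, a), (p, b)]) @ (e # ?P y3) = ?P y1 @ ([(p, a), (p, b), (a, b)] @ ?P y3)"
          by (simp add: e)
        also have "rev_equiv (?P y1 @ ([(p, a), (p, b), (a, b)] @ ?P y3)) (?P y1 @ ([(a, b), (p, b), (p, a)] @ ?P y3))"
          by (intro rev_equiv_append rev_equiv_flip) (use pa eQ in auto)
        also have "?P y1 @ ([(a, b), (p, b), (p, a)] @ ?P y3) = (?P y1 @ [(a, b)]) @ ([(p, b), (p, a)] @ ?P y3)"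
          by simp
        also have "rev_equiv ((?P y1 @ [(a, b)]) @ ([(p, b), (p, a)] @ ?P y3))
            (((a, b) # ?P y1) @ ([(p, b), (p, a)] @ ?P y3))"
          by (rule rev_equiv_append[OF rev_equiv_block]) (use d pa eQ in auto)
        finally have "rev_equiv (map (Pair p) ys @ [e]) (e # map (Pair p) (y1 @ b # a # y3))"
          by (simp add: ys_eq e)
        from rev_equiv_append[OF rev_equiv_refl[of "?F us"] this]
        have "rev_equiv (us @ [e]) (?F (us @ [e]) @ map (Pair p) (y1 @ b # a # y3))"
          using rev_equiv_trans[OF app] F by simp
        moreover have "sorted_wrt (precedes (us @ [e])) (y1 @ b # a # y3)"
        proof -
          let ?Q = "precedes (us @ [e])"
          \<comment> \<open>Adding \<open>(a, b)\<close> changes the relative order of a and b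
            only.\<close>
          have mono: "?Q y y'" if "precedes us y y'" "y < y' \<longrightarrow> y \<noteq> a \<or> y' \<noteq> b" for y y'
            using that e by (auto simp: precedes_def split: if_splits)
          have "sorted_wrt (precedes us) (y1 @ a # b # y3)" using ys(4) unfolding ys_eq .
          then have s: "sorted_wrt (precedes us) y1" "sorted_wrt (precedes us) y3"
            "\<forall>y\<in>set y1. precedes us y a \<and> precedes us y b \<and> (\<forall>y'\<in>set y3. precedes us y y')"
            "\<forall>y\<in>set y3. precedes us a y \<and> precedes us b y"
            by (auto simp: sorted_wrt_append)
          have "sorted_wrt ?Q y1" "sorted_wrt ?Q y3"
            by (rule sorted_wrt_mono_rel[OF mono s(1)]; use d in auto)
               (rule sorted_wrt_mono_rel[OF mono s(2)]; use d in auto)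
          moreover have "?Q b a" using e eQ(4) by (simp add: precedes_def)
          moreover have "\<forall>y\<in>set y1. ?Q y a \<and> ?Q y b \<and> (\<forall>y'\<in>set y3. ?Q y y')"
            using s(3) mono d by blast
          moreover have "\<forall>y\<in>set y3. ?Q a y \<and> ?Q b y" using s(4) mono d eQ(4) by blast
          ultimately show ?thesis by (simp add: sorted_wrt_append)
        qed
        moreover have "set (y1 @ b # a # y3) = {j. (p, j) \<in> set (us @ [e])}"
          using ys(3) e False unfolding ys_eq by auto
        moreover have "distinct (y1 @ b # a # y3)" using ys(2) unfolding ys_eq by auto
        ultimately show ?thesis by blast
      qed
    qed
  qed
  from main[of qs "[]"] obtain ys where ys: "rev_equiv qs (?F qs @ map (Pair p) ys)" "distinct ys"
    "set ys = {j. (p, j) \<in> set qs}" "sorted_wrt (precedes qs) ys" by auto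
  have set_ys: "set ys = {Suc p..<Suc r}"
  proof (intro equalityI subsetI)
    fix y assume "y \<in> set ys"
    then have "(p, y) \<in> set qs" using ys(3) by simp
    then show "y \<in> {Suc p..<Suc r}" using Q[of p y] r[of y] by simp
  next
    fix y assume "y \<in> {Suc p..<Suc r}"
    then have "(p, y) \<in> set qs" using clique[of p y] by simp
    then show "y \<in> set ys" using ys(3) by simp
  qed
  \<comment> \<open>At the end all pairs of {p..r} have occurred, so the order reached is the
    reverse of the natural one.\<close>
  have "sorted_wrt (\<lambda>y y'. y' < y) ys"
  proof (rule sorted_wrt_mono_rel[OF _ ys(4)])
    fix y y' assume y: "y \<in> set ys" "y' \<in> set ys" "precedes qs y y'"
    have "y \<noteq> y'" using y(3) Q[of y y] by (auto simp: precedes_def)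
    moreover have "\<not> y < y'"
      using clique[of y y'] y set_ys by (auto simp: precedes_def)
    ultimately show "y' < y" by simp
  qed
  then have "sorted_wrt (<) (rev ys)" by (simp add: sorted_wrt_rev)
  moreover have "set (rev ys) = {Suc p..<Suc r}" using set_ys by simp
  ultimately have "rev ys = [Suc p..<Suc r]"
    by (intro sorted_distinct_set_unique) (simp_all add: strict_sorted_iff del: upt_Suc)
  then have "ys = rev [Suc p..<Suc r]" by (metis rev_rev_ident)
  then show ?thesis using ys(1) by simp
qed

section \<open>Compatible orders give saturated chains\<close>

text \<open>Compatibility phrased through initial segments \<open>us\<close>, the form used by the
  collection lemma and stable under deleting pairs. If \<open>T i k\<close> is below w, the
  condition says that it lies between the other two. Otherwise the test
  \<open>k \<le> pmax (perm_inv w) i\<close> decides whether \<open>R3 i j k\<close> is below w, and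
  thereby which of \<open>(i, j)\<close> and \<open>(j, k)\<close> comes first.\<close>

definition compat_list :: "perm \<Rightarrow> (nat \<times> nat) list \<Rightarrow> bool" where
  "compat_list w qs \<longleftrightarrow> distinct qs \<and> set qs = hess_pairs w \<and>
     (\<forall>us vs i j k. qs = us @ vs \<and> (i, j) \<in> hess_pairs w \<and> (j, k) \<in> hess_pairs w \<longrightarrow>
        (if k \<le> hess w i
         then ((i, k) \<in> set us \<longrightarrow> (i, j) \<in> set us \<or> (j, k) \<in> set us) \<and>
              ((i, j) \<in> set us \<and> (j, k) \<in> set us \<longrightarrow> (i, k) \<in> set us)
         else if k \<le> pmax (perm_inv w) i then (j, k) \<in> set us \<longrightarrow> (i, j) \<in> set us
         else (i, j) \<in> set us \<longrightarrow> (j, k) \<in> set us))"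

lemma sorted_wrt_irreflp_distinct:
  "sorted_wrt R xs \<Longrightarrow> irreflp_on (set xs) R \<Longrightarrow> distinct xs"
  by (induction xs) (auto simp: irreflp_on_def)

lemma T_in_C_below_iff:
  assumes w: "w permutes {1..n}" and ij: "1 \<le> i" "i < j" "j \<le> n"
  shows "T i j \<in> C_below n w \<longleftrightarrow> j \<le> hess w i"
proof -
  have "T i j \<in> C23 n" using ij by (auto simp: C23_def transpositions_def)
  then show ?thesis using T_le_iff[OF w ij] by (simp add: C_below_def)
qed

lemma R3_in_C_below_iff:
  assumes w: "w permutes {1..n}" and ij: "1 \<le> i" "i < j" "j < k" "k \<le> n"
  shows "R3 i j k \<in> C_below n w \<longleftrightarrow> j \<le> pmax w i \<and> k \<le> pmax w j \<and> k \<le> pmax (perm_inv w) i"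
proof -
  have "R3 i j k \<in> C23 n" unfolding C23_def using ij by blast
  then show ?thesis using R3_le_iff[OF w ij] by (simp add: C_below_def)
qed

lemma compat_list_of_compatible_order:
  assumes w: "w permutes {1..n}" and comp: "compatible_order n (C_below n w) prec"
    and ts: "set ts = CT_below n w" "sorted_wrt prec ts"
  shows "\<exists>qs. compat_list w qs \<and> ts = map (\<lambda>(a, b). T a b) qs"
proof -
  let ?f = "\<lambda>(a, b). T a b :: perm"
  have CT: "C_below n w \<inter> transpositions n = CT_below n w"
    by (auto simp: C_below_def CT_below_def C23_def)
  then have lin: "irreflp_on (CT_below n w) prec" "transp_on (CT_below n w) prec" "totalp_on (CT_below n w) prec"
    using comp by (auto simp: compatible_order_def strict_linear_order_on_def)
  have dist: "distinct ts" using sorted_wrt_irreflp_distinct[OF ts(2)] lin(1) ts(1) by simp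
  define g where "g = inv_into (hess_pairs w) ?f"
  define qs where "qs = map g ts"
  have fg: "?f (g t) = t" if "t \<in> set ts" for t
    unfolding g_def by (rule f_inv_into_f) (use that ts(1) CT_below_eq[OF w] in simp)
  have gf: "g (?f e) = e" if "e \<in> hess_pairs w" for e
    unfolding g_def by (rule inv_into_f_f[OF inj_on_T_pairs that])
  have ts_eq: "ts = map ?f qs" unfolding qs_def by (simp add: fg cong: map_cong)
  have set_qs: "set qs = hess_pairs w"
  proof -
    have "set qs = g ` ?f ` hess_pairs w" unfolding qs_def using ts(1) CT_below_eq[OF w] by simp
    also have "\<dots> = hess_pairs w" using gf by (auto simp: image_iff) force
    finally show ?thesis .
  qed
  have dist_qs: "distinct qs" using dist unfolding ts_eq by (simp add: distinct_map)
  have f_in: "?f e \<in> CT_below n w" if "e \<in> hess_pairs w" for e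
    using that CT_below_eq[OF w] by blast
  have cond: "if k \<le> hess w i
         then ((i, k) \<in> set us \<longrightarrow> (i, j) \<in> set us \<or> (j, k) \<in> set us) \<and>
              ((i, j) \<in> set us \<and> (j, k) \<in> set us \<longrightarrow> (i, k) \<in> set us)
         else if k \<le> pmax (perm_inv w) i then (j, k) \<in> set us \<longrightarrow> (i, j) \<in> set us
         else (i, j) \<in> set us \<longrightarrow> (j, k) \<in> set us"
    if qs: "qs = us @ vs" and ij: "(i, j) \<in> hess_pairs w" and jk: "(j, k) \<in> hess_pairs w" for us vs i j k
  proof -
    \<comment> \<open>An initial segment of the sorted list is downward closed for
      \<open>prec\<close>.\<close>
    have closed: "a \<in> set us" if "a \<in> hess_pairs w" "b \<in> set us" "prec (?f a) (?f b)" for a b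
    proof (rule ccontr)
      assume "a \<notin> set us"
      then have a: "a \<in> set vs" using that(1) set_qs qs by auto
      have b: "b \<in> hess_pairs w" using that(2) set_qs qs by auto
      have "prec (?f b) (?f a)"
        using ts(2) a that(2) unfolding ts_eq qs by (simp add: sorted_wrt_append)
      then have "prec (?f a) (?f a)"
        using lin(2) that(3) f_in[OF that(1)] f_in[OF b] unfolding transp_on_def by blast
      then show False using lin(1) f_in[OF that(1)] by (simp add: irreflp_on_def)
    qed
    have closed': "(a, b) \<in> set us" if "(a, b) \<in> hess_pairs w" "(c, d) \<in> set us" "prec (T a b) (T c d)" for a b c d
      by (rule closed[OF that(1,2)]) (simp only: prod.case that(3))
    have b: "1 \<le> i" "i < j" "j < k" "k \<le> n" "j \<le> n"
      using hess_pairs_le[OF w ij] hess_pairs_le[OF w jk] by auto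
    have h: "j \<le> hess w i" "k \<le> hess w j" using ij jk by (auto simp: hess_pairs_def)
    have inC: "T i j \<in> C_below n w" "T j k \<in> C_below n w" "T i k \<in> C_below n w \<longleftrightarrow> k \<le> hess w i"
      using T_in_C_below_iff[OF w] b h by auto
    \<comment> \<open>Two of the three conditions for \<open>R3 i j k\<close> follow from
      \<open>T i j\<close> and \<open>T j k\<close> being below w.\<close>
    have R: "R3 i j k \<in> C_below n w \<longleftrightarrow> k \<le> pmax (perm_inv w) i"
      using R3_in_C_below_iff[OF w b(1-4)] h by (simp add: hess_def)
    have c1: "k \<le> hess w i \<Longrightarrow> (prec (T i j) (T i k) \<and> prec (T i k) (T j k)) \<or> (prec (T j k) (T i k) \<and> prec (T i k) (T i j))"
      and c2: "\<not> k \<le> hess w i \<Longrightarrow> (k \<le> pmax (perm_inv w) i \<longleftrightarrow> prec (T i j) (T j k))"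
      using comp inC R b unfolding compatible_order_def by blast+
    show ?thesis
    proof (cases "k \<le> hess w i")
      case True
      then have ik: "(i, k) \<in> hess_pairs w" using b by (simp add: hess_pairs_def)
      have "(i, k) \<in> set us \<Longrightarrow> prec (T i j) (T i k) \<Longrightarrow> (i, j) \<in> set us"
        "(i, k) \<in> set us \<Longrightarrow> prec (T j k) (T i k) \<Longrightarrow> (j, k) \<in> set us"
        "(i, j) \<in> set us \<Longrightarrow> prec (T i k) (T i j) \<Longrightarrow> (i, k) \<in> set us"
        "(j, k) \<in> set us \<Longrightarrow> prec (T i k) (T j k) \<Longrightarrow> (i, k) \<in> set us"
        by (rule closed'[OF ij], assumption+) (rule closed'[OF jk] closed'[OF ik], assumption+)+
      then have "((i, k) \<in> set us \<longrightarrow> (i, j) \<in> set us \<or> (j, k) \<in> set us) \<and>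
              ((i, j) \<in> set us \<and> (j, k) \<in> set us \<longrightarrow> (i, k) \<in> set us)"
        using c1[OF True] by blast
      then show ?thesis using True by (simp only: if_True)
    next
      case False
      show ?thesis
      proof (cases "k \<le> pmax (perm_inv w) i")
        case True
        then show ?thesis using c2 closed[OF ij, of "(j, k)"] False by simp
      next
        case F: False
        have "T i j \<noteq> T j k" using b by (simp add: T_eq_iff)
        then have "prec (T j k) (T i j)"
          using lin(3) f_in[OF ij] f_in[OF jk] c2 False F unfolding totalp_on_def by auto
        then show ?thesis using closed[OF jk, of "(i, j)"] False F by simp
      qed
    qed
  qed
  show ?thesis
    using ts_eq set_qs dist_qs cond unfolding compat_list_def by blast
qed

lemma filter_eq_appendD:
  "filter P qs = us @ vs \<Longrightarrow> \<exists>us' vs'. qs = us' @ vs' \<and> us = filter P us' \<and> vs = filter P vs'"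
proof (induction qs arbitrary: us)
  case (Cons q qs)
  show ?case
  proof (cases "us = []")
    case True
    then show ?thesis using Cons.prems by (intro exI[of _ "[]"] exI[of _ "q # qs"]) simp
  next
    case False
    show ?thesis
    proof (cases "P q")
      case True
      then obtain us0 where us0: "us = q # us0" "filter P qs = us0 @ vs" using Cons.prems False by (cases us) auto
      from Cons.IH[OF us0(2)] obtain us' vs' where "qs = us' @ vs'" "us0 = filter P us'" "vs = filter P vs'" by blast
      then show ?thesis using True us0 by (intro exI[of _ "q # us'"] exI[of _ vs']) simp
    next
      case F: False
      then have "filter P qs = us @ vs" using Cons.prems by simp
      from Cons.IH[OF this] obtain us' vs' where "qs = us' @ vs'" "us = filter P us'" "vs = filter P vs'" by blast
      then show ?thesis using F by (intro exI[of _ "q # us'"] exI[of _ vs']) simp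
    qed
  qed
qed simp

text \<open>A triple i < j < k involves pairs with first index i or j only, and both differ from p
  for pairs that remain. So its condition is inherited as soon as its type, the branch of the case
  distinction, is the same for u and w.\<close>

lemma compat_list_filter:
  assumes c: "compat_list w qs"
    and pairs: "hess_pairs u = {e \<in> hess_pairs w. fst e \<noteq> p}"
    and type: "\<And>i j k. (i, j) \<in> hess_pairs u \<Longrightarrow> (j, k) \<in> hess_pairs u \<Longrightarrow>
       (k \<le> hess u i \<longleftrightarrow> k \<le> hess w i) \<and>
       (\<not> k \<le> hess w i \<longrightarrow> (k \<le> pmax (perm_inv u) i \<longleftrightarrow> k \<le> pmax (perm_inv w) i))"
  shows "compat_list u (filter (\<lambda>e. fst e \<noteq> p) qs)"
  unfolding compat_list_def
proof (intro conjI allI impI)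
  show "distinct (filter (\<lambda>e. fst e \<noteq> p) qs)" "set (filter (\<lambda>e. fst e \<noteq> p) qs) = hess_pairs u"
    using c pairs by (auto simp: compat_list_def)
next
  fix us vs i j k
  assume A: "filter (\<lambda>e. fst e \<noteq> p) qs = us @ vs \<and> (i, j) \<in> hess_pairs u \<and> (j, k) \<in> hess_pairs u"
  then obtain us' vs' where q: "qs = us' @ vs'" "us = filter (\<lambda>e. fst e \<noteq> p) us'"
    using filter_eq_appendD by blast
  have ij: "(i, j) \<in> hess_pairs w" "(j, k) \<in> hess_pairs w" "i \<noteq> p" "j \<noteq> p" using A pairs by auto
  have mem: "(i, x) \<in> set us \<longleftrightarrow> (i, x) \<in> set us'" "(j, x) \<in> set us \<longleftrightarrow> (j, x) \<in> set us'" for x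
    using q(2) ij by auto
  have "if k \<le> hess w i
         then ((i, k) \<in> set us' \<longrightarrow> (i, j) \<in> set us' \<or> (j, k) \<in> set us') \<and>
              ((i, j) \<in> set us' \<and> (j, k) \<in> set us' \<longrightarrow> (i, k) \<in> set us')
         else if k \<le> pmax (perm_inv w) i then (j, k) \<in> set us' \<longrightarrow> (i, j) \<in> set us'
         else (i, j) \<in> set us' \<longrightarrow> (j, k) \<in> set us'"
    using c ij q(1) unfolding compat_list_def by blast
  then show "if k \<le> hess u i
         then ((i, k) \<in> set us \<longrightarrow> (i, j) \<in> set us \<or> (j, k) \<in> set us) \<and>
              ((i, j) \<in> set us \<and> (j, k) \<in> set us \<longrightarrow> (i, k) \<in> set us)
         else if k \<le> pmax (perm_inv u) i then (j, k) \<in> set us \<longrightarrow> (i, j) \<in> set us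
         else (i, j) \<in> set us \<longrightarrow> (j, k) \<in> set us"
    unfolding mem using type[of i j k] A by (auto split: if_splits)
qed

lemma hess_pairs_inv: "w permutes S \<Longrightarrow> hess_pairs (perm_inv w) = hess_pairs w"
  by (simp add: hess_pairs_def hess_inv)

context split_off begin

lemma hess_pairs_w':
  assumes "tight n w"
  shows "hess_pairs w' = {e \<in> hess_pairs w. fst e \<noteq> p}"
proof -
  have "(i, j) \<in> hess_pairs w' \<longleftrightarrow> (i, j) \<in> hess_pairs w \<and> i \<noteq> p" for i j
    using tight_w'(2)[OF assms, of i] hess_w'_below[of i] hess_below[OF w, of i]
    by (cases "p < i"; cases "i = p") (auto simp: hess_pairs_def)
  then show ?thesis by auto
qed

lemma hess_pairs_first: "Pair p ` {Suc p..<Suc r} = {e \<in> hess_pairs w. fst e = p}"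
proof -
  have "(p, j) \<in> hess_pairs w \<longleftrightarrow> j \<in> {Suc p..<Suc r}" for j
    using hess_p p by (auto simp: hess_pairs_def)
  then show ?thesis by (auto simp del: atLeastLessThan_iff)
qed

text \<open>By \<open>tight_hess_hess_le\<close> at least one of the two maxima of \<open>w'\<close>
  at i reaches k. Passing to w can only enlarge them, but \<open>k > hess w i\<close> means that not
  both maxima of w reach k; so the same one does for w and \<open>w'\<close>.\<close>

lemma type_w':
  assumes t: "tight n w" and ij: "(i, j) \<in> hess_pairs w'" and jk: "(j, k) \<in> hess_pairs w'" and k: "\<not> k \<le> hess w i"
  shows "k \<le> pmax (perm_inv w') i \<longleftrightarrow> k \<le> pmax (perm_inv w) i" "k \<le> pmax w' i \<longleftrightarrow> k \<le> pmax w i"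
proof -
  have "p < i" using hess_w'_below[of i] ij by (cases "p < i") (auto simp: hess_pairs_def)
  have "k \<le> hess w' j" "j \<le> hess w' i" using ij jk by (auto simp: hess_pairs_def)
  then have "k \<le> hess w' (hess w' i)" using hess_mono[of j "hess w' i" w'] by simp
  then have "k \<le> max (pmax w' i) (pmax (perm_inv w') i)"
    using tight_hess_hess_le[OF w' _ tight_w'(1)[OF t], of i] by simp
  then show "k \<le> pmax (perm_inv w') i \<longleftrightarrow> k \<le> pmax (perm_inv w) i" "k \<le> pmax w' i \<longleftrightarrow> k \<le> pmax w i"
    using pmax_w'_le[OF \<open>p < i\<close>] pmax_inv_w'_le[OF \<open>p < i\<close>] k by (auto simp: hess_def)
qed

lemma type_hess_w':
  assumes t: "tight n w" and ij: "(i, j) \<in> hess_pairs w'"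
  shows "hess w' i = hess w i"
  using tight_w'(2)[OF t, of i] hess_w'_below[of i] ij by (cases "p < i") (auto simp: hess_pairs_def)

lemma compat_list_w':
  "tight n w \<Longrightarrow> compat_list w qs \<Longrightarrow> compat_list w' (filter (\<lambda>e. fst e \<noteq> p) qs)"
  by (erule compat_list_filter) (use hess_pairs_w' type_w' type_hess_w' in auto)

lemma compat_list_inv_w':
  assumes t: "tight n w" and c: "compat_list (perm_inv w) qs"
  shows "compat_list (perm_inv w') (filter (\<lambda>e. fst e \<noteq> p) qs)"
  by (rule compat_list_filter[OF c])
     (use hess_pairs_w'[OF t] type_w'[OF t] type_hess_w'[OF t] in
       \<open>auto simp: hess_pairs_inv[OF w] hess_pairs_inv[OF w'] hess_inv[OF w] hess_inv[OF w']
          perm_inv_inv[OF w] perm_inv_inv[OF w']\<close>)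

end

section \<open>The cycle as a block of transpositions\<close>

lemma pair_prod_cyc:
  assumes "p \<le> r"
  shows "inc_chain id (map (Pair p) [Suc p..<Suc r]) \<and> pair_prod (map (Pair p) [Suc p..<Suc r]) = cyc p r"
  using assms
proof (induction r rule: dec_induct)
  case base
  have "cyc p p = id" by (auto simp: fun_eq_iff cyc_def)
  then show ?case by simp
next
  case (step r)
  have eq: "map (Pair p) [Suc p..<Suc (Suc r)] = map (Pair p) [Suc p..<Suc r] @ [(p, Suc r)]"
    using step by simp
  have "cyc p r \<circ> T p (Suc r) = cyc p (Suc r)"
    using step by (auto simp: fun_eq_iff cyc_def Transposition.transpose_def)
  moreover have "cyc p r p < cyc p r (Suc r)" using step by (simp add: cyc_def)
  ultimately show ?case
    using step.IH unfolding eq inc_chain_append pair_prod_append pair_prod_Cons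
    by (simp only: id_comp inc_chain.simps pair_prod_Nil comp_id simp_thms)
qed

lemma pair_prod_cyc_inv:
  assumes "p \<le> r"
  shows "pair_prod (map (Pair p) (rev [Suc p..<Suc r])) = cyc_inv p r"
  using assms
proof (induction r rule: dec_induct)
  case base
  have "cyc_inv p p = id" by (auto simp: fun_eq_iff cyc_inv_def)
  then show ?case by simp
next
  case (step r)
  have eq: "map (Pair p) (rev [Suc p..<Suc (Suc r)]) = (p, Suc r) # map (Pair p) (rev [Suc p..<Suc r])"
    using step by simp
  have "T p (Suc r) \<circ> cyc_inv p r = cyc_inv p (Suc r)"
    using step by (auto simp: fun_eq_iff cyc_inv_def Transposition.transpose_def)
  then show ?case
    using step.IH unfolding eq pair_prod_Cons by (simp only:)
qed

text \<open>The entry at p starts below all others and is replaced in turn by u r, u (r - 1), ..., u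
  (p + 1), which increase because u decreases.\<close>

lemma inc_chain_decreasing:
  assumes "p \<le> r" "\<And>x. p < x \<Longrightarrow> x \<le> r \<Longrightarrow> u p < u x"
    "\<And>x y. p < x \<Longrightarrow> x < y \<Longrightarrow> y \<le> r \<Longrightarrow> u y < u x"
  shows "inc_chain u (map (Pair p) (rev [Suc p..<Suc r]))"
  using assms
proof (induction r arbitrary: u rule: dec_induct)
  case (step r)
  have eq: "map (Pair p) (rev [Suc p..<Suc (Suc r)]) = (p, Suc r) # map (Pair p) (rev [Suc p..<Suc r])"
    using step by simp
  have v: "(u \<circ> T p (Suc r)) p = u (Suc r)" "(u \<circ> T p (Suc r)) x = u x" if "p < x" "x \<le> r" for x
    using that by simp_all
  have "inc_chain (u \<circ> T p (Suc r)) (map (Pair p) (rev [Suc p..<Suc r]))"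
    by (rule step.IH) (use v step.prems in simp_all)
  then show ?case unfolding eq inc_chain.simps using step.prems(1)[of "Suc r"] step.hyps by simp
qed simp

text \<open>All comparisons in the chain are between values above p, and the cycle preserves their
  order.\<close>

lemma inc_chain_cyc_comp:
  assumes "x permutes {Suc p..n}" "\<And>i j. (i, j) \<in> set qs \<Longrightarrow> p < i \<and> i < j \<and> j \<le> n" "inc_chain x qs"
  shows "inc_chain (cyc p r \<circ> x) qs"
  using assms
proof (induction qs arbitrary: x)
  case (Cons e qs)
  obtain a b where e: "e = (a, b)" by (cases e)
  have ab: "p < a" "a < b" "b \<le> n" using Cons.prems(2)[of a b] e by auto
  have gt: "p < x a" "p < x b"
    using permutes_ge[OF Cons.prems(1), of a] permutes_ge[OF Cons.prems(1), of b] ab by auto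
  have lt: "x a < x b" "inc_chain (x \<circ> T a b) qs" using Cons.prems(3) e by simp_all
  have "T a b permutes {Suc p..n}" by (rule permutes_swap_id) (use ab in auto)
  then have "x \<circ> T a b permutes {Suc p..n}" by (rule permutes_compose[OF _ Cons.prems(1)])
  then have "inc_chain (cyc p r \<circ> (x \<circ> T a b)) qs"
    using Cons.IH lt(2) Cons.prems(2) by (metis list.set_intros(2))
  moreover have "cyc p r (x a) < cyc p r (x b)" using gt lt by (auto simp: cyc_def)
  ultimately show ?case unfolding e inc_chain.simps comp_assoc by simp
qed simp

context split_off begin

lemma chain_front:
  assumes qs: "set qs = hess_pairs w'" "inc_chain id qs" "pair_prod qs = w'"
  shows "inc_chain id (map (Pair p) [Suc p..<Suc r] @ qs)" "pair_prod (map (Pair p) [Suc p..<Suc r] @ qs) = w"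
proof -
  have "p < i \<and> i < j \<and> j \<le> n" if "(i, j) \<in> set qs" for i j
  proof -
    have "p < i" using that qs(1) hess_w'_below[of i] by (cases "p < i") (auto simp: hess_pairs_def)
    then show ?thesis using hess_pairs_le[OF w'1, of i j] that qs(1) by auto
  qed
  then have "inc_chain (cyc p r \<circ> id) qs"
    using inc_chain_cyc_comp[of id p n qs r] qs(2) permutes_id by blast
  then show "inc_chain id (map (Pair p) [Suc p..<Suc r] @ qs)"
    unfolding inc_chain_append id_comp comp_id using pair_prod_cyc[OF r(1)] by (simp only: simp_thms)
  show "pair_prod (map (Pair p) [Suc p..<Suc r] @ qs) = w"
    unfolding pair_prod_append qs(3) using pair_prod_cyc[OF r(1)] w_eq by (simp only:)
qed

lemma perm_inv_w_eq: "perm_inv w = perm_inv w' \<circ> cyc_inv p r"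
proof -
  have "perm_inv w' \<circ> cyc_inv p r = perm_inv w \<circ> (cyc p r \<circ> cyc_inv p r)"
    unfolding inv_w' comp_assoc ..
  also have "cyc p r \<circ> cyc_inv p r = id" using r(1) by (simp add: fun_eq_iff cyc_cyc_inv)
  finally show ?thesis by (simp only: comp_id)
qed

text \<open>The inverse of w is the inverse of \<open>w'\<close> times the inverse cycle, whose
  factors are T_{p,r}, ..., T_{p,p+1}. Since \<open>perm_inv w'\<close> at z is
  \<open>perm_inv w\<close> at z - 1 for z in {p<..r}, the decrease on {p..r} shifts to {p<..r} and
  makes these factors ascents.\<close>

lemma chain_back:
  assumes t: "tight n w" and qs: "inc_chain id qs" "pair_prod qs = perm_inv w'"
  shows "inc_chain id (qs @ map (Pair p) (rev [Suc p..<Suc r]))"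
    "pair_prod (qs @ map (Pair p) (rev [Suc p..<Suc r])) = perm_inv w"
proof -
  let ?u = "perm_inv w'"
  have up: "?u p = p" using permutes_below[OF permutes_inv[OF w']] by simp
  have "inc_chain ?u (map (Pair p) (rev [Suc p..<Suc r]))"
  proof (rule inc_chain_decreasing[OF r(1)])
    fix x assume "p < x"
    then show "?u p < ?u x" using up permutes_ge[OF permutes_inv[OF w'], of x] by simp
  next
    fix x y assume xy: "p < x" "x < y" "y \<le> r"
    have "?u z = perm_inv w (z - 1)" if "p < z" "z \<le> r" for z
      unfolding inv_w' using that by (simp add: cyc_def)
    moreover have "perm_inv w (y - 1) < perm_inv w (x - 1)"
    proof -
      have "\<forall>x y. p \<le> x \<and> x < y \<and> y \<le> r \<longrightarrow> perm_inv w y < perm_inv w x"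
        using tight_decreasing[OF w p(1) t] le by blast
      moreover have "p \<le> x - 1" "x - 1 < y - 1" "y - 1 \<le> r" using xy by auto
      ultimately show ?thesis by blast
    qed
    ultimately show "?u y < ?u x" using xy by simp
  qed
  then show "inc_chain id (qs @ map (Pair p) (rev [Suc p..<Suc r]))"
    unfolding inc_chain_append id_comp qs(2) using qs(1) by blast
  show "pair_prod (qs @ map (Pair p) (rev [Suc p..<Suc r])) = perm_inv w"
    unfolding pair_prod_append qs(2) pair_prod_cyc_inv[OF r(1)] perm_inv_w_eq ..
qed

end

section \<open>Chains by induction on the first moved index\<close>

lemma split_off_cases:
  assumes w: "w permutes {p..n}" "1 \<le> p" "p \<le> n"
  shows "split_off n p w \<or> (split_off n p (perm_inv w) \<and> perm_inv w p < w p)"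
proof (cases "w p \<le> perm_inv w p")
  case True
  then show ?thesis using w by (simp add: split_off_def)
next
  case False
  then show ?thesis using w permutes_inv[OF w(1)] perm_inv_inv[OF w(1)] by (simp add: split_off_def)
qed

lemma hess_pairs_id: "hess_pairs id = {}"
proof -
  have "hess id i = i" for i by (rule hess_below[of id "Suc i"]) (auto simp: permutes_id)
  then show ?thesis unfolding hess_pairs_def by (metis (no_types, lifting) Collect_empty_eq case_prodE leD)
qed

text \<open>Built recursively: the block of pairs with first index p stands in front, in increasing
  order, if \<open>w p \<le> perm_inv w p\<close>, and at the end, in decreasing order,
  otherwise.\<close>

lemma tight_exists_chain:
  assumes "w permutes {p..n}" "1 \<le> p" "tight n w"
  shows "\<exists>qs. distinct qs \<and> set qs = hess_pairs w \<and> inc_chain id qs \<and> pair_prod qs = w"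
  using assms
proof (induction "Suc n - p" arbitrary: p w)
  case 0
  then have "{p..n} = {}" by auto
  then have "w = id" using 0 by simp
  show ?case unfolding \<open>w = id\<close> hess_pairs_id by (intro exI[of _ "[]"]) (simp add: pair_prod_def)
next
  case (Suc d)
  then have p: "p \<le> n" by simp
  have inj: "distinct (map (Pair p) xs)" if "distinct xs" for xs :: "nat list"
    using that by (simp add: distinct_map inj_on_def)
  from split_off_cases[OF Suc.prems(1,2) p] show ?case
  proof
    assume "split_off n p w"
    then interpret split_off n p w .
    have "d = Suc n - Suc p" using Suc.hyps(2) by simp
    from Suc.hyps(1)[OF this w' _ tight_w'(1)[OF Suc.prems(3)]] obtain qs where
      qs: "distinct qs" "set qs = hess_pairs w'" "inc_chain id qs" "pair_prod qs = w'" by auto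
    let ?qs = "map (Pair p) [Suc p..<Suc r] @ qs"
    have "set ?qs = hess_pairs w"
      using qs(2) hess_pairs_w'[OF Suc.prems(3)] hess_pairs_first by (auto simp del: upt_Suc)
    moreover have "distinct ?qs"
      using qs(1,2) hess_pairs_w'[OF Suc.prems(3)] inj[of "[Suc p..<Suc r]"] by (auto simp del: upt_Suc)
    ultimately show ?case using chain_front[OF qs(2-4)] by blast
  next
    assume A: "split_off n p (perm_inv w) \<and> perm_inv w p < w p"
    then interpret s: split_off n p "perm_inv w" by simp
    have t: "tight n (perm_inv w)" using Suc.prems tight_inv permutes_1 by blast
    have "tight n (perm_inv s.w')" using s.tight_w'(1)[OF t] tight_inv[OF s.w'1] by simp
    moreover have "d = Suc n - Suc p" using Suc.hyps(2) by simp
    ultimately obtain qs where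
      qs: "distinct qs" "set qs = hess_pairs (perm_inv s.w')" "inc_chain id qs" "pair_prod qs = perm_inv s.w'"
      using Suc.hyps(1)[of "Suc p" "perm_inv s.w'"] permutes_inv[OF s.w'] by auto
    have set_qs: "set qs = {e \<in> hess_pairs w. fst e \<noteq> p}"
      using qs(2) hess_pairs_inv[OF s.w'] hess_pairs_inv[OF Suc.prems(1)] s.hess_pairs_w'[OF t] by simp
    let ?qs = "qs @ map (Pair p) (rev [Suc p..<Suc (perm_inv w p)])"
    have "set ?qs = hess_pairs w"
      using set_qs s.hess_pairs_first hess_pairs_inv[OF Suc.prems(1)] by (auto simp del: upt_Suc)
    moreover have "distinct ?qs"
      using qs(1) set_qs inj[of "rev [Suc p..<Suc (perm_inv w p)]"] by (auto simp del: upt_Suc)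
    ultimately show ?case
      using s.chain_back[OF t qs(3,4)] unfolding perm_inv_inv[OF Suc.prems(1)] by blast
  qed
qed

text \<open>The hypothesis says that for k beyond m(p) the triple p < j < k is always in the last
  branch of compatibility, so \<open>(j, k)\<close> precedes \<open>(p, j)\<close>. This is the
  condition \<open>path\<close> of the collection lemma.\<close>

lemma compat_list_collect:
  assumes w: "w permutes {p..n}" "1 \<le> p" and c: "compat_list w qs"
    and L: "\<And>j k. (p, j) \<in> hess_pairs w \<Longrightarrow> (j, k) \<in> hess_pairs w \<Longrightarrow> hess w p < k \<Longrightarrow> \<not> k \<le> pmax (perm_inv w) p"
  shows "rev_equiv qs (filter (\<lambda>e. fst e \<noteq> p) qs @ map (Pair p) (rev [Suc p..<Suc (hess w p)]))"
proof -
  have set: "set qs = hess_pairs w" and dist: "distinct qs" using c by (auto simp: compat_list_def)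
  have cond: "if k \<le> hess w i
         then ((i, k) \<in> set us \<longrightarrow> (i, j) \<in> set us \<or> (j, k) \<in> set us) \<and>
              ((i, j) \<in> set us \<and> (j, k) \<in> set us \<longrightarrow> (i, k) \<in> set us)
         else if k \<le> pmax (perm_inv w) i then (j, k) \<in> set us \<longrightarrow> (i, j) \<in> set us
         else (i, j) \<in> set us \<longrightarrow> (j, k) \<in> set us"
    if "qs = us @ vs" "(i, j) \<in> hess_pairs w" "(j, k) \<in> hess_pairs w" for us vs i j k
    using c that unfolding compat_list_def by blast
  have clique: "(i, j) \<in> hess_pairs w" if "p \<le> i" "i < j" "j \<le> hess w p" for i j
    using that w(2) hess_mono[of p i w] by (auto simp: hess_pairs_def)
  have hm: "hess w p \<le> hess w i" if "p \<le> i" for i using hess_mono[OF that] .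
  show ?thesis
  proof (rule collect_first_index)
    show "p \<le> i \<and> i < j" if "(i, j) \<in> set qs" for i j
      using that hess_below[OF w(1), of i] unfolding set by (cases "i < p") (auto simp: hess_pairs_def)
    show "(i, j) \<in> set qs" if "p \<le> i" "i < j" "j \<le> hess w p" for i j using clique[OF that] set by simp
    show "j \<le> hess w p" if "(p, j) \<in> set qs" for j using that unfolding set by (simp add: hess_pairs_def)
    show "distinct qs" by (rule dist)
    show "(i, j) \<in> set us \<or> (j, k) \<in> set us"
      if "qs = us @ vs" "p \<le> i" "i < j" "j < k" "k \<le> hess w p" "(i, k) \<in> set us" for us vs i j k
      using cond[OF that(1), of i j k] clique[of i j] clique[of j k] hm[of i] that by auto
    show "(i, k) \<in> set us"
      if "qs = us @ vs" "p \<le> i" "i < j" "j < k" "k \<le> hess w p" "(i, j) \<in> set us" "(j, k) \<in> set us" for us vs i j k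
      using cond[OF that(1), of i j k] clique[of i j] clique[of j k] hm[of i] that by auto
    show "(j, k) \<in> set us"
      if "qs = us @ vs" "(p, j) \<in> set us" "(j, k) \<in> set qs" "hess w p < k" for us vs j k
    proof -
      have m: "(p, j) \<in> hess_pairs w" "(j, k) \<in> hess_pairs w" using that set by auto
      show ?thesis using cond[OF that(1) m] L[OF m that(4)] that by (auto split: if_splits)
    qed
  qed
qed

text \<open>The mirror image: if \<open>(p, j)\<close> always precedes \<open>(j, k)\<close> for k
  beyond m(p), then \<open>path\<close> holds for the reversed list. Biclosedness passes to the
  reversed list because it is preserved by complements.\<close>

lemma compat_list_rev_collect:
  assumes w: "w permutes {p..n}" "1 \<le> p" and c: "compat_list w qs"
    and R: "\<And>j k. (p, j) \<in> hess_pairs w \<Longrightarrow> (j, k) \<in> hess_pairs w \<Longrightarrow> hess w p < k \<Longrightarrow> k \<le> pmax (perm_inv w) p"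
  shows "rev_equiv (rev qs) (filter (\<lambda>e. fst e \<noteq> p) (rev qs) @ map (Pair p) (rev [Suc p..<Suc (hess w p)]))"
proof -
  have set: "set qs = hess_pairs w" and dist: "distinct qs" using c by (auto simp: compat_list_def)
  have cond: "(if k \<le> hess w i
         then ((i, k) \<in> set (rev vs) \<longrightarrow> (i, j) \<in> set (rev vs) \<or> (j, k) \<in> set (rev vs)) \<and>
              ((i, j) \<in> set (rev vs) \<and> (j, k) \<in> set (rev vs) \<longrightarrow> (i, k) \<in> set (rev vs))
         else if k \<le> pmax (perm_inv w) i then (j, k) \<in> set (rev vs) \<longrightarrow> (i, j) \<in> set (rev vs)
         else (i, j) \<in> set (rev vs) \<longrightarrow> (j, k) \<in> set (rev vs))"
    if "rev qs = us @ vs" "(i, j) \<in> hess_pairs w" "(j, k) \<in> hess_pairs w" for us vs i j k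
  proof -
    have "qs = rev vs @ rev us" using that(1) by (metis rev_append rev_rev_ident)
    then show ?thesis using c that unfolding compat_list_def by blast
  qed
  have compl: "e \<in> set us \<longleftrightarrow> e \<notin> set vs" if "rev qs = us @ vs" "e \<in> hess_pairs w" for us vs e
  proof -
    have "distinct (us @ vs)" "set (us @ vs) = hess_pairs w"
      using dist set unfolding that(1)[symmetric] by simp_all
    then show ?thesis using that(2) by auto
  qed
  have clique: "(i, j) \<in> hess_pairs w" if "p \<le> i" "i < j" "j \<le> hess w p" for i j
    using that w(2) hess_mono[of p i w] by (auto simp: hess_pairs_def)
  have hm: "hess w p \<le> hess w i" if "p \<le> i" for i using hess_mono[OF that] .
  show ?thesis
  proof (rule collect_first_index)
    show "p \<le> i \<and> i < j" if "(i, j) \<in> set (rev qs)" for i j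
      using that hess_below[OF w(1), of i] set by (cases "i < p") (auto simp: hess_pairs_def)
    show "(i, j) \<in> set (rev qs)" if "p \<le> i" "i < j" "j \<le> hess w p" for i j using clique[OF that] set by simp
    show "j \<le> hess w p" if "(p, j) \<in> set (rev qs)" for j using that set by (simp add: hess_pairs_def)
    show "distinct (rev qs)" using dist by simp
    show "(i, j) \<in> set us \<or> (j, k) \<in> set us"
      if "rev qs = us @ vs" "p \<le> i" "i < j" "j < k" "k \<le> hess w p" "(i, k) \<in> set us" for us vs i j k
      using cond[OF that(1), of i j k] clique[of i j] clique[of j k] clique[of i k] hm[of i] that
        compl[OF that(1), of "(i, j)"] compl[OF that(1), of "(j, k)"] compl[OF that(1), of "(i, k)"] by auto
    show "(i, k) \<in> set us"
      if "rev qs = us @ vs" "p \<le> i" "i < j" "j < k" "k \<le> hess w p" "(i, j) \<in> set us" "(j, k) \<in> set us" for us vs i j k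
      using cond[OF that(1), of i j k] clique[of i j] clique[of j k] clique[of i k] hm[of i] that
        compl[OF that(1), of "(i, j)"] compl[OF that(1), of "(j, k)"] compl[OF that(1), of "(i, k)"] by auto
    show "(j, k) \<in> set us"
      if "rev qs = us @ vs" "(p, j) \<in> set us" "(j, k) \<in> set (rev qs)" "hess w p < k" for us vs j k
    proof -
      have "set us \<subseteq> set (rev qs)" using that(1) by simp
      then have m: "(p, j) \<in> hess_pairs w" "(j, k) \<in> hess_pairs w" using that(2,3) set by auto
      show ?thesis using cond[OF that(1) m] R[OF m that(4)] that compl[OF that(1) m(1)] compl[OF that(1) m(2)]
        by (auto split: if_splits)
    qed
  qed
qed

text \<open>The block goes to the side where the cycle is split off. If
  \<open>w p \<le> perm_inv w p\<close>, a k beyond m(p) = \<open>w p\<close> exceeds the maximum of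
  w at p, so by \<open>tight_hess_hess_le\<close> the maximum of the inverse reaches it, and the
  block moves to the front. Otherwise m(p) = \<open>perm_inv w p\<close> is itself that maximum, k
  exceeds it, and the block moves to the end.\<close>

lemma compat_list_chain:
  assumes "w permutes {p..n}" "1 \<le> p" "tight n w" "compat_list w qs"
  shows "inc_chain id qs \<and> pair_prod qs = w"
  using assms
proof (induction "Suc n - p" arbitrary: p w qs)
  case 0
  then have "{p..n} = {}" by auto
  then have w: "w = id" using 0 by simp
  have "set qs = hess_pairs w" using 0(5) unfolding compat_list_def by blast
  then have "qs = []" unfolding w hess_pairs_id by simp
  show ?case unfolding w \<open>qs = []\<close> by (simp only: pair_prod_Nil inc_chain.simps simp_thms)
next
  case (Suc d)
  then have p: "p \<le> n" by simp
  let ?qs = "filter (\<lambda>e. fst e \<noteq> p) qs"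
  from split_off_cases[OF Suc.prems(1,2) p] show ?case
  proof
    assume "split_off n p w"
    then interpret split_off n p w .
    note c' = compat_list_w'[OF Suc.prems(3,4)]
    have IH: "inc_chain id ?qs \<and> pair_prod ?qs = w'"
      by (rule Suc.hyps(1)[OF _ w' _ tight_w'(1)[OF Suc.prems(3)] c']) (use Suc.hyps(2) in simp_all)
    have "rev_equiv (rev qs) (filter (\<lambda>e. fst e \<noteq> p) (rev qs) @ map (Pair p) (rev [Suc p..<Suc (hess w p)]))"
    proof (rule compat_list_rev_collect[OF Suc.prems(1,2,4)])
      fix j k assume jk: "(p, j) \<in> hess_pairs w" "(j, k) \<in> hess_pairs w" "hess w p < k"
      then have "k \<le> hess w (hess w p)" using hess_mono[of j "hess w p" w] by (simp add: hess_pairs_def)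
      then have "k \<le> max (pmax w p) (pmax (perm_inv w) p)"
        using tight_hess_hess_le[OF Suc.prems(1-3), of p] by simp
      then show "k \<le> pmax (perm_inv w) p" using jk(3) pmax_first[OF w] hess_p by simp
    qed
    then have "list_equiv qs (map (Pair p) [Suc p..<Suc r] @ ?qs)"
      unfolding rev_equiv_def hess_p rev_append rev_map rev_rev_ident rev_filter by blast
    then show ?case
      using chain_front[of ?qs] IH c' unfolding list_equiv_def compat_list_def by metis
  next
    assume A: "split_off n p (perm_inv w) \<and> perm_inv w p < w p"
    then interpret s: split_off n p "perm_inv w" by simp
    have t: "tight n (perm_inv w)" using Suc.prems tight_inv permutes_1 by blast
    have t': "tight n (perm_inv s.w')" using s.tight_w'(1)[OF t] tight_inv[OF s.w'1] by simp
    have c': "compat_list (perm_inv s.w') ?qs"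
      by (rule s.compat_list_inv_w'[OF t]) (use Suc.prems(4) perm_inv_inv[OF Suc.prems(1)] in simp)
    have IH: "inc_chain id ?qs \<and> pair_prod ?qs = perm_inv s.w'"
      by (rule Suc.hyps(1)[OF _ permutes_inv[OF s.w'] _ t' c']) (use Suc.hyps(2) in simp_all)
    have h: "hess w p = perm_inv w p" using s.hess_p hess_inv[OF Suc.prems(1)] by simp
    have "rev_equiv qs (?qs @ map (Pair p) (rev [Suc p..<Suc (hess w p)]))"
      by (rule compat_list_collect[OF Suc.prems(1,2,4)])
         (use h pmax_first[OF permutes_inv[OF Suc.prems(1)]] in simp)
    then show ?case
      using s.chain_back[OF t, of ?qs] IH unfolding rev_equiv_def list_equiv_def h perm_inv_inv[OF Suc.prems(1)] by metis
  qed
qed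

theorem tight_compatible_chain:
  assumes w: "w permutes {1..n}" and t: "tight n w" and comp: "compatible_order n (C_below n w) prec"
    and ts: "set ts = CT_below n w" "sorted_wrt prec ts"
  shows "chain_property n w ts"
proof -
  obtain qs where qs: "compat_list w qs" "ts = map (\<lambda>(a, b). T a b) qs"
    using compat_list_of_compatible_order[OF w comp ts] by blast
  have c: "inc_chain id qs" "pair_prod qs = w" using compat_list_chain[OF w _ t qs(1)] by auto
  have s: "set qs = hess_pairs w" "distinct qs" using qs(1) by (auto simp: compat_list_def)
  have "length qs = card (hess_pairs w)" using s by (metis distinct_card)
  also have "\<dots> = hess_sum n w"
    using card_CT_below[OF w] unfolding CT_below_eq[OF w] card_image[OF inj_on_T_pairs] .
  finally have len: "inv_count n (pair_prod qs) \<le> length qs" using t c by (simp add: tight_def)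
  have "set qs \<subseteq> index_pairs n" unfolding s(1) using hess_pairs_le[OF w] by (auto simp: index_pairs_def)
  from inc_chain_chain_property[OF this c(1) len] show ?thesis unfolding c(2) qs(2) .
qed

theorem tight_chain_exists:
  assumes w: "w permutes {1..n}" and t: "tight n w"
  shows "\<exists>ts. distinct ts \<and> set ts = CT_below n w \<and> chain_property n w ts"
proof -
  obtain qs where s: "distinct qs" "set qs = hess_pairs w" and c: "inc_chain id qs" "pair_prod qs = w"
    using tight_exists_chain[OF w _ t] by auto
  have "length qs = card (hess_pairs w)" using s by (metis distinct_card)
  also have "\<dots> = hess_sum n w"
    using card_CT_below[OF w] unfolding CT_below_eq[OF w] card_image[OF inj_on_T_pairs] .
  finally have len: "inv_count n (pair_prod qs) \<le> length qs" using t c by (simp add: tight_def)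
  have "set qs \<subseteq> index_pairs n" unfolding s(2) using hess_pairs_le[OF w] by (auto simp: index_pairs_def)
  from inc_chain_chain_property[OF this c(1) len]
  have "chain_property n w (map (\<lambda>(a, b). T a b) qs)" unfolding c(2) .
  moreover have "distinct (map (\<lambda>(a, b). T a b :: perm) qs)"
    using s inj_on_T_pairs[of w] by (simp add: distinct_map)
  moreover have "set (map (\<lambda>(a, b). T a b) qs) = CT_below n w"
    unfolding CT_below_eq[OF w] using s(2) by simp
  ultimately show ?thesis by blast
qed

theorem chain_tight:
  assumes w: "w permutes {1..n}" and ts: "distinct ts" "set ts = CT_below n w" "chain_property n w ts"
  shows "tight n w"
  using chain_property_length[OF ts(3)] card_CT_below[OF w] distinct_card[OF ts(1)] ts(2) by (simp add: tight_def)

section \<open>Flags and Bruhat cells\<close>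

lemma mult_mat_entry:
  assumes "A \<in> carrier_mat nr m" "B \<in> carrier_mat m nc" "i < nr" "j < nc"
  shows "(A * B) $$ (i, j) = (\<Sum>l<m. A $$ (i, l) * B $$ (l, j))"
  using assms by (simp add: scalar_prod_def atLeast0LessThan)

lemma mult_mat_vec_entry:
  assumes "A \<in> carrier_mat nr m" "x \<in> carrier_vec m" "i < nr"
  shows "(A *\<^sub>v x) $ i = (\<Sum>l<m. A $$ (i, l) * x $ l)"
  using assms by (simp add: scalar_prod_def atLeast0LessThan)

lemma GL_carrier: "g \<in> GL n \<Longrightarrow> g \<in> carrier_mat n n"
  by (simp add: GL_def)

lemma GL_I:
  assumes "g \<in> carrier_mat n n" "h \<in> carrier_mat n n" "g * h = 1\<^sub>m n"
  shows "g \<in> GL n"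
proof -
  have "h * g = 1\<^sub>m n" using mat_mult_left_right_inverse[OF assms] .
  then show ?thesis using assms unfolding GL_def invertible_mat_def inverts_mat_def by auto
qed

lemma GL_inverse:
  assumes "g \<in> GL n"
  obtains h where "h \<in> GL n" "g * h = 1\<^sub>m n" "h * g = 1\<^sub>m n"
proof -
  have g: "g \<in> carrier_mat n n" "invertible_mat g" using assms by (auto simp: GL_def)
  then obtain h where h: "g * h = 1\<^sub>m n" "h * g = 1\<^sub>m (dim_row h)"
    unfolding invertible_mat_def inverts_mat_def by auto
  have "dim_col (g * h) = n" "dim_col (h * g) = dim_row h" unfolding h by simp_all
  then have hc: "h \<in> carrier_mat n n" using g by auto
  then have "h * g = 1\<^sub>m n" using h by simp
  then show thesis using that[of h] GL_I[OF hc g(1)] h by simp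
qed

lemma GL_mult:
  assumes "g \<in> GL n" "h \<in> GL n"
  shows "g * h \<in> GL n"
proof -
  obtain g' where g': "g' \<in> GL n" "g * g' = 1\<^sub>m n" using GL_inverse[OF assms(1)] by blast
  obtain h' where h': "h' \<in> GL n" "h * h' = 1\<^sub>m n" using GL_inverse[OF assms(2)] by blast
  note c = GL_carrier[OF assms(1)] GL_carrier[OF assms(2)] GL_carrier[OF g'(1)] GL_carrier[OF h'(1)]
  have "(g * h) * (h' * g') = g * ((h * h') * g')" using c by (simp add: assoc_mult_mat[of _ n n _ n _ n])
  also have "\<dots> = 1\<^sub>m n" using c g' h' by simp
  finally show ?thesis using GL_I[of "g * h" n "h' * g'"] c by simp
qed

lemma borel_GL: "b \<in> borel_subgroup n \<Longrightarrow> b \<in> GL n"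
  by (simp add: borel_subgroup_def)

lemma borel_carrier: "b \<in> borel_subgroup n \<Longrightarrow> b \<in> carrier_mat n n"
  using GL_carrier borel_GL by blast

lemma borel_entry: "b \<in> borel_subgroup n \<Longrightarrow> j < i \<Longrightarrow> i < n \<Longrightarrow> b $$ (i, j) = 0"
  using borel_carrier[of b n] by (auto simp: borel_subgroup_def)

lemma upper_triangular_mult:
  fixes A B :: "complex mat"
  assumes "A \<in> carrier_mat n n" "B \<in> carrier_mat n n" "upper_triangular A" "upper_triangular B"
  shows "upper_triangular (A * B)"
proof (rule upper_triangularI)
  fix i j assume ij: "j < i" "i < dim_row (A * B)"
  have "A $$ (i, l) * B $$ (l, j) = 0" if "l < n" for l
    using upper_triangularD[OF assms(3), of l i] upper_triangularD[OF assms(4), of j l] that assms ij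
    by (cases "l < i") auto
  then have "(\<Sum>l<n. A $$ (i, l) * B $$ (l, j)) = 0" by (intro sum.neutral) simp
  then show "(A * B) $$ (i, j) = 0"
    using mult_mat_entry[OF assms(1,2), of i j] ij assms by simp
qed

lemma borel_mult: "a \<in> borel_subgroup n \<Longrightarrow> b \<in> borel_subgroup n \<Longrightarrow> a * b \<in> borel_subgroup n"
  using GL_mult upper_triangular_mult[of a n b] GL_carrier by (auto simp: borel_subgroup_def)

lemma borel_diag_nonzero:
  assumes "b \<in> borel_subgroup n" "i < n"
  shows "b $$ (i, i) \<noteq> 0"
proof -
  obtain h where h: "h \<in> GL n" "b * h = 1\<^sub>m n" using GL_inverse[OF borel_GL[OF assms(1)]] by blast
  have "det b * det h = det (1\<^sub>m n :: complex mat)"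
    using det_mult[OF borel_carrier[OF assms(1)] GL_carrier[OF h(1)]] h(2) by simp
  then have "det b \<noteq> 0" by auto
  moreover have "det b = prod_list (diag_mat b)"
    using det_upper_triangular[OF _ borel_carrier[OF assms(1)]] assms(1) by (simp add: borel_subgroup_def)
  ultimately have "0 \<notin> set (diag_mat b)" by (metis prod_list_zero_iff)
  then show ?thesis using assms(2) borel_carrier[OF assms(1)] by (auto simp: diag_mat_def)
qed

lemma borel_I:
  assumes b: "b \<in> carrier_mat n n" "upper_triangular b" and nz: "\<And>i. i < n \<Longrightarrow> b $$ (i, i) \<noteq> 0"
  shows "b \<in> borel_subgroup n"
proof -
  have "0 \<notin> set (diag_mat b)" using nz b by (auto simp: diag_mat_def)
  then have "det b \<noteq> 0" using det_upper_triangular[OF b(2,1)] by (simp add: prod_list_zero_iff)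
  from det_non_zero_imp_unit[OF b(1) this, of "()"] obtain h where "h \<in> carrier_mat n n" "b * h = 1\<^sub>m n"
    unfolding Units_def ring_mat_def by auto
  then show ?thesis using GL_I[OF b(1)] b by (simp add: borel_subgroup_def)
qed

lemma borel_one [simp]: "1\<^sub>m n \<in> borel_subgroup n"
  by (rule borel_I) auto

lemma borel_inverse:
  assumes b: "b \<in> borel_subgroup n"
  obtains h where "h \<in> borel_subgroup n" "b * h = 1\<^sub>m n" "h * b = 1\<^sub>m n"
proof -
  obtain h where h: "h \<in> GL n" "b * h = 1\<^sub>m n" "h * b = 1\<^sub>m n" using GL_inverse[OF borel_GL[OF b]] by blast
  have zero: "h $$ (i, j) = 0" if "j < i" "i < n" for i j
    using that
  \<comment> \<open>From the last row upwards: in row i of \<open>b * h\<close> the terms left of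
    the diagonal vanish by triangularity of b, those right of it by the rows of h already
    treated.\<close>
  proof (induction "n - i" arbitrary: i rule: less_induct)
    case less
    have "(\<Sum>l<n. b $$ (i, l) * h $$ (l, j)) = 0"
      using mult_mat_entry[OF borel_carrier[OF b] GL_carrier[OF h(1)], of i j] h(2) less.prems by simp
    moreover have z: "b $$ (i, l) * h $$ (l, j) = 0" if "l < n" "l \<noteq> i" for l
      using borel_entry[OF b, of l i] less.hyps[of l] less.prems that by (cases "l < i") auto
    have "(\<Sum>l \<in> {..<n} - {i}. b $$ (i, l) * h $$ (l, j)) = 0"
      by (intro sum.neutral ballI z) auto
    then have "(\<Sum>l<n. b $$ (i, l) * h $$ (l, j)) = b $$ (i, i) * h $$ (i, j)"
      using less.prems sum.remove[of "{..<n}" i "\<lambda>l. b $$ (i, l) * h $$ (l, j)"] by simp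
    ultimately show ?case using borel_diag_nonzero[OF b less.prems(2)] by simp
  qed
  have "h \<in> borel_subgroup n"
    unfolding borel_subgroup_def using h(1) zero GL_carrier[OF h(1)] by auto
  then show thesis using that h by blast
qed

section \<open>Flags as cosets of the Borel subgroup\<close>

lemma flag_of_mult:
  assumes "g \<in> carrier_mat n n" "h \<in> carrier_mat n n"
  shows "flag_of n (g * h) d = (\<lambda>x. g *\<^sub>v x) ` flag_of n h d"
proof -
  have "(g * h) *\<^sub>v x = g *\<^sub>v (h *\<^sub>v x)" if "x \<in> std_flag n d" for x
    using that assms by (intro assoc_mult_mat_vec) (auto simp: std_flag_def)
  then show ?thesis unfolding flag_of_def by (auto simp: image_iff)
qed

lemma std_flag_carrier: "x \<in> std_flag n d \<Longrightarrow> x \<in> carrier_vec n"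
  by (simp add: std_flag_def)

lemma borel_std_flag:
  assumes "b \<in> borel_subgroup n" "x \<in> std_flag n d"
  shows "b *\<^sub>v x \<in> std_flag n d"
proof -
  have "(b *\<^sub>v x) $ k = 0" if "k < n" "d \<le> k" for k
  proof -
    have "b $$ (k, l) * x $ l = 0" if "l < n" for l
      using borel_entry[OF assms(1), of l k] assms(2) that \<open>k < n\<close> \<open>d \<le> k\<close>
      by (cases "l < k") (auto simp: std_flag_def)
    then have "(\<Sum>l<n. b $$ (k, l) * x $ l) = 0" by (intro sum.neutral) simp
    then show ?thesis
      using mult_mat_vec_entry[OF borel_carrier[OF assms(1)] std_flag_carrier[OF assms(2)] that(1)] by simp
  qed
  moreover have "b *\<^sub>v x \<in> carrier_vec n"
    by (rule mult_mat_vec_carrier[OF borel_carrier[OF assms(1)] std_flag_carrier[OF assms(2)]])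
  ultimately show ?thesis by (simp only: std_flag_def) blast
qed

lemma flag_of_borel: 
  assumes "b \<in> borel_subgroup n"
  shows "(\<lambda>x. b *\<^sub>v x) ` std_flag n d = std_flag n d"
proof
  show "(\<lambda>x. b *\<^sub>v x) ` std_flag n d \<subseteq> std_flag n d" using borel_std_flag[OF assms] by auto
  obtain h where h: "h \<in> borel_subgroup n" "b * h = 1\<^sub>m n" using borel_inverse[OF assms] by blast
  show "std_flag n d \<subseteq> (\<lambda>x. b *\<^sub>v x) ` std_flag n d"
  proof
    fix x assume x: "x \<in> std_flag n d"
    have "b *\<^sub>v (h *\<^sub>v x) = (b * h) *\<^sub>v x"
      using borel_carrier[OF assms] borel_carrier[OF h(1)] std_flag_carrier[OF x]
      by (intro assoc_mult_mat_vec[symmetric])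
    then have "b *\<^sub>v (h *\<^sub>v x) = x" using h(2) std_flag_carrier[OF x] by simp
    then show "x \<in> (\<lambda>x. b *\<^sub>v x) ` std_flag n d" using borel_std_flag[OF h(1) x] by (metis imageI)
  qed
qed

lemma flag_of_mult_borel:
  assumes "g \<in> carrier_mat n n" "b \<in> borel_subgroup n"
  shows "flag_of n (g * b) = flag_of n g"
proof
  fix d show "flag_of n (g * b) d = flag_of n g d"
    unfolding flag_of_mult[OF assms(1) borel_carrier[OF assms(2)]]
    unfolding flag_of_def flag_of_borel[OF assms(2)] ..
qed

text \<open>The quotient of g and h preserves the standard flag; testing this on unit vectors shows
  that it is upper triangular.\<close>

lemma flag_of_eqD:
  assumes g: "g \<in> GL n" and h: "h \<in> GL n" and eq: "flag_of n g = flag_of n h"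
  shows "\<exists>b \<in> borel_subgroup n. h = g * b"
proof -
  obtain g' where g': "g' \<in> GL n" "g * g' = 1\<^sub>m n" "g' * g = 1\<^sub>m n" using GL_inverse[OF g] by blast
  note c = GL_carrier[OF g] GL_carrier[OF h] GL_carrier[OF g'(1)]
  let ?b = "g' * h"
  have "flag_of n ?b d = std_flag n d" for d
  proof -
    have "flag_of n ?b d = flag_of n (g' * g) d"
      unfolding flag_of_mult[OF c(3) c(2)] flag_of_mult[OF c(3) c(1)] eq ..
    also have "\<dots> = (\<lambda>x. x) ` std_flag n d"
      unfolding g'(3) flag_of_def by (rule image_cong) (auto simp: std_flag_def)
    finally show ?thesis by simp
  qed
  note fl = this
  have "upper_triangular ?b"
  proof (rule upper_triangularI)
    fix i j assume ij: "j < i" "i < dim_row ?b"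
    then have n: "i < n" "j < n" using c by auto
    have "unit_vec n j \<in> std_flag n (Suc j)" by (auto simp: std_flag_def)
    then have "?b *\<^sub>v unit_vec n j \<in> flag_of n ?b (Suc j)" unfolding flag_of_def by blast
    then have "(?b *\<^sub>v unit_vec n j) $ i = 0" unfolding fl using ij n by (auto simp: std_flag_def)
    moreover have "(?b *\<^sub>v unit_vec n j) $ i = ?b $$ (i, j)"
      using mult_mat_vec_entry[of ?b n n "unit_vec n j" i] c n
      by (simp add: unit_vec_def if_distrib[of "\<lambda>x. _ * x"] cong: if_cong)
    ultimately show "?b $$ (i, j) = 0" by simp
  qed
  then have "?b \<in> borel_subgroup n" using GL_mult[OF g'(1) h] by (simp add: borel_subgroup_def)
  moreover have "g * ?b = h"
  proof -
    have "g * ?b = (g * g') * h" using c by (simp add: assoc_mult_mat[of _ n n _ n _ n])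
    then show ?thesis using c g'(2) by simp
  qed
  ultimately show ?thesis by metis
qed

section \<open>Unipotent matrices and permutation matrices\<close>

lemma lower_unipotent_carrier [simp]: "lower_unipotent n a \<in> carrier_mat n n"
  by (simp add: lower_unipotent_def)

lemma lower_unipotent_GL [simp]: "lower_unipotent n a \<in> GL n"
proof -
  have "det (lower_unipotent n a) = prod_list (diag_mat (lower_unipotent n a))"
    by (rule det_lower_triangular[of n]) (auto simp: lower_unipotent_def)
  also have "diag_mat (lower_unipotent n a) = replicate n 1"
    by (intro nth_equalityI) (auto simp: diag_mat_def lower_unipotent_def)
  finally have "det (lower_unipotent n a) \<noteq> 0" by simp
  from det_non_zero_imp_unit[OF lower_unipotent_carrier this, of "()"] obtain h
    where "h \<in> carrier_mat n n" "lower_unipotent n a * h = 1\<^sub>m n"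
    unfolding Units_def ring_mat_def by auto
  then show ?thesis using GL_I[OF lower_unipotent_carrier] by blast
qed

lemma perm_mat_carrier [simp]: "perm_mat n w \<in> carrier_mat n n"
  by (simp add: perm_mat_def)

lemma perm_mat_dim [simp]: "dim_row (perm_mat n w) = n" "dim_col (perm_mat n w) = n"
  by (simp_all add: perm_mat_def)

lemma lower_unipotent_dim [simp]: "dim_row (lower_unipotent n a) = n" "dim_col (lower_unipotent n a) = n"
  by (simp_all add: lower_unipotent_def)

text \<open>Permutations act on \<open>{1..n}\<close>, but matrices are indexed from 0.\<close>

definition w0 :: "perm \<Rightarrow> nat \<Rightarrow> nat" where
  "w0 w j = w (Suc j) - 1"

lemma w0:
  assumes w: "w permutes {1..n}" and "j < n"
  shows "w (Suc j) = Suc (w0 w j)" "w0 w j < n"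
proof -
  have "1 \<le> w (Suc j) \<and> w (Suc j) \<le> n" using permutes_atLeastAtMost[OF w, of "Suc j"] assms(2) by simp
  then show "w (Suc j) = Suc (w0 w j)" "w0 w j < n" by (auto simp: w0_def)
qed

lemma w0_inj:
  assumes w: "w permutes {1..n}" and "i < n" "j < n" "w0 w i = w0 w j"
  shows "i = j"
proof -
  have "w (Suc i) = w (Suc j)" using w0[OF w] assms by simp
  then show ?thesis using permutes_neq[OF w, of "Suc i" "Suc j"] by auto
qed

lemma w0_surj:
  assumes w: "w permutes {1..n}" and "i < n"
  shows "\<exists>k<n. i = w0 w k"
proof -
  have "1 \<le> perm_inv w (Suc i)" "perm_inv w (Suc i) \<le> n"
    using permutes_inv_atLeastAtMost[OF w, of "Suc i"] assms(2) by auto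
  moreover from this have "w0 w (perm_inv w (Suc i) - 1) = i"
    using permutes_inverses(1)[OF w, of "Suc i"] by (simp add: w0_def)
  ultimately show ?thesis by (intro exI[of _ "perm_inv w (Suc i) - 1"]) auto
qed

lemma perm_mat_entry:
  assumes w: "w permutes {1..n}" and "i < n" "j < n"
  shows "perm_mat n w $$ (i, j) = (if i = w0 w j then 1 else 0)"
  using w0[OF w assms(3)] assms by (auto simp: perm_mat_def)

lemma perm_mat_mult_entry:
  assumes w: "w permutes {1..n}" and A: "A \<in> carrier_mat n n" and "k < n" "s < n"
  shows "(perm_mat n w * A) $$ (w0 w k, s) = A $$ (k, s)"
proof -
  have "(perm_mat n w * A) $$ (w0 w k, s) = (\<Sum>l<n. (if l = k then 1 else 0) * A $$ (l, s))"
    unfolding mult_mat_entry[OF perm_mat_carrier A w0(2)[OF w assms(3)] assms(4)]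
    by (rule sum.cong) (use perm_mat_entry[OF w w0(2)[OF w assms(3)]] w0_inj[OF w] assms in auto)
  then show ?thesis using assms by (simp add: if_distrib[of "\<lambda>x. x * _"] cong: if_cong)
qed

lemma perm_mat_GL:
  assumes w: "w permutes {1..n}"
  shows "perm_mat n w \<in> GL n"
proof (rule GL_I)
  let ?Q = "mat n n (\<lambda>(i, j). if w0 w i = j then 1 else 0) :: complex mat"
  show "?Q \<in> carrier_mat n n" by simp
  show "perm_mat n w * ?Q = 1\<^sub>m n"
  proof (rule eq_matI)
    fix i j assume "i < dim_row (1\<^sub>m n :: complex mat)" "j < dim_col (1\<^sub>m n :: complex mat)"
    then have ij: "i < n" "j < n" by auto
    then obtain k where k: "k < n" "i = w0 w k" using w0_surj[OF w] by blast
    show "(perm_mat n w * ?Q) $$ (i, j) = (1\<^sub>m n :: complex mat) $$ (i, j)"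
      unfolding k(2) using perm_mat_mult_entry[OF w, of ?Q k j] k ij w0(2)[OF w k(1)] by simp
  qed auto
qed simp

text \<open>Every row index has the form \<open>w0 w k\<close>, and in this form the rows of
  \<open>perm_mat n w * A\<close> are simply the rows of A.\<close>

lemma eq_mat_w0I:
  fixes A B :: "complex mat"
  assumes w: "w permutes {1..n}" and "A \<in> carrier_mat n n" "B \<in> carrier_mat n n"
    and "\<And>k s. k < n \<Longrightarrow> s < n \<Longrightarrow> A $$ (w0 w k, s) = B $$ (w0 w k, s)"
  shows "A = B"
proof (rule eq_matI)
  fix i j assume "i < dim_row B" "j < dim_col B"
  then show "A $$ (i, j) = B $$ (i, j)" using w0_surj[OF w, of i] assms by auto
qed (use assms in auto)

section \<open>Elementary matrices and Bruhat cells\<close>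

lemma addrow_mult_entry:
  fixes A :: "complex mat"
  assumes "A \<in> carrier_mat n n" "k < n" "l < n" "i < n" "s < n"
  shows "(addrow_mat n c k l * A) $$ (i, s) = (if i = k then c * A $$ (l, s) + A $$ (i, s) else A $$ (i, s))"
  unfolding addrow_mat[OF assms(1,3), of c k, symmetric] using assms by simp

lemma addrow_mat_entry:
  "i < n \<Longrightarrow> j < n \<Longrightarrow> addrow_mat n (c :: complex) k l $$ (i, j) = (if i = j then 1 else 0) + (if i = k \<and> j = l then c else 0)"
  by (auto simp: addrow_mat_def)

lemma addrow_borel:
  assumes "k < l"
  shows "addrow_mat n c k l \<in> borel_subgroup n"
proof (rule borel_I)
  show "upper_triangular (addrow_mat n c k l)"
    by (rule upper_triangularI) (use assms in \<open>auto simp: addrow_mat_entry\<close>)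
qed (use assms in \<open>auto simp: addrow_mat_entry\<close>)

lemma perm_mat_addrow:
  assumes v: "v permutes {1..n}" and ij: "i < n" "j < n"
  shows "perm_mat n v * addrow_mat n c i j = addrow_mat n c (w0 v i) (w0 v j) * perm_mat n v"
proof (rule eq_mat_w0I[OF v])
  fix k s assume ks: "k < n" "s < n"
  note P = perm_mat_entry[OF v w0(2)[OF v] ks(2)]
  have inj: "w0 v k = w0 v i \<longleftrightarrow> k = i" "w0 v k = w0 v s \<longleftrightarrow> k = s" "w0 v j = w0 v s \<longleftrightarrow> j = s"
    "w0 v i = w0 v s \<longleftrightarrow> i = s"
    using w0_inj[OF v] ks ij by blast+
  have "(addrow_mat n c (w0 v i) (w0 v j) * perm_mat n v) $$ (w0 v k, s) =
      (if k = i then c * (if j = s then 1 else 0) else 0) + (if k = s then 1 else 0)"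
    using addrow_mult_entry[OF perm_mat_carrier w0(2)[OF v ij(1)] w0(2)[OF v ij(2)] w0(2)[OF v ks(1)] ks(2), of c]
    using P[OF ij(2)] P[OF ks(1)] unfolding inj by auto
  also have "\<dots> = (perm_mat n v * addrow_mat n c i j) $$ (w0 v k, s)"
    unfolding perm_mat_mult_entry[OF v addrow_mat_carrier ks] addrow_mat_entry[OF ks] by auto
  finally show "(perm_mat n v * addrow_mat n c i j) $$ (w0 v k, s) =
      (addrow_mat n c (w0 v i) (w0 v j) * perm_mat n v) $$ (w0 v k, s)" by simp
qed (rule mult_carrier_mat[of _ n n]; simp)+

text \<open>The double coset of v for the Borel subgroup. The right factor makes membership
  independent of the matrix chosen to represent a flag.\<close>

definition bruhat_cell :: "nat \<Rightarrow> perm \<Rightarrow> complex mat set" where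
  "bruhat_cell n v = {b * perm_mat n v * b' | b b'. b \<in> borel_subgroup n \<and> b' \<in> borel_subgroup n}"

lemma assoc3: "A \<in> carrier_mat n n \<Longrightarrow> B \<in> carrier_mat n n \<Longrightarrow> C \<in> carrier_mat n n \<Longrightarrow> A * B * C = A * (B * C)"
  for A :: "complex mat"
  by (rule assoc_mult_mat)

lemma bruhat_cell_mult:
  assumes g: "g \<in> bruhat_cell n v" and a: "a \<in> borel_subgroup n"
  shows "a * g \<in> bruhat_cell n v" "g * a \<in> bruhat_cell n v"
proof -
  obtain b b' where b: "b \<in> borel_subgroup n" "b' \<in> borel_subgroup n" "g = b * perm_mat n v * b'"
    using g by (auto simp: bruhat_cell_def)
  note c = borel_carrier[OF a] borel_carrier[OF b(1)] borel_carrier[OF b(2)] perm_mat_carrier[of n v]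
  have "a * g = (a * b) * perm_mat n v * b'" "g * a = b * perm_mat n v * (b' * a)"
    unfolding b(3) using c
    by (simp_all add: assoc_mult_mat[of _ n n _ n _ n] mult_carrier_mat[of _ n n _ n])
  then show "a * g \<in> bruhat_cell n v" "g * a \<in> bruhat_cell n v"
    using borel_mult[OF a b(1)] borel_mult[OF b(2) a] b unfolding bruhat_cell_def by blast+
qed

lemma bruhat_cell_GL:
  assumes "v permutes {1..n}" "g \<in> bruhat_cell n v"
  shows "g \<in> GL n"
  using assms perm_mat_GL GL_mult borel_GL by (auto simp: bruhat_cell_def)

lemma perm_mat_in_cell: "perm_mat n v \<in> bruhat_cell n v"
proof -
  have "perm_mat n v = 1\<^sub>m n * perm_mat n v * 1\<^sub>m n" using perm_mat_carrier[of n v] by simp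
  then show ?thesis unfolding bruhat_cell_def using borel_one by blast
qed

lemma flag_in_schubert_cell_iff:
  assumes w: "w permutes {1..n}" and g: "g \<in> GL n"
  shows "flag_of n g \<in> schubert_cell n w \<longleftrightarrow> g \<in> bruhat_cell n w"
proof
  assume "flag_of n g \<in> schubert_cell n w"
  then obtain b where b: "b \<in> borel_subgroup n" "flag_of n (b * perm_mat n w) = flag_of n g"
    unfolding schubert_cell_def by auto
  have "b * perm_mat n w \<in> GL n" by (rule GL_mult[OF borel_GL[OF b(1)] perm_mat_GL[OF w]])
  then show "g \<in> bruhat_cell n w" using flag_of_eqD[OF _ g b(2)] b(1) by (auto simp: bruhat_cell_def)
next
  assume "g \<in> bruhat_cell n w"
  then obtain b b' where b: "b \<in> borel_subgroup n" "b' \<in> borel_subgroup n" "g = b * perm_mat n w * b'"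
    by (auto simp: bruhat_cell_def)
  have "flag_of n g = flag_of n (b * perm_mat n w)"
    unfolding b(3) by (rule flag_of_mult_borel[OF _ b(2)]) (use borel_carrier[OF b(1)] in simp)
  then show "flag_of n g \<in> schubert_cell n w" unfolding schubert_cell_def using b(1) by blast
qed

text \<open>Moving the elementary matrix to the left of the permutation matrix turns it into one
  with indices \<open>w0 v i < w0 v j\<close>, which is upper triangular.\<close>

lemma addrow_inversion_cell:
  assumes v: "v permutes {1..n}" and ij: "i < n" "j < n" "v (Suc i) < v (Suc j)"
  shows "perm_mat n v * addrow_mat n c i j \<in> bruhat_cell n v"
proof -
  have "w0 v i < w0 v j" using w0(1)[OF v, of i] w0(1)[OF v, of j] ij by simp
  then show ?thesis
    unfolding perm_mat_addrow[OF v ij(1,2)] by (intro bruhat_cell_mult perm_mat_in_cell addrow_borel)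
qed

text \<open>The 2 by 2 computation behind the Bruhat decomposition of SL_2: a lower elementary
  matrix with entry c \<noteq> 0 is an upper triangular matrix times the swap times an upper
  triangular matrix.\<close>

lemma addrow_ascent_cell:
  assumes v: "v permutes {1..n}" and ij: "j < i" "i < n" "v (Suc j) < v (Suc i)" and c: "c \<noteq> 0"
  shows "perm_mat n v * addrow_mat n c i j \<in> bruhat_cell n (v \<circ> T (Suc j) (Suc i))"
proof -
  let ?t = "T (Suc j) (Suc i)" and ?u = "v \<circ> T (Suc j) (Suc i)"
  let ?P = "perm_mat n v * addrow_mat n c i j"
  \<comment> \<open>On the rows and columns j, i in this order, adding -1/c times the second row of
    ((1, 0), (c, 1)) to the first and swapping the rows gives ((c, 1), (0, -1/c)).\<close>
  define D where "D = mat n n (\<lambda>(r, s). if r = j \<and> s = j then c else if r = i \<and> s = i then - 1 / c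
      else if r = s \<or> (r = j \<and> s = i) then 1 else 0)"
  let ?a = "addrow_mat n (- 1 / c) (w0 v j) (w0 v i)" and ?a' = "addrow_mat n (1 / c) (w0 v j) (w0 v i)"
  have lt: "w0 v j < w0 v i" using w0(1)[OF v, of i] w0(1)[OF v, of j] ij by simp
  have u: "?u permutes {1..n}" by (rule permutes_comp_T[OF v]) (use ij in auto)
  have u0: "w0 ?u j = w0 v i" "w0 ?u i = w0 v j" "k \<noteq> i \<Longrightarrow> k \<noteq> j \<Longrightarrow> w0 ?u k = w0 v k" for k
    using ij by (auto simp: w0_def)
  have D: "D \<in> borel_subgroup n"
  proof (rule borel_I)
    show "upper_triangular D" by (rule upper_triangularI) (use ij in \<open>auto simp: D_def\<close>)
  qed (use c in \<open>auto simp: D_def\<close>)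
  have carr: "?P \<in> carrier_mat n n" by (rule mult_carrier_mat[of _ n n]) auto
  have eq: "?a * ?P = perm_mat n ?u * D"
  proof (rule eq_mat_w0I[OF v])
    fix k s assume ks: "k < n" "s < n"
    have P: "?P $$ (w0 v k, s) = (if k = s then 1 else 0) + (if k = i \<and> s = j then c else 0)" if "k < n" for k
      using perm_mat_mult_entry[OF v, of "addrow_mat n c i j" k s] addrow_mat_entry that ks by auto
    have L: "(?a * ?P) $$ (w0 v k, s) =
        (if k = j then - 1 / c * ?P $$ (w0 v i, s) + ?P $$ (w0 v k, s) else ?P $$ (w0 v k, s))"
      using addrow_mult_entry[OF carr, of "w0 v j" "w0 v i" "w0 v k" s "- 1 / c"] ks ij
        w0(2)[OF v] w0_inj[OF v, of k j] by auto
    define k' where "k' = (if k = i then j else if k = j then i else k)"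
    have k': "k' < n" "w0 v k = w0 ?u k'" using u0 ks ij by (auto simp: k'_def)
    have R: "(perm_mat n ?u * D) $$ (w0 v k, s) = D $$ (k', s)"
      unfolding k'(2) by (rule perm_mat_mult_entry[OF u borel_carrier[OF D] k'(1) ks(2)])
    show "(?a * ?P) $$ (w0 v k, s) = (perm_mat n ?u * D) $$ (w0 v k, s)"
      unfolding L R using P[of k] P[of i] ks ij c k'(1) by (auto simp: D_def k'_def)
  next
    show "?a * ?P \<in> carrier_mat n n" using carr by (intro mult_carrier_mat[of _ n n]) auto
    show "perm_mat n ?u * D \<in> carrier_mat n n"
      using borel_carrier[OF D] by (intro mult_carrier_mat[of _ n n]) auto
  qed
  have "?a' * ?a = 1\<^sub>m n"
    by (rule eq_matI) (use lt addrow_mult_entry[of ?a n "w0 v j" "w0 v i" _ _ "1 / c"] w0(2)[OF v] ij c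
        in \<open>auto simp: addrow_mat_entry\<close>)
  then have "?P = (?a' * ?a) * ?P" using carr by simp
  also have "\<dots> = ?a' * (?a * ?P)" by (rule assoc3[of _ n]) (use carr in auto)
  also have "\<dots> = ?a' * (perm_mat n ?u * D)" unfolding eq ..
  also have "\<dots> \<in> bruhat_cell n ?u"
    by (intro bruhat_cell_mult perm_mat_in_cell D addrow_borel lt)
  finally show ?thesis .
qed

section \<open>Bruhat decomposition by elimination\<close>

definition partial_perm_form :: "nat \<Rightarrow> nat \<Rightarrow> complex mat \<Rightarrow> (nat \<Rightarrow> nat) \<Rightarrow> bool" where
  "partial_perm_form n k g f \<longleftrightarrow> inj_on f {..<k} \<and> f ` {..<k} \<subseteq> {..<n} \<and>
     (\<forall>j<k. \<forall>i<n. g $$ (i, j) = (if i = f j then 1 else 0) \<and> g $$ (f j, i) = (if i = j then 1 else 0))"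

text \<open>Left multiplication by the Borel subgroup adds lower rows to higher ones, and right
  multiplication adds columns to later ones. Column k is therefore cleared upwards from its lowest
  nonzero entry, and then the pivot row is cleared to the right. Earlier pivots are untouched: the
  new row vanishes in the earlier columns, and the earlier pivot rows vanish in column k.\<close>

lemma partial_perm_form_step:
  assumes g: "g \<in> GL n" and k: "k < n" and form: "partial_perm_form n k g f"
  shows "\<exists>b \<in> borel_subgroup n. \<exists>b' \<in> borel_subgroup n. \<exists>f'. partial_perm_form n (Suc k) (b * g * b') f'"
proof -
  have gc: "g \<in> carrier_mat n n" by (rule GL_carrier[OF g])
  have f: "inj_on f {..<k}" "\<And>j. j < k \<Longrightarrow> f j < n"
    and colf: "\<And>i j. j < k \<Longrightarrow> i < n \<Longrightarrow> g $$ (i, j) = (if i = f j then 1 else 0)"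
    and rowf: "\<And>i j. j < k \<Longrightarrow> i < n \<Longrightarrow> g $$ (f j, i) = (if i = j then 1 else 0)"
    using form by (auto simp: partial_perm_form_def)
  obtain h where h: "h \<in> GL n" "h * g = 1\<^sub>m n" using GL_inverse[OF g] by blast
  have "(\<Sum>l<n. h $$ (k, l) * g $$ (l, k)) = 1"
    using mult_mat_entry[OF GL_carrier[OF h(1)] gc k k] h(2) k by simp
  then have ex: "\<exists>l<n. g $$ (l, k) \<noteq> 0" by (metis (no_types, lifting) lessThan_iff mult_zero_right sum.neutral zero_neq_one)
  let ?N = "{i. i < n \<and> g $$ (i, k) \<noteq> 0}"
  define i1 where "i1 = Max ?N"
  have "i1 \<in> ?N" unfolding i1_def by (rule Max_in) (use ex in auto)
  then have i1: "i1 < n" "g $$ (i1, k) \<noteq> 0" by auto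
  have above: "g $$ (i, k) = 0" if "i1 < i" "i < n" for i
    using Max_ge[of ?N i] that unfolding i1_def by fastforce
  have i1f: "f j \<noteq> i1" if "j < k" for j using rowf[OF that k] i1 that by auto
  define d where "d = g $$ (i1, k)"
  define \<beta> where "\<beta> i = (if i = i1 then 1 / d else if i < i1 then - g $$ (i, k) / d else 0)" for i
  \<comment> \<open>Upper triangular because the pivot row is the lowest row with a nonzero entry in
    column k: column \<open>i1\<close> of b needs entries only on and above the diagonal.\<close>
  define b where "b = mat n n (\<lambda>(i, j). (if i = j \<and> j \<noteq> i1 then 1 else 0) + (if j = i1 then \<beta> i else 0))"
  have d: "d \<noteq> 0" using i1 d_def by simp
  have b: "b \<in> borel_subgroup n"
  proof (rule borel_I)
    show "upper_triangular b" by (rule upper_triangularI) (auto simp: b_def \<beta>_def)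
  qed (use d in \<open>auto simp: b_def \<beta>_def\<close>)
  define g2 where "g2 = b * g"
  have g2c: "g2 \<in> carrier_mat n n" unfolding g2_def by (rule mult_carrier_mat[OF borel_carrier[OF b] gc])
  have g2: "g2 $$ (i, s) = (if i \<noteq> i1 then g $$ (i, s) else 0) + \<beta> i * g $$ (i1, s)" if "i < n" "s < n" for i s
  proof -
    have "g2 $$ (i, s) = (\<Sum>l<n. (if l = i then (if i \<noteq> i1 then g $$ (i, s) else 0) else 0) +
        (if l = i1 then \<beta> i * g $$ (i1, s) else 0))"
      unfolding g2_def mult_mat_entry[OF borel_carrier[OF b] gc that]
      by (rule sum.cong) (use that in \<open>auto simp: b_def\<close>)
    then show ?thesis using that i1 by (simp add: sum.distrib)
  qed
  have col2: "g2 $$ (i, k) = (if i = i1 then 1 else 0)" if "i < n" for i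
    unfolding g2[OF that k] using above[of i] that d d_def by (auto simp: \<beta>_def)
  have colf2: "g2 $$ (i, j) = (if i = f j then 1 else 0)" if "j < k" "i < n" for i j
    using g2[OF that(2), of j] colf[OF that] colf[OF that(1) i1(1)] i1f[OF that(1)] that k by auto
  have rowf2: "g2 $$ (f j, i) = (if i = j then 1 else 0)" if "j < k" "i < n" for i j
  proof -
    have "\<beta> (f j) = 0" using i1f[OF that(1)] rowf[OF that(1) k] that by (simp add: \<beta>_def)
    then show ?thesis using g2[OF f(2)[OF that(1)] that(2)] rowf[OF that] i1f[OF that(1)] by simp
  qed
  define b' where "b' = mat n n (\<lambda>(i, j). (if i = j then 1 else 0) + (if i = k \<and> k < j then - g2 $$ (i1, j) else 0))"
  have b': "b' \<in> borel_subgroup n"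
  proof (rule borel_I)
    show "upper_triangular b'" by (rule upper_triangularI) (auto simp: b'_def)
  qed (auto simp: b'_def)
  define g3 where "g3 = g2 * b'"
  have g3: "g3 $$ (i, s) = g2 $$ (i, s) - (if i = i1 \<and> k < s then g2 $$ (i1, s) else 0)" if "i < n" "s < n" for i s
  proof -
    have "g3 $$ (i, s) = (\<Sum>l<n. (if l = s then g2 $$ (i, s) else 0) +
        (if l = k then (if k < s then - g2 $$ (i, k) * g2 $$ (i1, s) else 0) else 0))"
      unfolding g3_def mult_mat_entry[OF g2c borel_carrier[OF b'] that]
      by (rule sum.cong) (use that in \<open>auto simp: b'_def algebra_simps\<close>)
    then show ?thesis using that k col2[OF that(1)] by (simp add: sum.distrib)
  qed
  let ?f = "f(k := i1)"
  have "partial_perm_form n (Suc k) g3 ?f"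
    unfolding partial_perm_form_def
  proof (intro conjI allI impI)
    show "inj_on ?f {..<Suc k}"
    proof -
      have "i1 \<notin> f ` {..<k}" using i1f by auto
      then show ?thesis
        unfolding lessThan_Suc inj_on_insert using inj_on_fun_updI[OF f(1), of i1 k] by auto
    qed
    show "?f ` {..<Suc k} \<subseteq> {..<n}" using f(2) i1 by (auto simp: less_Suc_eq)
  next
    fix j i assume j: "j < Suc k" and i: "i < n"
    show "g3 $$ (i, j) = (if i = ?f j then 1 else 0)"
      using g3[OF i, of j] col2[OF i] colf2[of j i] j k i by (cases "j = k") auto
    show "g3 $$ (?f j, i) = (if i = j then 1 else 0)"
    proof (cases "j = k")
      case True
      have "g2 $$ (i1, i) = 0" if "i < k" using colf2[OF that i1(1)] i1f[OF that] by simp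
      then show ?thesis using True g3[OF i1(1) i] col2[OF i1(1)] by (cases "i < k"; cases "i = k") auto
    next
      case False
      then have "j < k" using j by simp
      then show ?thesis using g3[OF f(2) i, of j] rowf2[of j i] i1f[of j] i by simp
    qed
  qed
  then show ?thesis using b b' unfolding g3_def g2_def by blast
qed

lemma bruhat_decomposition:
  assumes g: "g \<in> GL n"
  shows "\<exists>v. v permutes {1..n} \<and> g \<in> bruhat_cell n v"
proof -
  have gc: "g \<in> carrier_mat n n" by (rule GL_carrier[OF g])
  have "\<exists>b \<in> borel_subgroup n. \<exists>b' \<in> borel_subgroup n. \<exists>f. partial_perm_form n k (b * g * b') f" if "k \<le> n" for k
    using that
  proof (induction k)
    case 0
    show ?case by (intro bexI[of _ "1\<^sub>m n"]) (auto simp: partial_perm_form_def)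
  next
    case (Suc k)
    then obtain b b' f where b: "b \<in> borel_subgroup n" "b' \<in> borel_subgroup n" "partial_perm_form n k (b * g * b') f"
      by auto
    have "b * g * b' \<in> GL n" by (intro GL_mult borel_GL[OF b(1)] borel_GL[OF b(2)] g)
    from partial_perm_form_step[OF this _ b(3)] Suc.prems obtain c c' f' where
      c: "c \<in> borel_subgroup n" "c' \<in> borel_subgroup n" "partial_perm_form n (Suc k) (c * (b * g * b') * c') f'" by auto
    have "c * (b * g * b') * c' = (c * b) * g * (b' * c')"
      using borel_carrier[OF b(1)] borel_carrier[OF b(2)] borel_carrier[OF c(1)] borel_carrier[OF c(2)] gc
      by (simp add: assoc_mult_mat[of _ n n _ n _ n] mult_carrier_mat[of _ n n _ n])
    then show ?case using c(3) borel_mult[OF c(1) b(1)] borel_mult[OF b(2) c(2)] by metis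
  qed
  from this[OF order_refl] obtain b b' f where b: "b \<in> borel_subgroup n" "b' \<in> borel_subgroup n"
    and form: "partial_perm_form n n (b * g * b') f" by blast
  define v where "v x = (if 1 \<le> x \<and> x \<le> n then Suc (f (x - 1)) else x)" for x
  have f: "inj_on f {..<n}" "f ` {..<n} \<subseteq> {..<n}" using form by (auto simp: partial_perm_form_def)
  have v: "v permutes {1..n}"
  proof (rule bij_imp_permutes)
    have "inj_on v {1..n}"
    proof (rule inj_onI)
      fix x y assume "x \<in> {1..n}" "y \<in> {1..n}" "v x = v y"
      then have "f (x - 1) = f (y - 1)" "x - 1 < n" "y - 1 < n" "1 \<le> x" "1 \<le> y" by (auto simp: v_def)
      then show "x = y" using inj_onD[OF f(1), of "x - 1" "y - 1"] by auto
    qed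
    moreover have "v x \<in> {1..n}" if "x \<in> {1..n}" for x
    proof -
      have "x - 1 < n" using that by auto
      then have "f (x - 1) < n" using f(2) by auto
      then show ?thesis using that by (simp add: v_def)
    qed
    then have "v ` {1..n} \<subseteq> {1..n}" by blast
    ultimately show "bij_betw v {1..n} {1..n}"
      unfolding bij_betw_def using endo_inj_surj[of "{1..n}" v] by blast
  qed (auto simp: v_def)
  have v0: "w0 v j = f j" if "j < n" for j using that by (simp add: w0_def v_def)
  note c = borel_carrier[OF b(1)] borel_carrier[OF b(2)]
  have eq: "b * g * b' = perm_mat n v"
  proof (rule eq_matI)
    fix i j assume "i < dim_row (perm_mat n v)" "j < dim_col (perm_mat n v)"
    then have ij: "i < n" "j < n" by auto
    show "(b * g * b') $$ (i, j) = perm_mat n v $$ (i, j)"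
      unfolding perm_mat_entry[OF v ij] v0[OF ij(2)] using form ij unfolding partial_perm_form_def by blast
  qed (use c gc in auto)
  obtain h where h: "h \<in> borel_subgroup n" "h * b = 1\<^sub>m n" using borel_inverse[OF b(1)] by blast
  obtain h' where h': "h' \<in> borel_subgroup n" "b' * h' = 1\<^sub>m n" using borel_inverse[OF b(2)] by blast
  note c' = c borel_carrier[OF h(1)] borel_carrier[OF h'(1)]
  have "h * (b * g * b') * h' = (h * b) * g * (b' * h')"
    using c' gc by (simp add: assoc_mult_mat[of _ n n _ n _ n] mult_carrier_mat[of _ n n _ n])
  also have "\<dots> = g" using h h' gc by simp
  finally have "g = h * perm_mat n v * h'" using eq by simp
  then show ?thesis using v h h' unfolding bruhat_cell_def by blast
qed

section \<open>Polynomial functions on the charts\<close>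

lemma polynomial_sum: "finite A \<Longrightarrow> (\<And>x. x \<in> A \<Longrightarrow> polynomial_coord_fun (f x)) \<Longrightarrow> polynomial_coord_fun (\<lambda>a. \<Sum>x\<in>A. f x a)"
  by (induction A rule: finite_induct) (auto intro: polynomial_coord_fun.intros)

lemma polynomial_prod: "finite A \<Longrightarrow> (\<And>x. x \<in> A \<Longrightarrow> polynomial_coord_fun (f x)) \<Longrightarrow> polynomial_coord_fun (\<lambda>a. \<Prod>x\<in>A. f x a)"
  by (induction A rule: finite_induct) (auto intro: polynomial_coord_fun.intros)

lemma polynomial_det:
  assumes "\<And>i j. i < m \<Longrightarrow> j < m \<Longrightarrow> polynomial_coord_fun (\<lambda>a. M a i j)"
  shows "polynomial_coord_fun (\<lambda>a. det (mat m m (\<lambda>(i, j). M a i j)))"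
proof -
  have "det (mat m m (\<lambda>(i, j). M a i j)) = (\<Sum>p \<in> {p. p permutes {0..<m}}. signof p * (\<Prod>i = 0..<m. M a i (p i)))" for a
  proof -
    let ?M = "mat m m (\<lambda>(i, j). M a i j)"
    have "det ?M = (\<Sum>p \<in> {p. p permutes {0..<m}}. signof p * (\<Prod>i = 0..<m. ?M $$ (i, p i)))"
      by (rule det_def') simp
    also have "\<dots> = (\<Sum>p \<in> {p. p permutes {0..<m}}. signof p * (\<Prod>i = 0..<m. M a i (p i)))"
    proof (intro sum.cong refl arg_cong2[of _ _ _ _ "(*)"] prod.cong)
      fix p i assume "p \<in> {p. p permutes {0..<m}}" "i \<in> {0..<m}"
      then show "?M $$ (i, p i) = M a i (p i)" using permutes_in_image[of p "{0..<m}" i] by simp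
    qed
    finally show ?thesis .
  qed
  moreover have "polynomial_coord_fun (\<lambda>a. \<Sum>p \<in> {p. p permutes {0..<m}}. signof p * (\<Prod>i = 0..<m. M a i (p i)))"
  proof (intro polynomial_sum polynomial_coord_fun.mult polynomial_coord_fun.const polynomial_prod)
    show "polynomial_coord_fun (\<lambda>a. M a i (p i))" if "p \<in> {p. p permutes {0..<m}}" "i \<in> {0..<m}" for p i
    proof (rule assms)
      show "i < m" "p i < m" using that permutes_in_image[of p "{0..<m}" i] by auto
    qed
  qed (auto intro: finite_permutations)
  ultimately show ?thesis by simp
qed

text \<open>D is the differential of f, with value \<open>D a v\<close> at the point a in direction
  v. Its continuity in both arguments, for convergence in each coordinate, is what the
  semicontinuity argument needs; its linearity makes tangent spaces subspaces.\<close>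

lemma polynomial_directional_derivative:
  assumes "polynomial_coord_fun f"
  shows "\<exists>D. (\<forall>a v. ((\<lambda>s. f (\<lambda>p. a p + s * v p)) has_field_derivative D a v) (at 0)) \<and>
     (\<forall>A V a v. (\<forall>p. (\<lambda>k::nat. A k p) \<longlonglongrightarrow> a p) \<and> (\<forall>p. (\<lambda>k. V k p) \<longlonglongrightarrow> v p) \<longrightarrow>
        (\<lambda>k. f (A k)) \<longlonglongrightarrow> f a \<and> (\<lambda>k. D (A k) (V k)) \<longlonglongrightarrow> D a v) \<and>
     (\<forall>a v u c d. D a (\<lambda>p. c * v p + d * u p) = c * D a v + d * D a u)"
  using assms
proof induction
  case (const c)
  show ?case by (rule exI[of _ "\<lambda>a v. 0"]) auto
next
  case (coord p)
  show ?case by (rule exI[of _ "\<lambda>a v. v p"]) (auto intro!: derivative_eq_intros simp del: split_paired_All)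
next
  case (add f g)
  then obtain D E where D: "\<forall>a v. ((\<lambda>s. f (\<lambda>p. a p + s * v p)) has_field_derivative D a v) (at 0)"
      "\<forall>A V a v. (\<forall>p. (\<lambda>k::nat. A k p) \<longlonglongrightarrow> a p) \<and> (\<forall>p. (\<lambda>k. V k p) \<longlonglongrightarrow> v p) \<longrightarrow>
        (\<lambda>k. f (A k)) \<longlonglongrightarrow> f a \<and> (\<lambda>k. D (A k) (V k)) \<longlonglongrightarrow> D a v"
    and E: "\<forall>a v. ((\<lambda>s. g (\<lambda>p. a p + s * v p)) has_field_derivative E a v) (at 0)"
      "\<forall>A V a v. (\<forall>p. (\<lambda>k::nat. A k p) \<longlonglongrightarrow> a p) \<and> (\<forall>p. (\<lambda>k. V k p) \<longlonglongrightarrow> v p) \<longrightarrow>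
        (\<lambda>k. g (A k)) \<longlonglongrightarrow> g a \<and> (\<lambda>k. E (A k) (V k)) \<longlonglongrightarrow> E a v"
    and lin: "\<forall>a v u c d. D a (\<lambda>p. c * v p + d * u p) = c * D a v + d * D a u"
      "\<forall>a v u c d. E a (\<lambda>p. c * v p + d * u p) = c * E a v + d * E a u"
    by (elim exE conjE) (rule that)
  show ?case
    by (rule exI[of _ "\<lambda>a v. D a v + E a v"]) (use D E lin in \<open>auto intro!: DERIV_add tendsto_add simp: algebra_simps\<close>)
next
  case (mult f g)
  then obtain D E where D: "\<forall>a v. ((\<lambda>s. f (\<lambda>p. a p + s * v p)) has_field_derivative D a v) (at 0)"
      "\<forall>A V a v. (\<forall>p. (\<lambda>k::nat. A k p) \<longlonglongrightarrow> a p) \<and> (\<forall>p. (\<lambda>k. V k p) \<longlonglongrightarrow> v p) \<longrightarrow>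
        (\<lambda>k. f (A k)) \<longlonglongrightarrow> f a \<and> (\<lambda>k. D (A k) (V k)) \<longlonglongrightarrow> D a v"
    and E: "\<forall>a v. ((\<lambda>s. g (\<lambda>p. a p + s * v p)) has_field_derivative E a v) (at 0)"
      "\<forall>A V a v. (\<forall>p. (\<lambda>k::nat. A k p) \<longlonglongrightarrow> a p) \<and> (\<forall>p. (\<lambda>k. V k p) \<longlonglongrightarrow> v p) \<longrightarrow>
        (\<lambda>k. g (A k)) \<longlonglongrightarrow> g a \<and> (\<lambda>k. E (A k) (V k)) \<longlonglongrightarrow> E a v"
    and lin: "\<forall>a v u c d. D a (\<lambda>p. c * v p + d * u p) = c * D a v + d * D a u"
      "\<forall>a v u c d. E a (\<lambda>p. c * v p + d * u p) = c * E a v + d * E a u"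
    by (elim exE conjE) (rule that)
  have prod: "((\<lambda>s. f (\<lambda>p. a p + s * v p) * g (\<lambda>p. a p + s * v p)) has_field_derivative D a v * g a + E a v * f a) (at 0)" for a v
    using DERIV_mult[OF D(1)[rule_format, of a v] E(1)[rule_format, of a v]] by simp
  then show ?case
    by (intro exI[of _ "\<lambda>a v. D a v * g a + E a v * f a"]) (use prod D(2) E(2) lin in \<open>auto intro!: tendsto_add tendsto_mult simp: algebra_simps\<close>)
qed

text \<open>The chain rule at 0: the derivative of f along a curve depends only on the position and
  velocity of the curve.\<close>

lemma polynomial_curves:
  assumes "polynomial_coord_fun f" "\<And>p. \<gamma> 0 p = \<delta> 0 p"
    and "\<And>p. ((\<lambda>s. \<gamma> s p) has_field_derivative d p) (at 0)" "\<And>p. ((\<lambda>s. \<delta> s p) has_field_derivative d p) (at 0)"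
  shows "\<exists>D. ((\<lambda>s. f (\<gamma> s)) has_field_derivative D) (at 0) \<and> ((\<lambda>s. f (\<delta> s)) has_field_derivative D) (at 0)"
  using assms(1)
proof induction
  case (const c)
  show ?case by (rule exI[of _ 0]) auto
next
  case (coord p)
  show ?case using assms by blast
next
  case (add f g)
  then obtain D E where D: "((\<lambda>s. f (\<gamma> s)) has_field_derivative D) (at 0)" "((\<lambda>s. f (\<delta> s)) has_field_derivative D) (at 0)"
    "((\<lambda>s. g (\<gamma> s)) has_field_derivative E) (at 0)" "((\<lambda>s. g (\<delta> s)) has_field_derivative E) (at 0)" by blast
  then show ?case using DERIV_add[OF D(1,3)] DERIV_add[OF D(2,4)] by blast
next
  case (mult f g)
  then obtain D E where D: "((\<lambda>s. f (\<gamma> s)) has_field_derivative D) (at 0)" "((\<lambda>s. f (\<delta> s)) has_field_derivative D) (at 0)"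
    "((\<lambda>s. g (\<gamma> s)) has_field_derivative E) (at 0)" "((\<lambda>s. g (\<delta> s)) has_field_derivative E) (at 0)" by blast
  have "\<gamma> 0 = \<delta> 0" using assms(2) by (rule ext)
  then show ?case using DERIV_mult[OF D(1,3)] DERIV_mult[OF D(2,4)] by auto
qed

section \<open>Schubert varieties\<close>

lemma flag_of_mult_cong:
  assumes "b \<in> carrier_mat n n" "g \<in> carrier_mat n n" "h \<in> carrier_mat n n" "flag_of n g = flag_of n h"
  shows "flag_of n (b * g) = flag_of n (b * h)"
  using flag_of_mult[OF assms(1,2)] flag_of_mult[OF assms(1,3)] assms(4) by (intro ext) simp

lemma chart_GL: "g \<in> GL n \<Longrightarrow> g * lower_unipotent n a \<in> GL n"
  by (intro GL_mult lower_unipotent_GL)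

text \<open>Left multiplication by b carries the chart centred at g to the chart centred at
  \<open>b * g\<close> with the same coordinates, so the preimage of a closed set is cut out by the
  same polynomials.\<close>

lemma zariski_closed_translate:
  assumes Z: "zariski_closed n Z" and b: "b \<in> GL n"
  defines "Z' \<equiv> {flag_of n g | g. g \<in> GL n \<and> flag_of n (b * g) \<in> Z}"
  shows "zariski_closed n Z'" "g \<in> GL n \<Longrightarrow> flag_of n g \<in> Z' \<longleftrightarrow> flag_of n (b * g) \<in> Z"
proof -
  have iff: "flag_of n g \<in> Z' \<longleftrightarrow> flag_of n (b * g) \<in> Z" if g: "g \<in> GL n" for g
  proof
    assume "flag_of n g \<in> Z'"
    then obtain h where h: "h \<in> GL n" "flag_of n g = flag_of n h" "flag_of n (b * h) \<in> Z" by (auto simp: Z'_def)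
    then show "flag_of n (b * g) \<in> Z"
      using flag_of_mult_cong[OF GL_carrier[OF b] GL_carrier[OF g] GL_carrier[OF h(1)] h(2)] by simp
  qed (use g Z'_def in blast)
  show "flag_of n g \<in> Z' \<longleftrightarrow> flag_of n (b * g) \<in> Z" if "g \<in> GL n" using iff[OF that] .
  show "zariski_closed n Z'"
    unfolding zariski_closed_def
  proof (intro conjI ballI)
    show "Z' \<subseteq> flag_variety n" by (auto simp: Z'_def flag_variety_def)
    fix g assume g: "g \<in> GL n"
    have "chart n g a \<in> Z' \<longleftrightarrow> chart n (b * g) a \<in> Z" for a
      using iff[OF chart_GL[OF g]] GL_carrier[OF b] GL_carrier[OF g]
      by (simp add: chart_def assoc_mult_mat[of _ n n _ n _ n])
    then have "chart_part n g Z' = chart_part n (b * g) Z" by (simp add: chart_part_def)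
    then show "algebraic_set n (chart_part n g Z')" using Z GL_mult[OF b g] by (simp add: zariski_closed_def)
  qed
qed

lemma in_schubert_variety_iff:
  "F \<in> schubert_variety n w \<longleftrightarrow> (\<forall>Z. zariski_closed n Z \<and> schubert_cell n w \<subseteq> Z \<longrightarrow> F \<in> Z)"
  by (auto simp: schubert_variety_def zariski_closure_def)

text \<open>If Z is closed and contains the cell, so is and does its preimage under b, since the
  cell is stable under the Borel subgroup.\<close>

lemma schubert_variety_borel:
  assumes w: "w permutes {1..n}" and b: "b \<in> borel_subgroup n" and g: "g \<in> GL n"
    and mem: "flag_of n g \<in> schubert_variety n w"
  shows "flag_of n (b * g) \<in> schubert_variety n w"
  unfolding in_schubert_variety_iff
proof (intro allI impI)
  fix Z assume Z: "zariski_closed n Z \<and> schubert_cell n w \<subseteq> Z"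
  let ?Z' = "{flag_of n g | g. g \<in> GL n \<and> flag_of n (b * g) \<in> Z}"
  note tr = zariski_closed_translate[OF conjunct1[OF Z] borel_GL[OF b]]
  have "schubert_cell n w \<subseteq> ?Z'"
  proof
    fix F assume F: "F \<in> schubert_cell n w"
    then obtain c where c: "c \<in> borel_subgroup n" "F = flag_of n (c * perm_mat n w)" by (auto simp: schubert_cell_def)
    have g': "c * perm_mat n w \<in> GL n" by (intro GL_mult borel_GL[OF c(1)] perm_mat_GL[OF w])
    have "c * perm_mat n w \<in> bruhat_cell n w" using F flag_in_schubert_cell_iff[OF w g'] c(2) by simp
    then have "b * (c * perm_mat n w) \<in> bruhat_cell n w" by (rule bruhat_cell_mult(1)[OF _ b])
    then have "flag_of n (b * (c * perm_mat n w)) \<in> schubert_cell n w"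
      using flag_in_schubert_cell_iff[OF w GL_mult[OF borel_GL[OF b] g']] by simp
    then show "F \<in> ?Z'" unfolding c(2) using tr(2)[OF g'] Z by blast
  qed
  then have "flag_of n g \<in> ?Z'" using mem tr(1) unfolding in_schubert_variety_iff by blast
  then show "flag_of n (b * g) \<in> Z" using tr(2)[OF g] by simp
qed

lemma schubert_variety_borel_iff:
  assumes w: "w permutes {1..n}" and b: "b \<in> borel_subgroup n" and g: "g \<in> GL n"
  shows "flag_of n (b * g) \<in> schubert_variety n w \<longleftrightarrow> flag_of n g \<in> schubert_variety n w"
proof
  assume A: "flag_of n (b * g) \<in> schubert_variety n w"
  obtain h where h: "h \<in> borel_subgroup n" "h * b = 1\<^sub>m n" using borel_inverse[OF b] by blast
  have "h * (b * g) = (h * b) * g" by (rule assoc3[symmetric, OF borel_carrier[OF h(1)] borel_carrier[OF b] GL_carrier[OF g]])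
  then have "h * (b * g) = g" using h(2) GL_carrier[OF g] by simp
  then show "flag_of n g \<in> schubert_variety n w"
    using schubert_variety_borel[OF w h(1) GL_mult[OF borel_GL[OF b] g] A] by simp
qed (rule schubert_variety_borel[OF assms])

section \<open>Which cells lie in a Schubert variety\<close>

definition line_coord :: "nat \<Rightarrow> nat \<Rightarrow> complex \<Rightarrow> coords" where
  "line_coord i j c = (\<lambda>p. if p = (i, j) then c else 0)"

lemma line_coord_affine: "j < i \<Longrightarrow> i < n \<Longrightarrow> line_coord i j c \<in> affine_space n"
  by (auto simp: line_coord_def affine_space_def)

lemma lower_unipotent_line: "j < i \<Longrightarrow> i < n \<Longrightarrow> lower_unipotent n (line_coord i j c) = addrow_mat n c i j"
  by (rule eq_matI) (auto simp: lower_unipotent_def line_coord_def addrow_mat_entry)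

lemma lower_unipotent_zero: "lower_unipotent n 0 = 1\<^sub>m n"
  by (rule eq_matI) (auto simp: lower_unipotent_def)

lemma affine_zero: "0 \<in> affine_space n"
  by (simp add: affine_space_def)

lemma chart_zero: "g \<in> carrier_mat n n \<Longrightarrow> chart n g 0 = flag_of n g"
  by (simp add: chart_def lower_unipotent_zero)

lemma zero_in_chart_part: "g \<in> GL n \<Longrightarrow> 0 \<in> chart_part n g Z \<longleftrightarrow> flag_of n g \<in> Z"
  using affine_zero chart_zero[OF GL_carrier] by (simp add: chart_part_def)

text \<open>The coordinate line in direction \<open>(i, j)\<close> of the chart at a point of the
  smaller cell lies in the larger cell except at 0. Polynomials vanishing at its points 1/(k + 1)
  vanish at 0 by continuity.\<close>

lemma cell_closure_step:
  assumes v: "v permutes {1..n}" and ij: "j < i" "i < n" "v (Suc j) < v (Suc i)"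
    and Z: "zariski_closed n Z" "schubert_cell n (v \<circ> T (Suc j) (Suc i)) \<subseteq> Z"
  shows "schubert_cell n v \<subseteq> Z"
proof
  let ?u = "v \<circ> T (Suc j) (Suc i)"
  have u: "?u permutes {1..n}" by (rule permutes_comp_T[OF v]) (use ij in auto)
  fix F assume "F \<in> schubert_cell n v"
  then obtain b where b: "b \<in> borel_subgroup n" "F = flag_of n (b * perm_mat n v)" by (auto simp: schubert_cell_def)
  let ?g = "b * perm_mat n v"
  have g: "?g \<in> GL n" by (intro GL_mult borel_GL[OF b(1)] perm_mat_GL[OF v])
  obtain P where P: "\<forall>f\<in>P. polynomial_coord_fun f" "chart_part n ?g Z = {a \<in> affine_space n. \<forall>f\<in>P. f a = 0}"
    using Z(1) g unfolding zariski_closed_def algebraic_set_def by blast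
  have line: "line_coord i j c \<in> chart_part n ?g Z" if c: "c \<noteq> 0" for c
  proof -
    have eq: "?g * addrow_mat n c i j = b * (perm_mat n v * addrow_mat n c i j)"
      by (rule assoc3[OF borel_carrier[OF b(1)]]) auto
    have "?g * addrow_mat n c i j \<in> bruhat_cell n ?u"
      unfolding eq by (rule bruhat_cell_mult(1)[OF addrow_ascent_cell[OF v ij c] b(1)])
    then have "flag_of n (?g * addrow_mat n c i j) \<in> schubert_cell n ?u"
      using flag_in_schubert_cell_iff[OF u bruhat_cell_GL[OF u]] by simp
    then have "chart n ?g (line_coord i j c) \<in> Z"
      using Z(2) unfolding chart_def lower_unipotent_line[OF ij(1,2)] by blast
    then show ?thesis using line_coord_affine[OF ij(1,2)] by (simp add: chart_part_def)
  qed
  have "f 0 = 0" if f: "f \<in> P" for f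
  proof -
    have pf: "polynomial_coord_fun f" using P(1) f by blast
    let ?A = "\<lambda>k. line_coord i j (of_real (inverse (real (Suc k))))"
    have "(\<lambda>k. complex_of_real (inverse (real (Suc k)))) \<longlonglongrightarrow> complex_of_real 0"
      by (rule tendsto_of_real[OF LIMSEQ_inverse_real_of_nat])
    then have "(\<lambda>k. ?A k p) \<longlonglongrightarrow> (0 :: coords) p" for p
      by (cases "p = (i, j)") (auto simp: line_coord_def)
    then have "(\<lambda>k. f (?A k)) \<longlonglongrightarrow> f 0"
      using polynomial_directional_derivative[OF pf] tendsto_const[of _ sequentially] by metis
    moreover have "f (?A k) = 0" for k
    proof -
      have "complex_of_real (inverse (real (Suc k))) \<noteq> 0" by (simp del: of_nat_Suc)
      from line[OF this] show ?thesis unfolding P(2) using f by blast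
    qed
    ultimately show ?thesis by (simp add: LIMSEQ_const_iff)
  qed
  then have "0 \<in> chart_part n ?g Z" unfolding P(2) using affine_zero by simp
  then show "F \<in> Z" using zero_in_chart_part[OF g] b(2) by simp
qed

lemma cell_subset_schubert_variety:
  assumes "bruhat_le n v w"
  shows "schubert_cell n v \<subseteq> schubert_variety n w"
proof -
  have "schubert_cell n v \<subseteq> Z" if Z: "zariski_closed n Z" "schubert_cell n w \<subseteq> Z" for Z
  proof -
    have "(bruhat_step n)\<^sup>*\<^sup>* v w" using assms by (simp add: bruhat_le_def)
    then show ?thesis
    proof (induction rule: converse_rtranclp_induct)
      case (step x y)
      then obtain a b where ab: "x permutes {1..n}" "1 \<le> a" "a < b" "b \<le> n" "y = x \<circ> T a b" "x a < x b"
        by (auto simp: bruhat_step_iff)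
      then have Suc: "Suc (a - 1) = a" "Suc (b - 1) = b" by auto
      have sub: "schubert_cell n (x \<circ> T a b) \<subseteq> Z" using step.IH unfolding ab(5) .
      show ?case
        by (rule cell_closure_step[OF ab(1), of "a - 1" "b - 1", unfolded Suc, OF _ _ ab(6) Z(1) sub])
           (use ab(2-4) in auto)
    qed (rule Z(2))
  qed
  then show ?thesis using in_schubert_variety_iff by blast
qed

lemma bruhat_cell_in_schubert_variety:
  assumes "bruhat_le n v w" "g \<in> bruhat_cell n v"
  shows "flag_of n g \<in> schubert_variety n w"
proof -
  have "v permutes {1..n}" using assms by (simp add: bruhat_le_def)
  then show ?thesis
    using flag_in_schubert_cell_iff[OF _ bruhat_cell_GL] cell_subset_schubert_variety[OF assms(1)] assms(2) by blast
qed

text \<open>The flags for which the projection of the p-dimensional step to the coordinates from q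
  on has rank less than m. Minors of arbitrary vectors of that subspace are used, so the condition
  refers to the flag alone and becomes polynomial in each chart.\<close>

definition rank_locus :: "nat \<Rightarrow> nat \<Rightarrow> nat \<Rightarrow> nat \<Rightarrow> flag set" where
  "rank_locus n p q m = {F \<in> flag_variety n. \<forall>xs \<rho>. (\<forall>t<m. xs t \<in> F p) \<and> (\<forall>s<m. q \<le> \<rho> s \<and> \<rho> s < n) \<longrightarrow>
     det (mat m m (\<lambda>(s, t). xs t $ \<rho> s)) = 0}"

lemma rank_locus_iff:
  assumes "g \<in> GL n"
  shows "flag_of n g \<in> rank_locus n p q m \<longleftrightarrow>
    (\<forall>ys \<rho>. (\<forall>t<m. ys t \<in> std_flag n p) \<and> (\<forall>s<m. q \<le> \<rho> s \<and> \<rho> s < n) \<longrightarrow>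
       det (mat m m (\<lambda>(s, t). (g *\<^sub>v ys t) $ \<rho> s)) = 0)"
proof -
  have "flag_of n g \<in> rank_locus n p q m \<longleftrightarrow>
    (\<forall>xs \<rho>. (\<forall>t<m. xs t \<in> flag_of n g p) \<and> (\<forall>s<m. q \<le> \<rho> s \<and> \<rho> s < n) \<longrightarrow>
     det (mat m m (\<lambda>(s, t). xs t $ \<rho> s)) = 0)"
    using assms by (auto simp: rank_locus_def flag_variety_def)
  also have "\<dots> \<longleftrightarrow> (\<forall>ys \<rho>. (\<forall>t<m. ys t \<in> std_flag n p) \<and> (\<forall>s<m. q \<le> \<rho> s \<and> \<rho> s < n) \<longrightarrow>
       det (mat m m (\<lambda>(s, t). (g *\<^sub>v ys t) $ \<rho> s)) = 0)" (is "?L \<longleftrightarrow> ?R")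
  proof
    assume ?L
    then show ?R by (auto simp: flag_of_def)
  next
    assume R: ?R
    show ?L
    proof (intro allI impI)
      fix xs \<rho> assume A: "(\<forall>t<m. xs t \<in> flag_of n g p) \<and> (\<forall>s<m. q \<le> \<rho> s \<and> \<rho> s < n)"
      then have "\<forall>t. \<exists>y. t < m \<longrightarrow> y \<in> std_flag n p \<and> xs t = g *\<^sub>v y" by (auto simp: flag_of_def)
      then obtain ys where ys: "\<And>t. t < m \<Longrightarrow> ys t \<in> std_flag n p \<and> xs t = g *\<^sub>v ys t" by metis
      have "mat m m (\<lambda>(s, t). xs t $ \<rho> s) = mat m m (\<lambda>(s, t). (g *\<^sub>v ys t) $ \<rho> s)"
        by (rule eq_matI) (use ys in auto)
      then show "det (mat m m (\<lambda>(s, t). xs t $ \<rho> s)) = 0" using R ys A by auto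
    qed
  qed
  finally show ?thesis .
qed

lemma polynomial_lower_unipotent_entry:
  assumes "i < n" "j < n"
  shows "polynomial_coord_fun (\<lambda>a. lower_unipotent n a $$ (i, j))"
proof -
  have "(\<lambda>a. lower_unipotent n a $$ (i, j)) = (\<lambda>a. if i = j then 1 else if j < i then a (i, j) else 0)"
    using assms by (auto simp: lower_unipotent_def fun_eq_iff)
  moreover have "polynomial_coord_fun (\<lambda>a. if i = j then 1 else if j < i then a (i, j) else 0)"
    by (cases "i = j"; cases "j < i") (auto intro: polynomial_coord_fun.intros)
  ultimately show ?thesis by simp
qed

lemma polynomial_chart_entry:
  assumes "g \<in> carrier_mat n n" "i < n" "j < n"
  shows "polynomial_coord_fun (\<lambda>a. (g * lower_unipotent n a) $$ (i, j))"
  unfolding mult_mat_entry[OF assms(1) lower_unipotent_carrier assms(2,3)]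
  by (intro polynomial_sum polynomial_coord_fun.mult polynomial_coord_fun.const polynomial_lower_unipotent_entry)
     (use assms in auto)

lemma polynomial_chart_vec_entry:
  assumes "g \<in> carrier_mat n n" "i < n" "y \<in> carrier_vec n"
  shows "polynomial_coord_fun (\<lambda>a. ((g * lower_unipotent n a) *\<^sub>v y) $ i)"
proof -
  have c: "g * lower_unipotent n a \<in> carrier_mat n n" for a using assms(1) by (intro mult_carrier_mat[of _ n n]) auto
  show ?thesis
    unfolding mult_mat_vec_entry[OF c assms(3,2)]
    by (intro polynomial_sum polynomial_coord_fun.mult polynomial_coord_fun.const polynomial_chart_entry)
       (use assms in auto)
qed

lemma zariski_closed_rank_locus: "zariski_closed n (rank_locus n p q m)"
  unfolding zariski_closed_def
proof (intro conjI ballI)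
  show "rank_locus n p q m \<subseteq> flag_variety n" by (auto simp: rank_locus_def)
  fix g assume g: "g \<in> GL n"
  let ?f = "\<lambda>ys \<rho> a. det (mat m m (\<lambda>(s, t). ((g * lower_unipotent n a) *\<^sub>v ys t) $ \<rho> s))"
  let ?ok = "\<lambda>ys \<rho>. (\<forall>t<m. ys t \<in> std_flag n p) \<and> (\<forall>s<m. q \<le> \<rho> s \<and> \<rho> s < n)"
  let ?P = "{?f ys \<rho> | ys \<rho>. ?ok ys \<rho>}"
  have "polynomial_coord_fun (?f ys \<rho>)" if ok: "?ok ys \<rho>" for ys \<rho>
    by (rule polynomial_det) (use ok polynomial_chart_vec_entry[OF GL_carrier[OF g]] std_flag_carrier in blast)
  then have "\<forall>f\<in>?P. polynomial_coord_fun f" by (intro ballI) (elim CollectE exE conjE, simp only:)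
  moreover have "chart_part n g (rank_locus n p q m) = {a \<in> affine_space n. \<forall>f\<in>?P. f a = 0}"
  proof -
    have "(\<forall>f\<in>?P. f a = 0) \<longleftrightarrow> (\<forall>ys \<rho>. ?ok ys \<rho> \<longrightarrow> ?f ys \<rho> a = 0)" for a
    proof
      assume L: "\<forall>f\<in>?P. f a = 0"
      show "\<forall>ys \<rho>. ?ok ys \<rho> \<longrightarrow> ?f ys \<rho> a = 0"
      proof (intro allI impI)
        fix ys \<rho> assume ok: "?ok ys \<rho>"
        have "?f ys \<rho> \<in> ?P" using ok by (intro CollectI exI[of _ ys] exI[of _ \<rho>]) blast
        from L[rule_format, OF this] show "?f ys \<rho> a = 0" .
      qed
    next
      assume R: "\<forall>ys \<rho>. ?ok ys \<rho> \<longrightarrow> ?f ys \<rho> a = 0"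
      show "\<forall>f\<in>?P. f a = 0"
        by (intro ballI) (elim CollectE exE conjE, simp only: R)
    qed
    then show ?thesis
      unfolding chart_part_def chart_def rank_locus_iff[OF chart_GL[OF g]] by (simp only:)
  qed
  ultimately show "algebraic_set n (chart_part n g (rank_locus n p q m))" unfolding algebraic_set_def by blast
qed

lemma det_zero_row:
  fixes B :: "complex mat"
  assumes "B \<in> carrier_mat m m" "i < m" "\<And>j. j < m \<Longrightarrow> B $$ (i, j) = 0"
  shows "det B = 0"
  unfolding det_def'[OF assms(1)]
proof (intro sum.neutral ballI)
  fix p assume "p \<in> {p. p permutes {0..<m}}"
  then have "p i < m" using permutes_in_image[of p "{0..<m}" i] assms(2) by auto
  then have "B $$ (i, p i) = 0" using assms(3) by simp
  then have "(\<Prod>i = 0..<m. B $$ (i, p i)) = 0" using assms(2) by (intro prod_zero) auto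
  then show "signof p * (\<Prod>i = 0..<m. B $$ (i, p i)) = 0" by simp
qed

text \<open>The matrix factors through a space of dimension smaller than m. Padded to size m, the
  second factor has a zero row.\<close>

lemma det_low_rank:
  fixes A B :: "nat \<Rightarrow> nat \<Rightarrow> complex"
  assumes K: "finite K" "card K < m"
    and M: "\<And>s t. s < m \<Longrightarrow> t < m \<Longrightarrow> M s t = (\<Sum>k\<in>K. A s k * B k t)"
  shows "det (mat m m (\<lambda>(s, t). M s t)) = 0"
proof -
  obtain e where e: "bij_betw e {..<card K} K"
    using ex_bij_betw_nat_finite[OF K(1)] by (metis atLeast0LessThan)
  let ?A = "mat m m (\<lambda>(s, l). if l < card K then A s (e l) else 0)"
  let ?B = "mat m m (\<lambda>(l, t). if l < card K then B (e l) t else 0)"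
  have "mat m m (\<lambda>(s, t). M s t) = ?A * ?B"
  proof (rule eq_matI)
    fix s t assume "s < dim_row (?A * ?B)" "t < dim_col (?A * ?B)"
    then have st: "s < m" "t < m" by auto
    have "(?A * ?B) $$ (s, t) = (\<Sum>l<m. if l < card K then A s (e l) * B (e l) t else 0)"
      by (subst mult_mat_entry[of _ m m _ m]) (use st in \<open>auto intro!: sum.cong\<close>)
    also have "\<dots> = (\<Sum>l<card K. A s (e l) * B (e l) t)"
      using K(2) by (intro sum.mono_neutral_cong_right) auto
    also have "\<dots> = (\<Sum>k\<in>K. A s k * B k t)" by (rule sum.reindex_bij_betw[OF e])
    finally show "mat m m (\<lambda>(s, t). M s t) $$ (s, t) = (?A * ?B) $$ (s, t)" using M st by simp
  qed auto
  moreover have "det (?A * ?B) = det ?A * det ?B" by (rule det_mult[of _ m]) auto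
  moreover have "det ?B = 0" by (rule det_zero_row[of _ m "card K"]) (use K(2) in auto)
  ultimately show ?thesis by simp
qed

text \<open>Column k of \<open>b * perm_mat n w\<close> is column \<open>w0 w k\<close> of b and
  vanishes below row \<open>w0 w k\<close>. So in the rows from q on only the columns with
  \<open>q \<le> w0 w k\<close> contribute.\<close>

lemma cell_in_rank_locus:
  assumes w: "w permutes {1..n}" and p: "p \<le> n" and m: "card {k. k < p \<and> q \<le> w0 w k} < m"
  shows "schubert_cell n w \<subseteq> rank_locus n p q m"
proof
  fix F assume "F \<in> schubert_cell n w"
  then obtain b where b: "b \<in> borel_subgroup n" "F = flag_of n (b * perm_mat n w)" by (auto simp: schubert_cell_def)
  let ?g = "b * perm_mat n w"
  let ?K = "{k. k < p \<and> q \<le> w0 w k}"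
  have g: "?g \<in> GL n" by (intro GL_mult borel_GL[OF b(1)] perm_mat_GL[OF w])
  have entry: "?g $$ (r, k) = b $$ (r, w0 w k)" if "r < n" "k < n" for r k
  proof -
    have "?g $$ (r, k) = (\<Sum>l<n. if l = w0 w k then b $$ (r, w0 w k) else 0)"
      unfolding mult_mat_entry[OF borel_carrier[OF b(1)] perm_mat_carrier that]
      by (rule sum.cong) (use perm_mat_entry[OF w _ that(2)] in auto)
    then show ?thesis using w0(2)[OF w that(2)] by simp
  qed
  have "flag_of n ?g \<in> rank_locus n p q m"
    unfolding rank_locus_iff[OF g]
  proof (intro allI impI)
    fix ys \<rho> assume A: "(\<forall>t<m. ys t \<in> std_flag n p) \<and> (\<forall>s<m. q \<le> \<rho> s \<and> \<rho> s < n)"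
    show "det (mat m m (\<lambda>(s, t). (?g *\<^sub>v ys t) $ \<rho> s)) = 0"
    proof (rule det_low_rank[of ?K])
      fix s t assume st: "s < m" "t < m"
      then have \<rho>: "q \<le> \<rho> s" "\<rho> s < n" and y: "ys t \<in> std_flag n p" using A by auto
      have "(?g *\<^sub>v ys t) $ \<rho> s = (\<Sum>l<n. ?g $$ (\<rho> s, l) * ys t $ l)"
        by (rule mult_mat_vec_entry[OF GL_carrier[OF g] std_flag_carrier[OF y] \<rho>(2)])
      also have "\<dots> = (\<Sum>k\<in>?K. ?g $$ (\<rho> s, k) * ys t $ k)"
      proof (rule sum.mono_neutral_right)
        show "\<forall>l\<in>{..<n} - ?K. ?g $$ (\<rho> s, l) * ys t $ l = 0"
        proof
          fix l assume l: "l \<in> {..<n} - ?K"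
          show "?g $$ (\<rho> s, l) * ys t $ l = 0"
          proof (cases "l < p")
            case True
            then have "w0 w l < \<rho> s" using l \<rho> by auto
            then show ?thesis using entry[OF \<rho>(2), of l] borel_entry[OF b(1) _ \<rho>(2)] l by simp
          next
            case False
            then show ?thesis using y l by (auto simp: std_flag_def)
          qed
        qed
      qed (use p in auto)
      finally show "(?g *\<^sub>v ys t) $ \<rho> s = (\<Sum>k\<in>?K. ?g $$ (\<rho> s, k) * ys t $ k)" .
    qed (use m in auto)
  qed
  then show "F \<in> rank_locus n p q m" using b(2) by simp
qed

lemma schubert_variety_rank_locus:
  assumes "w permutes {1..n}" "p \<le> n" "card {k. k < p \<and> q \<le> w0 w k} < m"
  shows "schubert_variety n w \<subseteq> rank_locus n p q m"
  using cell_in_rank_locus[OF assms] zariski_closed_rank_locus in_schubert_variety_iff by blast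

lemma card_w0_eq_rk:
  assumes w: "w permutes {1..n}" and p: "p \<le> n"
  shows "card {k. k < p \<and> q \<le> w0 w k} = rk w p q"
proof -
  have "bij_betw Suc {k. k < p \<and> q \<le> w0 w k} {k \<in> {1..p}. q < w k}"
  proof (rule bij_betwI[where g = "\<lambda>k. k - 1"])
    show "Suc \<in> {k. k < p \<and> q \<le> w0 w k} \<rightarrow> {k \<in> {1..p}. q < w k}"
      using w0(1)[OF w] p by auto
    show "(\<lambda>k. k - 1) \<in> {k \<in> {1..p}. q < w k} \<rightarrow> {k. k < p \<and> q \<le> w0 w k}"
      using p by (auto simp: w0_def)
  qed auto
  then show ?thesis unfolding rk_def by (rule bij_betw_same_card)
qed

lemma std_unit_vec: "k < p \<Longrightarrow> p \<le> n \<Longrightarrow> unit_vec n k \<in> std_flag n p"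
  by (auto simp: std_flag_def)

lemma mat_unit_vec_entry:
  fixes A :: "complex mat"
  assumes "A \<in> carrier_mat n n" "i < n" "k < n"
  shows "(A *\<^sub>v unit_vec n k) $ i = A $$ (i, k)"
  using mult_mat_vec_entry[OF assms(1), of "unit_vec n k" i] assms
  by (simp add: unit_vec_def if_distrib[of "\<lambda>x. _ * x"] cong: if_cong)

lemma bruhat_le_of_schubert_variety:
  assumes w: "w permutes {1..n}" and v: "v permutes {1..n}" and g: "g \<in> bruhat_cell n v"
    and mem: "flag_of n g \<in> schubert_variety n w"
  shows "bruhat_le n v w"
proof -
  obtain b b' where b: "b \<in> borel_subgroup n" "b' \<in> borel_subgroup n" "g = b * perm_mat n v * b'"
    using g by (auto simp: bruhat_cell_def)
  have "flag_of n (b * perm_mat n v) \<in> schubert_variety n w"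
    using mem flag_of_mult_borel[OF _ b(2), of "b * perm_mat n v"] borel_carrier[OF b(1)] b(3) by simp
  then have V: "flag_of n (perm_mat n v) \<in> schubert_variety n w"
    using schubert_variety_borel_iff[OF w b(1) perm_mat_GL[OF v]] by simp
  have le_n: "rk v p q \<le> rk w p q" if p: "p \<le> n" for p q
  proof (rule ccontr)
    let ?K = "{k. k < p \<and> q \<le> w0 v k}"
    assume "\<not> ?thesis"
    then have "rk w p q < card ?K" using card_w0_eq_rk[OF v p] by simp
    then have *: "flag_of n (perm_mat n v) \<in> rank_locus n p q (card ?K)"
      using V schubert_variety_rank_locus[OF w p, of q "card ?K"] card_w0_eq_rk[OF w p, of q] by auto
    have "finite ?K" by simp
    then obtain e where e: "bij_betw e {..<card ?K} ?K"
      using ex_bij_betw_nat_finite by (metis atLeast0LessThan)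
    have eK: "e t < p" "q \<le> w0 v (e t)" if "t < card ?K" for t
      using bij_betwE[OF e] that by auto
    have inj: "e s = e t \<longleftrightarrow> s = t" if "s < card ?K" "t < card ?K" for s t
      using bij_betw_imp_inj_on[OF e] that by (auto simp: inj_on_def)
    let ?M = "mat (card ?K) (card ?K) (\<lambda>(s, t). (perm_mat n v *\<^sub>v unit_vec n (e t)) $ w0 v (e s))"
    have "det ?M = 0"
    proof (rule *[unfolded rank_locus_iff[OF perm_mat_GL[OF v]], rule_format, of "\<lambda>t. unit_vec n (e t)"])
      show "(\<forall>t<card ?K. unit_vec n (e t) \<in> std_flag n p) \<and> (\<forall>s<card ?K. q \<le> w0 v (e s) \<and> w0 v (e s) < n)"
        using eK std_unit_vec[OF _ p] w0(2)[OF v] p by (meson less_le_trans)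
    qed
    moreover have "?M = 1\<^sub>m (card ?K)"
    proof (rule eq_matI)
      fix s t assume "s < dim_row (1\<^sub>m (card ?K) :: complex mat)" "t < dim_col (1\<^sub>m (card ?K) :: complex mat)"
      then have st: "s < card ?K" "t < card ?K" by auto
      have lt: "e s < n" "e t < n" using eK[OF st(1)] eK[OF st(2)] p by auto
      show "?M $$ (s, t) = 1\<^sub>m (card ?K) $$ (s, t)"
        using st mat_unit_vec_entry[OF perm_mat_carrier w0(2)[OF v lt(1)] lt(2)]
          perm_mat_entry[OF v w0(2)[OF v lt(1)] lt(2)] inj[OF st] w0_inj[OF v lt] by auto
    qed auto
    ultimately show False by simp
  qed
  have "rk v p q \<le> rk w p q" for p q
  proof (cases "p \<le> n")
    \<comment> \<open>Beyond n every permutation of {1..n} has the same rank as the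
      identity.\<close>
    case False
    have *: "rk u p q = rk id p q" if u: "u permutes {1..n}" for u
    proof -
      have "bij_betw u {k \<in> {1..p}. q < u k} {k \<in> {1..p}. q < id k}"
      proof (rule bij_betwI[where g = "perm_inv u"])
        have up: "u permutes {1..p}" by (rule permutes_subset[OF u]) (use False in auto)
        show "u \<in> {k \<in> {1..p}. q < u k} \<rightarrow> {k \<in> {1..p}. q < id k}" using permutes_in_image[OF up] by auto
        show "perm_inv u \<in> {k \<in> {1..p}. q < id k} \<rightarrow> {k \<in> {1..p}. q < u k}"
          using permutes_in_image[OF permutes_inv[OF up]] permutes_inverses(1)[OF u] by auto
      qed (use permutes_inverses[OF u] in auto)
      then show ?thesis unfolding rk_def by (rule bij_betw_same_card)
    qed
    show ?thesis unfolding *[OF v] *[OF w] ..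
  qed (rule le_n)
  then show ?thesis by (rule bruhat_le_if_rk_le[OF v w])
qed

section \<open>Dimensions of tangent spaces\<close>

definition low :: "nat \<Rightarrow> (nat \<times> nat) set" where
  "low n = {(i, j). j < i \<and> i < n}"

definition supported :: "(nat \<times> nat) set \<Rightarrow> coords set" where
  "supported J = {V. \<forall>p. p \<notin> J \<longrightarrow> V p = 0}"

lemma finite_low [simp]: "finite (low n)"
  by (rule finite_subset[of _ "{..<n} \<times> {..<n}"]) (auto simp: low_def)

lemma affine_space_eq: "affine_space n = supported (low n)"
  by (auto simp: affine_space_def supported_def low_def)

lemma subspace_supported: "coord_space.subspace (supported J)"
  by (auto simp: coord_space.subspace_def supported_def coord_scale_def)

definition unit_coord :: "nat \<times> nat \<Rightarrow> coords" where
  "unit_coord p = (\<lambda>q. if q = p then 1 else 0)"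

lemma sum_coords_apply: "(\<Sum>x\<in>A. f x :: coords) p = (\<Sum>x\<in>A. f x p)"
  by (induction A rule: infinite_finite_induct) auto

lemma inj_unit_coord: "inj_on unit_coord J"
  by (auto simp: inj_on_def unit_coord_def fun_eq_iff split: if_splits)

lemma supported_span:
  assumes "finite J"
  shows "supported J \<subseteq> coord_space.span (unit_coord ` J)"
proof
  fix V assume V: "V \<in> supported J"
  have "V = (\<Sum>p\<in>J. coord_scale (V p) (unit_coord p))"
  proof
    fix q
    have "(\<Sum>p\<in>J. coord_scale (V p) (unit_coord p)) q = (\<Sum>p\<in>J. if q = p then V p else 0)"
      unfolding sum_coords_apply by (rule sum.cong) (auto simp: coord_scale_def unit_coord_def)
    also have "\<dots> = (if q \<in> J then V q else 0)" using assms by simp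
    also have "\<dots> = V q" using V by (simp add: supported_def del: split_paired_All)
    finally show "V q = (\<Sum>p\<in>J. coord_scale (V p) (unit_coord p)) q" by simp
  qed
  also have "\<dots> \<in> coord_space.span (unit_coord ` J)"
    by (intro coord_space.span_sum coord_space.span_scale coord_space.span_base) auto
  finally show "V \<in> coord_space.span (unit_coord ` J)" .
qed

lemma independent_unit_coord:
  assumes "finite J"
  shows "coord_space.independent (unit_coord ` J)"
proof
  assume "coord_space.dependent (unit_coord ` J)"
  then obtain u where u: "\<exists>v\<in>unit_coord ` J. u v \<noteq> 0" "(\<Sum>v\<in>unit_coord ` J. coord_scale (u v) v) = 0"
    using coord_space.dependent_finite[of "unit_coord ` J"] assms by auto
  then obtain q where q: "q \<in> J" "u (unit_coord q) \<noteq> 0" by auto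
  have "(\<Sum>p\<in>J. coord_scale (u (unit_coord p)) (unit_coord p)) = 0"
    using u(2) unfolding sum.reindex[OF inj_unit_coord] by (simp add: comp_def)
  then have "(\<Sum>p\<in>J. coord_scale (u (unit_coord p)) (unit_coord p)) q = 0" by simp
  moreover have "(\<Sum>p\<in>J. coord_scale (u (unit_coord p)) (unit_coord p)) q = (\<Sum>p\<in>J. if q = p then u (unit_coord p) else 0)"
    unfolding sum_coords_apply by (rule sum.cong) (auto simp: coord_scale_def unit_coord_def)
  ultimately show False using q assms by simp
qed

lemma dim_supported:
  assumes "finite J"
  shows "coord_space.dim (supported J) = card J"
proof (rule coord_space.dim_unique)
  show "unit_coord ` J \<subseteq> supported J" by (auto simp: supported_def unit_coord_def)
  show "card (unit_coord ` J) = card J" by (rule card_image[OF inj_unit_coord])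
qed (rule supported_span[OF assms] independent_unit_coord[OF assms])+

lemma linear_coordsI:
  assumes "\<And>v w. f (v + w) = f v + f w" "\<And>c v. f (coord_scale c v) = coord_scale c (f v)"
  shows "Vector_Spaces.linear coord_scale coord_scale f"
  unfolding Vector_Spaces.linear_iff using assms coord_space.vector_space_axioms by blast

text \<open>The space of all coordinate functions is infinite-dimensional; the finite set L supplies
  the finite basis of the target on which counting dimensions depends.\<close>

lemma dim_le_injective:
  assumes S: "coord_space.subspace S" and S': "S' \<subseteq> supported L" "finite L"
    and \<phi>: "Vector_Spaces.linear coord_scale coord_scale \<phi>" "\<phi> ` S \<subseteq> S'"
    and inj: "\<And>V. V \<in> S \<Longrightarrow> \<phi> V = 0 \<Longrightarrow> V = 0"
  shows "coord_space.dim S \<le> coord_space.dim S'"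
proof -
  interpret vector_space_pair coord_scale coord_scale by unfold_locales
  obtain B where B: "B \<subseteq> S" "coord_space.independent B" "S \<subseteq> coord_space.span B" "card B = coord_space.dim S"
    using coord_space.basis_exists by blast
  have span: "coord_space.span B \<subseteq> S" using coord_space.span_minimal[OF B(1) S] .
  have inj': "inj_on \<phi> (coord_space.span B)"
    unfolding linear_inj_on_iff_eq_0[OF \<phi>(1) coord_space.subspace_span] using inj span by blast
  have ind: "coord_space.independent (\<phi> ` B)"
    by (rule linear_independent_injective_image[OF \<phi>(1) B(2) inj'])
  obtain B' where B': "B' \<subseteq> S'" "coord_space.independent B'" "S' \<subseteq> coord_space.span B'" "card B' = coord_space.dim S'"
    using coord_space.basis_exists by blast
  have "finite B'"
    using coord_space.independent_span_bound[of "unit_coord ` L" B'] B' S' supported_span[OF S'(2)] by blast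
  then have "card (\<phi> ` B) \<le> card B'"
    using coord_space.independent_span_bound[OF _ ind] B(1) \<phi>(2) B'(3) by blast
  moreover have "card (\<phi> ` B) = card B"
    by (rule card_image) (rule inj_on_subset[OF inj' coord_space.span_superset])
  ultimately show ?thesis using B B' by simp
qed

text \<open>Any maximal \<open>J\<close> with \<open>T0 \<inter> supported J = {0}\<close> will do.\<close>

lemma complement_coordinates:
  assumes T: "coord_space.subspace T0" "T0 \<subseteq> supported L" and L: "finite L"
  shows "\<exists>J \<subseteq> L. T0 \<inter> supported J = {0} \<and> card (L - J) \<le> coord_space.dim T0"
proof -
  let ?ok = "\<lambda>J. J \<subseteq> L \<and> T0 \<inter> supported J = {0}"
  have zero: "0 \<in> T0" using T(1) coord_space.subspace_0 by blast
  have "?ok {}" using zero by (auto simp: supported_def fun_eq_iff)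
  moreover have "finite {J. ?ok J}" by (rule finite_subset[of _ "Pow L"]) (use L in auto)
  ultimately obtain J where J: "?ok J" and max: "\<And>J'. ?ok J' \<Longrightarrow> J \<subseteq> J' \<Longrightarrow> J' = J"
    using finite_has_maximal2[of "{J. ?ok J}" "{}"] by (metis (mono_tags, lifting) mem_Collect_eq)
  have "\<exists>v. v \<in> T0 \<and> v \<in> supported (insert p J) \<and> v p = 1" if p: "p \<in> L - J" for p
  proof -
    have "\<not> ?ok (insert p J)" using max[of "insert p J"] p by blast
    then obtain v where v: "v \<in> T0" "v \<in> supported (insert p J)" "v \<noteq> 0"
      using p J zero by (auto simp: supported_def)
    have "v p \<noteq> 0"
    proof
      assume "v p = 0"
      then have "v \<in> supported J" using v(2) by (auto simp: supported_def)
      then show False using v J by blast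
    qed
    then have "coord_scale (1 / v p) v p = 1" by (simp add: coord_scale_def)
    moreover have "coord_scale (1 / v p) v \<in> T0" "coord_scale (1 / v p) v \<in> supported (insert p J)"
      using coord_space.subspace_scale[OF T(1) v(1)] coord_space.subspace_scale[OF subspace_supported v(2)] by auto
    ultimately show ?thesis by blast
  qed
  then obtain v where v: "\<And>p. p \<in> L - J \<Longrightarrow> v p \<in> T0 \<and> v p \<in> supported (insert p J) \<and> v p p = 1" by metis
  have fin: "finite (L - J)" using L by simp
  \<comment> \<open>The vectors \<open>v p\<close> restrict to unit vectors on the coordinates in L
    - J, so this map from \<open>supported (L - J)\<close> into T0 is injective.\<close>
  let ?\<phi> = "\<lambda>V. \<Sum>p\<in>L - J. coord_scale (V p) (v p)"
  have val: "?\<phi> V q = V q" if "q \<in> L - J" for V q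
  proof -
    have "?\<phi> V q = (\<Sum>p\<in>L - J. if p = q then V q else 0)"
      unfolding sum_coords_apply
    proof (rule sum.cong[OF refl])
      fix p assume "p \<in> L - J"
      then show "coord_scale (V p) (v p) q = (if p = q then V q else 0)"
        using v[of p] that by (auto simp: coord_scale_def supported_def simp del: split_paired_All)
    qed
    then show ?thesis using that fin by simp
  qed
  have "coord_space.dim (supported (L - J)) \<le> coord_space.dim T0"
  proof (rule dim_le_injective[OF subspace_supported T(2) L])
    show "Vector_Spaces.linear coord_scale coord_scale ?\<phi>"
      by (rule linear_coordsI; intro ext)
         (simp_all add: sum_coords_apply coord_scale_def algebra_simps sum.distrib sum_distrib_left)
    show "?\<phi> ` supported (L - J) \<subseteq> T0"
    proof (intro image_subsetI coord_space.subspace_sum[OF T(1)])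
      fix V p assume "p \<in> L - J"
      then show "coord_scale (V p) (v p) \<in> T0" using v coord_space.subspace_scale[OF T(1)] by blast
    qed
    show "V = 0" if "V \<in> supported (L - J)" "?\<phi> V = 0" for V
    proof
      fix q show "V q = 0 q"
        using val[of q V] that by (cases "q \<in> L - J") (auto simp: supported_def simp del: split_paired_All)
    qed
  qed
  then show ?thesis using J dim_supported[OF fin] by auto
qed

lemma subspace_tangent_space: "coord_space.subspace (tangent_space n Z g)"
proof -
  have lin: "((\<lambda>s. f (coord_scale s (coord_scale c v + coord_scale d u))) has_field_derivative 0) (at 0)"
    if f: "polynomial_coord_fun f"
      and v: "((\<lambda>s. f (coord_scale s v)) has_field_derivative 0) (at 0)"
      and u: "((\<lambda>s. f (coord_scale s u)) has_field_derivative 0) (at 0)" for f c d u v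
  proof -
    obtain D where D: "\<And>a v. ((\<lambda>s. f (\<lambda>p. a p + s * v p)) has_field_derivative D a v) (at 0)"
      "\<And>a v u c d. D a (\<lambda>p. c * v p + d * u p) = c * D a v + d * D a u"
      using polynomial_directional_derivative[OF f] by blast
    have D': "((\<lambda>s. f (coord_scale s v)) has_field_derivative D 0 v) (at 0)" for v
      using D(1)[of 0 v] by (simp add: coord_scale_def)
    have "D 0 v = 0" "D 0 u = 0" using DERIV_unique[OF D' v] DERIV_unique[OF D' u] by auto
    then have "D 0 (\<lambda>p. c * v p + d * u p) = 0" using D(2)[of 0 c v d u] by simp
    moreover have "(\<lambda>p. c * v p + d * u p) = coord_scale c v + coord_scale d u"
      by (auto simp: coord_scale_def fun_eq_iff)
    ultimately show ?thesis using D'[of "coord_scale c v + coord_scale d u"] by simp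
  qed
  have one: "coord_scale 1 v = v" "coord_scale 0 v = 0" for v by (auto simp: coord_scale_def fun_eq_iff)
  show ?thesis
    unfolding coord_space.subspace_def
  proof (intro conjI allI ballI)
    show "0 \<in> tangent_space n Z g" using affine_zero by (auto simp: tangent_space_def coord_scale_def)
  next
    fix x y assume xy: "x \<in> tangent_space n Z g" "y \<in> tangent_space n Z g"
    then have "x + y \<in> affine_space n"
      unfolding affine_space_eq using coord_space.subspace_add[OF subspace_supported] by (auto simp: tangent_space_def affine_space_eq)
    then show "x + y \<in> tangent_space n Z g"
      using xy lin[of _ x y 1 1] unfolding tangent_space_def one by blast
  next
    fix c x assume x: "x \<in> tangent_space n Z g"
    then have "coord_scale c x \<in> affine_space n"
      unfolding affine_space_eq using coord_space.subspace_scale[OF subspace_supported] by (auto simp: tangent_space_def affine_space_eq)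
    then show "coord_scale c x \<in> tangent_space n Z g"
      using x lin[of _ x x c 0] unfolding tangent_space_def one by auto
  qed
qed

lemma tangent_space_supported: "tangent_space n Z g \<subseteq> supported (low n)"
  by (auto simp: tangent_space_def affine_space_eq)

section \<open>Semicontinuity along a coordinate line\<close>

lemma polynomial_compose:
  assumes "polynomial_coord_fun f" "\<And>p. polynomial_coord_fun (\<lambda>a. \<tau> a p)"
  shows "polynomial_coord_fun (\<lambda>a. f (\<tau> a))"
  using assms(1) by induction (auto intro: polynomial_coord_fun.intros assms(2))

text \<open>
  The strictly lower triangular matrix \<open>U\<close> multiplied from the left by the elementary matrix with
  entry \<open>c\<close> at \<open>(i, j)\<close>.
\<close>

definition line_shift :: "nat \<Rightarrow> nat \<Rightarrow> complex \<Rightarrow> coords \<Rightarrow> coords" where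
  "line_shift i j c U = (\<lambda>(a, b). U (a, b) + (if a = i \<and> b < j then c * U (j, b) else 0))"

lemma line_shift_affine:
  assumes "j < i" "i < n" "U \<in> affine_space n"
  shows "line_shift i j c U \<in> affine_space n"
  using assms by (auto simp: line_shift_def affine_space_def)

text \<open>Moving the centre of a chart along a coordinate line is an affine substitution in the
  coordinates, with linear part \<open>line_shift\<close>. Tangent spaces at all points of the line
  can thus be compared in one chart.\<close>

lemma addrow_lower_unipotent:
  assumes ij: "j < i" "i < n" and U: "U \<in> affine_space n"
  shows "addrow_mat n c i j * lower_unipotent n U = lower_unipotent n (line_coord i j c + line_shift i j c U)"
proof (rule eq_matI)
  fix a b assume "a < dim_row (lower_unipotent n (line_coord i j c + line_shift i j c U))"
    "b < dim_col (lower_unipotent n (line_coord i j c + line_shift i j c U))"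
  then have ab: "a < n" "b < n" by auto
  show "(addrow_mat n c i j * lower_unipotent n U) $$ (a, b) =
      lower_unipotent n (line_coord i j c + line_shift i j c U) $$ (a, b)"
    using addrow_mult_entry[OF lower_unipotent_carrier ij(2) _ ab, of j c U] ij ab
    by (auto simp: lower_unipotent_def line_coord_def line_shift_def)
qed auto

lemma tangent_space_line_shift:
  assumes g: "g \<in> GL n" and ij: "j < i" "i < n"
    and U: "U \<in> tangent_space n Z (g * addrow_mat n c i j)"
    and f: "polynomial_coord_fun f" "\<forall>a\<in>chart_part n g Z. f a = 0"
  shows "((\<lambda>s. f (\<lambda>p. line_coord i j c p + s * line_shift i j c U p)) has_field_derivative 0) (at 0)"
proof -
  let ?\<tau> = "\<lambda>a. line_coord i j c + line_shift i j c a"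
  have UA: "U \<in> affine_space n" using U by (simp add: tangent_space_def)
  have "polynomial_coord_fun (\<lambda>a. ?\<tau> a p)" for p
    by (cases p; cases "fst p = i \<and> snd p < j") (auto simp: line_shift_def intro!: polynomial_coord_fun.intros)
  then have "polynomial_coord_fun (\<lambda>a. f (?\<tau> a))" by (rule polynomial_compose[OF f(1)])
  moreover have "f (?\<tau> a) = 0" if a: "a \<in> chart_part n (g * addrow_mat n c i j) Z" for a
  proof -
    have aA: "a \<in> affine_space n" using a by (simp add: chart_part_def)
    have "g * addrow_mat n c i j * lower_unipotent n a = g * lower_unipotent n (?\<tau> a)"
      unfolding addrow_lower_unipotent[OF ij aA, symmetric] by (rule assoc3[OF GL_carrier[OF g]]) auto
    then have "chart n g (?\<tau> a) \<in> Z" using a by (simp add: chart_part_def chart_def)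
    moreover have "?\<tau> a \<in> affine_space n"
      using line_shift_affine[OF ij aA, of c] line_coord_affine[OF ij, of c] unfolding affine_space_eq
      by (intro coord_space.subspace_add[OF subspace_supported])
    ultimately show ?thesis using f(2) by (simp add: chart_part_def)
  qed
  ultimately have "((\<lambda>s. f (?\<tau> (coord_scale s U))) has_field_derivative 0) (at 0)"
    using U unfolding tangent_space_def by blast
  moreover have "?\<tau> (coord_scale s U) = (\<lambda>p. line_coord i j c p + s * line_shift i j c U p)" for s
    by (auto simp: fun_eq_iff line_shift_def coord_scale_def algebra_simps)
  ultimately show ?thesis by simp
qed

text \<open>Bolzano-Weierstrass, one coordinate at a time with successive subsequences.\<close>

lemma convergent_coordinates:
  fixes V :: "nat \<Rightarrow> 'a \<Rightarrow> complex"
  assumes "finite J" "\<And>k p. p \<in> J \<Longrightarrow> cmod (V k p) \<le> 1"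
  shows "\<exists>\<sigma> L. strict_mono (\<sigma> :: nat \<Rightarrow> nat) \<and> (\<forall>p\<in>J. (\<lambda>k. V (\<sigma> k) p) \<longlonglongrightarrow> L p)"
  using assms
proof (induction J rule: finite_induct)
  case empty
  show ?case by (rule exI[of _ "\<lambda>x. x"]) (simp add: strict_mono_def)
next
  case (insert q J)
  then obtain \<sigma> L where \<sigma>: "strict_mono \<sigma>" "\<forall>p\<in>J. (\<lambda>k. V (\<sigma> k) p) \<longlonglongrightarrow> L p" by auto
  have "\<forall>k. cmod (V (\<sigma> k) q) \<le> 1" using insert.prems by simp
  from Bolzano_Weierstrass_complex_disc[OF this] obtain \<tau> :: "nat \<Rightarrow> nat" and z where \<tau>: "strict_mono \<tau>"
    "\<forall>e>0. \<exists>N. \<forall>k\<ge>N. cmod (V (\<sigma> (\<tau> k)) q - z) < e" by blast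
  have "(\<lambda>k. V (\<sigma> (\<tau> k)) q) \<longlonglongrightarrow> z" using \<tau>(2) by (simp add: LIMSEQ_def dist_norm)
  moreover have "(\<lambda>k. V (\<sigma> (\<tau> k)) p) \<longlonglongrightarrow> L p" if "p \<in> J" for p
    using LIMSEQ_subseq_LIMSEQ[OF \<sigma>(2)[rule_format, OF that] \<tau>(1)] by (simp add: comp_def)
  ultimately have "\<forall>p\<in>insert q J. (\<lambda>k. V ((\<sigma> \<circ> \<tau>) k) p) \<longlonglongrightarrow> (L(q := z)) p"
    using insert.hyps by auto
  moreover have "strict_mono (\<sigma> \<circ> \<tau>)" using \<sigma>(1) \<tau>(1) by (rule strict_mono_o)
  ultimately show ?case by blast
qed

text \<open>Semicontinuity: limits of unit tangent vectors along the line would lie in the complement.\<close>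

lemma tangent_dim_line_le:
  assumes g: "g \<in> GL n" and ij: "j < i" "i < n"
    and k: "\<And>c. c \<noteq> 0 \<Longrightarrow> k \<le> tangent_dim n Z (g * addrow_mat n c i j)"
  shows "k \<le> tangent_dim n Z g"
proof (rule ccontr)
  let ?T = "tangent_space n Z g"
  let ?S = "\<lambda>c. tangent_space n Z (g * addrow_mat n c i j)"
  assume "\<not> ?thesis"
  then have small: "coord_space.dim ?T < k" by (simp add: tangent_dim_def)
  obtain J where J: "J \<subseteq> low n" "?T \<inter> supported J = {0}" "card (low n - J) \<le> coord_space.dim ?T"
    using complement_coordinates[OF subspace_tangent_space tangent_space_supported finite_low] by metis
  have finJ: "finite J" using J(1) finite_subset finite_low by blast
  have lin_shift: "line_shift i j c (v + w) = line_shift i j c v + line_shift i j c w"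
    "line_shift i j c (coord_scale d v) = coord_scale d (line_shift i j c v)" for c d v w
    by (auto simp: line_shift_def coord_scale_def fun_eq_iff algebra_simps)
  have "\<exists>U\<in>?S c. line_shift i j c U \<in> supported J \<and> (\<Sum>p\<in>J. cmod (line_shift i j c U p)) = 1" if c: "c \<noteq> 0" for c
  proof -
    \<comment> \<open>The tangent space at the point c has larger dimension than the number of
      coordinates outside J, so after the shift it contains a nonzero vector supported on J.\<close>
    let ?\<phi> = "\<lambda>U p. if p \<in> low n - J then line_shift i j c U p else 0"
    have "\<exists>U\<in>?S c. ?\<phi> U = 0 \<and> U \<noteq> 0"
    proof (rule ccontr)
      assume A: "\<not> ?thesis"
      have "coord_space.dim (?S c) \<le> coord_space.dim (supported (low n - J))"
      proof (rule dim_le_injective[OF subspace_tangent_space, of _ "low n - J"])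
        show "Vector_Spaces.linear coord_scale coord_scale ?\<phi>"
          by (rule linear_coordsI; intro ext; simp only: lin_shift; simp add: coord_scale_def)
      qed (use A in \<open>auto simp: supported_def\<close>)
      then show False using k[OF c] small J(3) dim_supported[of "low n - J"] by (simp add: tangent_dim_def)
    qed
    then obtain U where U: "U \<in> ?S c" "?\<phi> U = 0" "U \<noteq> 0" by blast
    let ?W = "line_shift i j c U"
    have UA: "U \<in> affine_space n" using U(1) by (simp add: tangent_space_def)
    have "?W p = 0" if "p \<notin> J" for p
    proof (cases "p \<in> low n")
      case True
      then show ?thesis using fun_cong[OF U(2), of p] that by simp
    next
      case False
      then show ?thesis using line_shift_affine[OF ij UA, of c]
        by (simp add: affine_space_eq supported_def del: split_paired_All)
    qed
    then have WJ: "?W \<in> supported J" by (simp add: supported_def)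
    have "?W \<noteq> 0"
    proof
      assume W: "?W = 0"
      have U1: "U (a, b) + (if a = i \<and> b < j then c * U (j, b) else 0) = 0" for a b
        using fun_cong[OF W, of "(a, b)"] by (simp add: line_shift_def)
      \<comment> \<open>The shift changes row i only, so row j of U vanishes; then the correction to
        row i vanishes too.\<close>
      have "U (j, b) = 0" for b using U1[of j b] ij by simp
      then have "U (a, b) = 0" for a b using U1[of a b] by (cases "a = i \<and> b < j") auto
      then show False using U(3) by (auto simp: fun_eq_iff)
    qed
    define N where "N = (\<Sum>p\<in>J. cmod (?W p))"
    obtain p where "?W p \<noteq> 0" using \<open>?W \<noteq> 0\<close> by (auto simp: fun_eq_iff)
    then have "p \<in> J" "0 < cmod (?W p)" using WJ by (auto simp: supported_def simp del: split_paired_All)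
    then have N: "0 < N" unfolding N_def using finJ by (intro sum_pos2) auto
    let ?d = "complex_of_real (1 / N)"
    have "coord_scale ?d U \<in> ?S c" by (rule coord_space.subspace_scale[OF subspace_tangent_space U(1)])
    moreover have "coord_scale ?d ?W \<in> supported J" by (rule coord_space.subspace_scale[OF subspace_supported WJ])
    moreover have "(\<Sum>p\<in>J. cmod (coord_scale ?d ?W p)) = 1"
    proof -
      have "cmod (coord_scale ?d ?W p) = cmod (?W p) / N" for p
        using N by (simp add: coord_scale_def norm_mult norm_divide)
      then have "(\<Sum>p\<in>J. cmod (coord_scale ?d ?W p)) = N / N"
        by (simp add: sum_divide_distrib[symmetric] N_def)
      then show ?thesis using N by simp
    qed
    ultimately show ?thesis unfolding lin_shift(2)[symmetric] by blast
  qed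
  then obtain U where U: "\<And>c. c \<noteq> 0 \<Longrightarrow> U c \<in> ?S c \<and> line_shift i j c (U c) \<in> supported J \<and>
      (\<Sum>p\<in>J. cmod (line_shift i j c (U c) p)) = 1" by metis
  define c :: "nat \<Rightarrow> complex" where "c m = complex_of_real (inverse (real (Suc m)))" for m
  have c0: "c m \<noteq> 0" for m unfolding c_def by (simp del: of_nat_Suc)
  have c_lim: "c \<longlonglongrightarrow> 0"
    unfolding c_def using tendsto_of_real[OF LIMSEQ_inverse_real_of_nat, where 'a = complex] by simp
  define W where "W m = line_shift i j (c m) (U (c m))" for m
  have W: "W m \<in> supported J" "(\<Sum>p\<in>J. cmod (W m p)) = 1" for m using U[OF c0] by (auto simp: W_def)
  have "cmod (W m p) \<le> 1" if "p \<in> J" for m p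
    using member_le_sum[OF that, of "\<lambda>p. cmod (W m p)"] finJ W(2)[of m] by simp
  from convergent_coordinates[where V = W, OF finJ this] obtain \<sigma> L where
    \<sigma>: "strict_mono \<sigma>" "\<forall>p\<in>J. (\<lambda>m. W (\<sigma> m) p) \<longlonglongrightarrow> L p" by auto
  define V where "V p = (if p \<in> J then L p else 0)" for p
  have lim: "(\<lambda>m. W (\<sigma> m) p) \<longlonglongrightarrow> V p" for p
    using \<sigma>(2) W(1) by (cases "p \<in> J") (auto simp: V_def supported_def simp del: split_paired_All)
  have "(\<lambda>m. \<Sum>p\<in>J. cmod (W (\<sigma> m) p)) \<longlonglongrightarrow> (\<Sum>p\<in>J. cmod (V p))"
    by (intro tendsto_sum tendsto_norm lim)
  then have "(\<Sum>p\<in>J. cmod (V p)) = 1" using W(2) by (simp add: LIMSEQ_const_iff)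
  then have "V \<noteq> 0" by auto
  have VJ: "V \<in> supported J" by (simp add: V_def supported_def)
  have VA: "V \<in> affine_space n" unfolding affine_space_eq using VJ J(1) by (auto simp: supported_def)
  have "V \<in> ?T"
    unfolding tangent_space_def
  proof (intro CollectI conjI VA allI impI)
    fix f assume f: "polynomial_coord_fun f \<and> (\<forall>a\<in>chart_part n g Z. f a = 0)"
    then obtain D where D: "\<And>a v. ((\<lambda>s. f (\<lambda>p. a p + s * v p)) has_field_derivative D a v) (at 0)"
      "\<And>A V a v. (\<forall>p. (\<lambda>k::nat. A k p) \<longlonglongrightarrow> a p) \<Longrightarrow> (\<forall>p. (\<lambda>k. V k p) \<longlonglongrightarrow> v p) \<Longrightarrow>
        (\<lambda>k. D (A k) (V k)) \<longlonglongrightarrow> D a v"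
      using polynomial_directional_derivative[of f] by blast
    \<comment> \<open>At each point of the sequence the differential kills the shifted tangent
      vector; by joint continuity it kills the limit.\<close>
    have zero: "D (line_coord i j (c m)) (W m) = 0" for m
      using DERIV_unique[OF D(1) tangent_space_line_shift[OF g ij conjunct1[OF U[OF c0[of m]]] conjunct1[OF f] conjunct2[OF f]]]
      unfolding W_def .
    have "(\<lambda>m. line_coord i j (c (\<sigma> m)) p) \<longlonglongrightarrow> (0 :: coords) p" for p
      using LIMSEQ_subseq_LIMSEQ[OF c_lim \<sigma>(1)] by (cases "p = (i, j)") (auto simp: line_coord_def comp_def)
    then have "(\<lambda>m. D (line_coord i j (c (\<sigma> m))) (W (\<sigma> m))) \<longlonglongrightarrow> D 0 V"
      using lim by (intro D(2)) auto
    then have "D 0 V = 0" unfolding zero by (simp add: LIMSEQ_const_iff)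
    then show "((\<lambda>s. f (coord_scale s V)) has_field_derivative 0) (at 0)"
      using D(1)[of 0 V] by (simp add: coord_scale_def)
  qed
  then show False using J(2) VJ \<open>V \<noteq> 0\<close> by blast
qed

lemma line_in_tangent_space:
  assumes g: "g \<in> GL n" and ij: "j < i" "i < n"
    and Z: "\<And>c. flag_of n (g * addrow_mat n c i j) \<in> Z"
  shows "unit_coord (i, j) \<in> tangent_space n Z g"
  unfolding tangent_space_def
proof (intro CollectI conjI allI impI)
  show "unit_coord (i, j) \<in> affine_space n" using ij by (auto simp: unit_coord_def affine_space_def)
  fix f assume f: "polynomial_coord_fun f \<and> (\<forall>a\<in>chart_part n g Z. f a = 0)"
  have "line_coord i j c \<in> chart_part n g Z" for c
    using Z line_coord_affine[OF ij] unfolding chart_part_def chart_def by (simp add: lower_unipotent_line[OF ij])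
  moreover have "coord_scale s (unit_coord (i, j)) = line_coord i j s" for s
    by (auto simp: coord_scale_def unit_coord_def line_coord_def fun_eq_iff)
  ultimately have "(\<lambda>s. f (coord_scale s (unit_coord (i, j)))) = (\<lambda>s. 0)" using f by simp
  then show "((\<lambda>s. f (coord_scale s (unit_coord (i, j)))) has_field_derivative 0) (at 0)" by simp
qed

section \<open>Change of the frame\<close>

text \<open>Agreement with P/Q is required only where Q is nonzero, so the values that division by
  zero assigns elsewhere do not matter.\<close>

definition rational_at_zero :: "(coords \<Rightarrow> complex) \<Rightarrow> bool" where
  "rational_at_zero f \<longleftrightarrow> (\<exists>P Q. polynomial_coord_fun P \<and> polynomial_coord_fun Q \<and> Q 0 \<noteq> 0 \<and>
     (\<forall>a. Q a \<noteq> 0 \<longrightarrow> f a = P a / Q a))"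

lemma rational_of_polynomial: "polynomial_coord_fun f \<Longrightarrow> rational_at_zero f"
  unfolding rational_at_zero_def by (intro exI[of _ f] exI[of _ "\<lambda>a. 1"]) (auto intro: polynomial_coord_fun.const)

lemma rational_add:
  assumes "rational_at_zero f" "rational_at_zero g"
  shows "rational_at_zero (\<lambda>a. f a + g a)"
proof -
  obtain P Q where 1: "polynomial_coord_fun P" "polynomial_coord_fun Q" "Q 0 \<noteq> 0" "\<And>a. Q a \<noteq> 0 \<Longrightarrow> f a = P a / Q a"
    using assms(1) unfolding rational_at_zero_def by blast
  obtain P' Q' where 2: "polynomial_coord_fun P'" "polynomial_coord_fun Q'" "Q' 0 \<noteq> 0" "\<And>a. Q' a \<noteq> 0 \<Longrightarrow> g a = P' a / Q' a"
    using assms(2) unfolding rational_at_zero_def by blast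
  show ?thesis unfolding rational_at_zero_def
    by (intro exI[of _ "\<lambda>a. P a * Q' a + P' a * Q a"] exI[of _ "\<lambda>a. Q a * Q' a"])
       (use 1 2 in \<open>auto intro!: polynomial_coord_fun.intros simp: add_frac_eq\<close>)
qed

lemma rational_mult:
  assumes "rational_at_zero f" "rational_at_zero g"
  shows "rational_at_zero (\<lambda>a. f a * g a)"
proof -
  obtain P Q where 1: "polynomial_coord_fun P" "polynomial_coord_fun Q" "Q 0 \<noteq> 0" "\<And>a. Q a \<noteq> 0 \<Longrightarrow> f a = P a / Q a"
    using assms(1) unfolding rational_at_zero_def by blast
  obtain P' Q' where 2: "polynomial_coord_fun P'" "polynomial_coord_fun Q'" "Q' 0 \<noteq> 0" "\<And>a. Q' a \<noteq> 0 \<Longrightarrow> g a = P' a / Q' a"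
    using assms(2) unfolding rational_at_zero_def by blast
  show ?thesis unfolding rational_at_zero_def
    by (intro exI[of _ "\<lambda>a. P a * P' a"] exI[of _ "\<lambda>a. Q a * Q' a"])
       (use 1 2 in \<open>auto intro!: polynomial_coord_fun.intros\<close>)
qed

text \<open>The fraction Q/P is extended by Q, so that a nonzero denominator guarantees both P and Q
  to be nonzero.\<close>

lemma rational_inverse:
  assumes "rational_at_zero f" "f 0 \<noteq> 0"
  shows "rational_at_zero (\<lambda>a. inverse (f a))"
proof -
  obtain P Q where 1: "polynomial_coord_fun P" "polynomial_coord_fun Q" "Q 0 \<noteq> 0" "\<And>a. Q a \<noteq> 0 \<Longrightarrow> f a = P a / Q a"
    using assms(1) unfolding rational_at_zero_def by blast
  have "P 0 \<noteq> 0" using 1(3) 1(4)[of 0] assms(2) by auto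
  moreover have "inverse (f a) = Q a * Q a / (P a * Q a)" if "P a * Q a \<noteq> 0" for a
  proof -
    have "f a = P a / Q a" using 1(4) that by simp
    then show ?thesis unfolding \<open>f a = _\<close> using that by simp
  qed
  ultimately show ?thesis unfolding rational_at_zero_def
    by (intro exI[of _ "\<lambda>a. Q a * Q a"] exI[of _ "\<lambda>a. P a * Q a"])
       (use 1(1-3) in \<open>auto intro!: polynomial_coord_fun.intros\<close>)
qed

lemma rational_const: "rational_at_zero (\<lambda>a. c)"
  by (rule rational_of_polynomial) (rule polynomial_coord_fun.const)

lemma rational_sum:
  "finite A \<Longrightarrow> (\<And>x. x \<in> A \<Longrightarrow> rational_at_zero (f x)) \<Longrightarrow> rational_at_zero (\<lambda>a. \<Sum>x\<in>A. f x a)"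
  by (induction A rule: finite_induct) (auto intro: rational_const rational_add)

lemma rational_prod:
  "finite A \<Longrightarrow> (\<And>x. x \<in> A \<Longrightarrow> rational_at_zero (f x)) \<Longrightarrow> rational_at_zero (\<lambda>a. \<Prod>x\<in>A. f x a)"
  by (induction A rule: finite_induct) (auto intro: rational_const rational_mult)

lemma rational_diff:
  assumes "rational_at_zero f" "rational_at_zero g"
  shows "rational_at_zero (\<lambda>a. f a - g a)"
  using rational_add[OF assms(1) rational_mult[OF rational_const[of "- 1"] assms(2)]] by simp

lemma rational_compose:
  assumes "polynomial_coord_fun f" "\<And>p. rational_at_zero (\<lambda>a. c a p)"
  shows "rational_at_zero (\<lambda>a. f (c a))"
  using assms(1) by induction (auto intro: rational_const rational_add rational_mult assms(2))

text \<open>Doolittle's algorithm: the entries of both factors of the LU decomposition in one array.\<close>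

function lu :: "(nat \<Rightarrow> nat \<Rightarrow> complex) \<Rightarrow> nat \<Rightarrow> nat \<Rightarrow> complex" where
  "lu H i j =
    (if i \<le> j then H i j - (\<Sum>k<i. lu H i k * lu H k j)
     else (H i j - (\<Sum>k<j. lu H i k * lu H k j)) / lu H j j)"
  by pat_completeness auto
termination by (relation "measure (\<lambda>(H, i, j). i + j)") auto

declare lu.simps [simp del]

lemma lu_decomposition:
  assumes nz: "\<And>j. j < n \<Longrightarrow> lu H j j \<noteq> 0"
  defines "\<gamma> \<equiv> \<lambda>(i, j). if j < i \<and> i < n then lu H i j else 0"
  shows "\<exists>U \<in> borel_subgroup n. mat n n (\<lambda>(i, j). H i j) = lower_unipotent n \<gamma> * U"
proof
  let ?U = "mat n n (\<lambda>(i, j). if i \<le> j then lu H i j else 0)"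
  show "?U \<in> borel_subgroup n"
  proof (rule borel_I)
    show "upper_triangular ?U" by (rule upper_triangularI) auto
  qed (use nz in auto)
  show "mat n n (\<lambda>(i, j). H i j) = lower_unipotent n \<gamma> * ?U"
  proof (rule eq_matI)
    fix i j assume "i < dim_row (lower_unipotent n \<gamma> * ?U)" "j < dim_col (lower_unipotent n \<gamma> * ?U)"
    then have ij: "i < n" "j < n" by auto
    let ?t = "\<lambda>l. lower_unipotent n \<gamma> $$ (i, l) * ?U $$ (l, j)"
    have e: "(lower_unipotent n \<gamma> * ?U) $$ (i, j) = (\<Sum>l<n. ?t l)"
      by (rule mult_mat_entry) (use ij in auto)
    have t: "?t l = (if l < i then lu H i l else if l = i then 1 else 0) * (if l \<le> j then lu H l j else 0)" if "l < n" for l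
      using that ij by (auto simp: lower_unipotent_def \<gamma>_def)
    have "(\<Sum>l<n. ?t l) = H i j"
    proof (cases "i \<le> j")
      case True
      have "?t l = 0" if "l \<in> {..<n} - {..<Suc i}" for l using t[of l] that by auto
      then have "(\<Sum>l<n. ?t l) = (\<Sum>l<Suc i. ?t l)"
        using ij by (intro sum.mono_neutral_right) auto
      also have "\<dots> = (\<Sum>l<i. lu H i l * lu H l j) + lu H i j"
      proof -
        have "(\<Sum>l<i. ?t l) = (\<Sum>l<i. lu H i l * lu H l j)"
          by (rule sum.cong[OF refl], subst t) (use True ij in auto)
        moreover have "?t i = lu H i j" by (subst t) (use True ij in auto)
        ultimately show ?thesis unfolding sum.lessThan_Suc by simp
      qed
      finally show ?thesis using True by (simp add: lu.simps[of H i j])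
    next
      case False
      have "?t l = 0" if "l \<in> {..<n} - {..<Suc j}" for l using t[of l] that by auto
      then have "(\<Sum>l<n. ?t l) = (\<Sum>l<Suc j. ?t l)"
        using ij by (intro sum.mono_neutral_right) auto
      also have "\<dots> = (\<Sum>l<j. lu H i l * lu H l j) + lu H i j * lu H j j"
      proof -
        have "(\<Sum>l<j. ?t l) = (\<Sum>l<j. lu H i l * lu H l j)"
          by (rule sum.cong[OF refl], subst t) (use False ij in auto)
        moreover have "?t j = lu H i j * lu H j j" by (subst t) (use False ij in auto)
        ultimately show ?thesis unfolding sum.lessThan_Suc by simp
      qed
      also have "lu H i j * lu H j j = H i j - (\<Sum>k<j. lu H i k * lu H k j)"
        using False nz[OF ij(2)] by (simp add: lu.simps[of H i j])
      finally show ?thesis by simp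
    qed
    then show "mat n n (\<lambda>(i, j). H i j) $$ (i, j) = (lower_unipotent n \<gamma> * ?U) $$ (i, j)" using e ij by simp
  qed auto
qed

lemma lu_rational:
  assumes "\<And>i j. i < n \<Longrightarrow> j < n \<Longrightarrow> polynomial_coord_fun (\<lambda>a. H a i j)"
    and "\<And>i j. i < n \<Longrightarrow> j < n \<Longrightarrow> H 0 i j = (if i = j then 1 else 0)"
    and "i < n" "j < n"
  shows "rational_at_zero (\<lambda>a. lu (H a) i j) \<and> lu (H 0) i j = (if i = j then 1 else 0)"
  using assms(3,4)
proof (induction "i + j" arbitrary: i j rule: less_induct)
  case less
  have IH: "rational_at_zero (\<lambda>a. lu (H a) k l)" "lu (H 0) k l = (if k = l then 1 else 0)"
    if "k + l < i + j" "k < n" "l < n" for k l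
    using less.hyps[OF that] by auto
  show ?case
  proof (cases "i \<le> j")
    case True
    have "rational_at_zero (\<lambda>a. H a i j - (\<Sum>k<i. lu (H a) i k * lu (H a) k j))"
      by (intro rational_diff rational_sum rational_mult rational_of_polynomial assms(1) IH(1))
         (use True less.prems in auto)
    moreover have "(\<Sum>k<i. lu (H 0) i k * lu (H 0) k j) = 0"
      by (intro sum.neutral ballI) (use IH(2) True less.prems in auto)
    ultimately show ?thesis using True assms(2) less.prems by (simp add: lu.simps[of _ i j])
  next
    case False
    have d: "lu (H 0) j j = 1" "rational_at_zero (\<lambda>a. lu (H a) j j)" using IH[of j j] False less.prems by auto
    have "rational_at_zero (\<lambda>a. (H a i j - (\<Sum>k<j. lu (H a) i k * lu (H a) k j)) * inverse (lu (H a) j j))"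
      by (intro rational_diff rational_sum rational_mult rational_of_polynomial rational_inverse assms(1) IH(1) d(2))
         (use False less.prems d in auto)
    moreover have "(\<Sum>k<j. lu (H 0) i k * lu (H 0) k j) = 0"
      by (intro sum.neutral ballI) (use IH(2) False less.prems in auto)
    ultimately show ?thesis using False assms(2) less.prems by (simp add: lu.simps[of _ i j] divide_inverse)
  qed
qed

text \<open>At the identity each product subtracted in the recursion has two vanishing factors,
  hence derivative 0, and the pivots are 1. To first order the LU decomposition is therefore the
  additive splitting of the matrix.\<close>

lemma lu_derivative:
  fixes H :: "complex \<Rightarrow> nat \<Rightarrow> nat \<Rightarrow> complex"
  assumes "\<And>i j. i < n \<Longrightarrow> j < n \<Longrightarrow> ((\<lambda>s. H s i j) has_field_derivative h i j) (at 0)"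
    and "\<And>i j. i < n \<Longrightarrow> j < n \<Longrightarrow> H 0 i j = (if i = j then 1 else 0)"
    and "i < n" "j < n"
  shows "((\<lambda>s. lu (H s) i j) has_field_derivative h i j) (at 0) \<and> lu (H 0) i j = (if i = j then 1 else 0)"
  using assms(3,4)
proof (induction "i + j" arbitrary: i j rule: less_induct)
  case less
  have IH: "((\<lambda>s. lu (H s) k l) has_field_derivative h k l) (at 0)" "lu (H 0) k l = (if k = l then 1 else 0)"
    if "k + l < i + j" "k < n" "l < n" for k l
    using less.hyps[OF that] by auto
  have sum: "((\<lambda>s. H s i j - (\<Sum>k<m. lu (H s) i k * lu (H s) k j)) has_field_derivative h i j) (at 0)"
    "(\<Sum>k<m. lu (H 0) i k * lu (H 0) k j) = 0" if m: "m \<le> i" "m \<le> j" for m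
  proof -
    have "((\<lambda>s. lu (H s) i k * lu (H s) k j) has_field_derivative 0) (at 0)" if "k < m" for k
      using DERIV_mult[OF IH(1)[of i k] IH(1)[of k j]] IH(2)[of i k] IH(2)[of k j] that m less.prems by simp
    then have "((\<lambda>s. \<Sum>k<m. lu (H s) i k * lu (H s) k j) has_field_derivative (\<Sum>k<m. 0)) (at 0)"
      by (intro DERIV_sum) auto
    then show "((\<lambda>s. H s i j - (\<Sum>k<m. lu (H s) i k * lu (H s) k j)) has_field_derivative h i j) (at 0)"
      using DERIV_diff[OF assms(1)[OF less.prems]] by fastforce
    show "(\<Sum>k<m. lu (H 0) i k * lu (H 0) k j) = 0"
      by (intro sum.neutral ballI) (use IH(2) m less.prems in auto)
  qed
  show ?case
  proof (cases "i \<le> j")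
    case True
    then show ?thesis using sum[of i] assms(2)[OF less.prems] by (simp add: lu.simps[of _ i j])
  next
    case False
    have d: "lu (H 0) j j = 1" "((\<lambda>s. lu (H s) j j) has_field_derivative h j j) (at 0)"
      using IH[of j j] False less.prems by auto
    have "((\<lambda>s. (H s i j - (\<Sum>k<j. lu (H s) i k * lu (H s) k j)) / lu (H s) j j) has_field_derivative h i j) (at 0)"
      using DERIV_divide[OF sum(1)[of j] d(2)] sum(2)[of j] d(1) False assms(2)[OF less.prems] by simp
    then show ?thesis using False sum(2)[of j] assms(2)[OF less.prems] by (simp add: lu.simps[of _ i j])
  qed
qed

section \<open>The differential of a change of frame\<close>

definition strict_lower :: "nat \<Rightarrow> coords \<Rightarrow> complex mat" where
  "strict_lower n V = mat n n (\<lambda>(i, j). if j < i then V (i, j) else 0)"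

text \<open>With h the inverse of b, this is the differential at the origin of the transition from
  the chart at g to the chart at \<open>g * b\<close>: conjugation followed by projection to the
  strictly lower triangular part.\<close>

definition frame_change :: "nat \<Rightarrow> complex mat \<Rightarrow> complex mat \<Rightarrow> coords \<Rightarrow> coords" where
  "frame_change n h b V = (\<lambda>(i, j). if j < i \<and> i < n then (h * strict_lower n V * b) $$ (i, j) else 0)"

lemma mult3_entry:
  assumes "h \<in> carrier_mat n n" "A \<in> carrier_mat n n" "b \<in> carrier_mat n n" "i < n" "j < n"
  shows "(h * A * b) $$ (i, j) = (\<Sum>l<n. \<Sum>m<n. h $$ (i, m) * A $$ (m, l) * b $$ (l, j))"
proof -
  have "(h * A * b) $$ (i, j) = (\<Sum>l<n. (h * A) $$ (i, l) * b $$ (l, j))"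
    by (rule mult_mat_entry) (use assms in auto)
  also have "\<dots> = (\<Sum>l<n. \<Sum>m<n. h $$ (i, m) * A $$ (m, l) * b $$ (l, j))"
    by (rule sum.cong[OF refl]) (use mult_mat_entry[OF assms(1,2,4)] in \<open>simp add: sum_distrib_right\<close>)
  finally show ?thesis .
qed

lemma strict_lower_carrier [simp]: "strict_lower n V \<in> carrier_mat n n"
  by (simp add: strict_lower_def)

lemma strict_lower_dim [simp]: "dim_row (strict_lower n V) = n" "dim_col (strict_lower n V) = n"
  by (simp_all add: strict_lower_def)

lemma strict_lower_entry: "i < n \<Longrightarrow> j < n \<Longrightarrow> strict_lower n V $$ (i, j) = (if j < i then V (i, j) else 0)"
  by (simp add: strict_lower_def)

lemma linear_frame_change:
  assumes "h \<in> carrier_mat n n" "b \<in> carrier_mat n n"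
  shows "Vector_Spaces.linear coord_scale coord_scale (frame_change n h b)"
proof (rule linear_coordsI)
  note e = mult3_entry[OF assms(1) strict_lower_carrier assms(2)]
  show "frame_change n h b (v + w) = frame_change n h b v + frame_change n h b w" for v w
  proof (intro ext)
    fix p :: "nat \<times> nat"
    obtain i j where p: "p = (i, j)" by (cases p)
    show "frame_change n h b (v + w) p = (frame_change n h b v + frame_change n h b w) p"
    proof (cases "j < i \<and> i < n")
      case True
      then have "i < n" "j < n" by auto
      then show ?thesis using True unfolding p frame_change_def plus_fun_apply
        by (simp add: e sum.distrib[symmetric]) (intro sum.cong refl, simp add: strict_lower_entry algebra_simps)
    qed (auto simp: p frame_change_def)
  qed
  show "frame_change n h b (coord_scale c v) = coord_scale c (frame_change n h b v)" for c v
  proof (intro ext)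
    fix p :: "nat \<times> nat"
    obtain i j where p: "p = (i, j)" by (cases p)
    show "frame_change n h b (coord_scale c v) p = coord_scale c (frame_change n h b v) p"
    proof (cases "j < i \<and> i < n")
      case True
      then have "i < n" "j < n" by auto
      then show ?thesis using True unfolding p frame_change_def coord_scale_def
        by (simp add: e sum_distrib_left) (intro sum.cong refl, simp add: strict_lower_entry algebra_simps)
    qed (auto simp: p frame_change_def coord_scale_def)
  qed
qed

text \<open>If the conjugate of V has no strictly lower part, it is upper triangular; conjugating
  back, V is both upper and strictly lower triangular.\<close>

lemma frame_change_injective:
  assumes b: "b \<in> borel_subgroup n" "h \<in> borel_subgroup n" "b * h = 1\<^sub>m n"
    and V: "V \<in> affine_space n" "frame_change n h b V = 0"
  shows "V = 0"
proof -
  let ?N = "strict_lower n V"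
  note c = borel_carrier[OF b(1)] borel_carrier[OF b(2)]
  have "(h * ?N * b) $$ (i, j) = 0" if "j < i" "i < n" for i j
    using fun_cong[OF V(2), of "(i, j)"] that by (simp add: frame_change_def)
  then have up: "upper_triangular (h * ?N * b)" by (intro upper_triangularI) (use c in auto)
  have ub: "upper_triangular b" "upper_triangular h" using b by (auto simp: borel_subgroup_def)
  have "h * ?N * b \<in> carrier_mat n n" using c by (simp add: mult_carrier_mat[of _ n n _ n])
  then have "upper_triangular (b * (h * ?N * b) * h)"
    using upper_triangular_mult[of "b * (h * ?N * b)" n h] upper_triangular_mult[of b n "h * ?N * b"] c up ub
    by (simp add: mult_carrier_mat[of _ n n _ n])
  also have "b * (h * ?N * b) * h = (b * h) * ?N * (b * h)"
    using c by (simp add: assoc_mult_mat[of _ n n _ n _ n] mult_carrier_mat[of _ n n _ n])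
  also have "\<dots> = ?N" using b(3) by simp
  finally have "upper_triangular ?N" .
  show "V = 0"
  proof
    fix p :: "nat \<times> nat"
    obtain i j where p: "p = (i, j)" by (cases p)
    show "V p = 0 p"
    proof (cases "j < i \<and> i < n")
      case True
      then have "?N $$ (i, j) = 0" using upper_triangularD[OF \<open>upper_triangular ?N\<close>, of j i] by (simp add: strict_lower_def)
      then show ?thesis using True by (simp add: p strict_lower_def)
    qed (use V(1) in \<open>simp add: p affine_space_def\<close>)
  qed
qed

text \<open>Writing \<open>h * u(a) * b\<close> as \<open>u(\<gamma> a)\<close> times an upper
  triangular matrix expresses the transition of charts by \<gamma>, which is rational. A polynomial
  f vanishing on Z in the new chart pulls back to P/Q; the numerator times a suitable denominator
  vanishes on Z in the old chart, so V annihilates it.\<close>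

lemma frame_change_tangent:
  assumes g: "g \<in> GL n" and b: "b \<in> borel_subgroup n" "h \<in> borel_subgroup n" "b * h = 1\<^sub>m n" "h * b = 1\<^sub>m n"
    and mem: "flag_of n g \<in> Z" and V: "V \<in> tangent_space n Z g"
  shows "frame_change n h b V \<in> tangent_space n Z (g * b)"
  unfolding tangent_space_def
proof (intro CollectI conjI allI impI)
  show "frame_change n h b V \<in> affine_space n" by (auto simp: frame_change_def affine_space_def)
  fix f assume "polynomial_coord_fun f \<and> (\<forall>a\<in>chart_part n (g * b) Z. f a = 0)"
  then have f: "polynomial_coord_fun f" "\<And>a. a \<in> chart_part n (g * b) Z \<Longrightarrow> f a = 0" by auto
  note c = borel_carrier[OF b(1)] borel_carrier[OF b(2)] GL_carrier[OF g]
  have VA: "V \<in> affine_space n" using V by (simp add: tangent_space_def)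
  define H where "H a i j = (h * lower_unipotent n a * b) $$ (i, j)" for a i j
  have H_eq: "H a i j = (\<Sum>l<n. \<Sum>m<n. h $$ (i, m) * lower_unipotent n a $$ (m, l) * b $$ (l, j))" if "i < n" "j < n" for a i j
    unfolding H_def by (rule mult3_entry[OF c(2) lower_unipotent_carrier c(1) that])
  have H_poly: "polynomial_coord_fun (\<lambda>a. H a i j)" if "i < n" "j < n" for i j
    unfolding H_eq[OF that]
    by (intro polynomial_sum polynomial_coord_fun.mult polynomial_coord_fun.const polynomial_lower_unipotent_entry) auto
  have H_zero: "H 0 i j = (if i = j then 1 else 0)" if "i < n" "j < n" for i j
    unfolding H_def lower_unipotent_zero using c b(4) that by simp
  have H_line: "H (coord_scale s V) i j = (if i = j then 1 else 0) + s * (h * strict_lower n V * b) $$ (i, j)"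
    if "i < n" "j < n" for s i j
  proof -
    have lu: "lower_unipotent n (coord_scale s V) $$ (m, l) = 1\<^sub>m n $$ (m, l) + s * strict_lower n V $$ (m, l)"
      if "m < n" "l < n" for m l
      using that by (auto simp: lower_unipotent_def strict_lower_def coord_scale_def)
    have "H (coord_scale s V) i j = (\<Sum>l<n. \<Sum>m<n. h $$ (i, m) * 1\<^sub>m n $$ (m, l) * b $$ (l, j)
        + s * (h $$ (i, m) * strict_lower n V $$ (m, l) * b $$ (l, j)))"
      unfolding H_eq[OF that] by (intro sum.cong refl) (use lu in \<open>simp add: algebra_simps\<close>)
    also have "\<dots> = (h * 1\<^sub>m n * b) $$ (i, j) + s * (h * strict_lower n V * b) $$ (i, j)"
      using mult3_entry[OF c(2) one_carrier_mat c(1) that] mult3_entry[OF c(2) strict_lower_carrier c(1) that]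
      by (simp add: sum.distrib sum_distrib_left)
    finally show ?thesis using c b(4) that by simp
  qed
  define \<gamma> where "\<gamma> a = (\<lambda>(i, j). if j < i \<and> i < n then lu (H a) i j else 0)" for a
  have \<gamma>_affine: "\<gamma> a \<in> affine_space n" for a by (auto simp: \<gamma>_def affine_space_def)
  note lur = lu_rational[of n H, OF H_poly H_zero]
  have \<gamma>_rat: "rational_at_zero (\<lambda>a. \<gamma> a p)" for p
  proof (cases p)
    case (Pair i j)
    show ?thesis
    proof (cases "j < i \<and> i < n")
      case True
      then show ?thesis using lur[of i j] by (simp add: Pair \<gamma>_def)
    next
      case False
      then have "\<gamma> a p = 0" for a by (auto simp: Pair \<gamma>_def)
      then show ?thesis using rational_const[of 0] by simp
    qed
  qed
  have \<gamma>_zero: "\<gamma> 0 = 0"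
  proof
    fix p :: "nat \<times> nat" show "\<gamma> 0 p = 0 p"
      using lur by (cases p) (auto simp: \<gamma>_def)
  qed
  obtain P Q where PQ: "polynomial_coord_fun P" "polynomial_coord_fun Q" "Q 0 \<noteq> 0" "\<And>a. Q a \<noteq> 0 \<Longrightarrow> f (\<gamma> a) = P a / Q a"
  proof -
    define F where "F = (\<lambda>a. f (\<gamma> a))"
    have "rational_at_zero F" unfolding F_def by (rule rational_compose[OF f(1) \<gamma>_rat])
    then obtain P Q where "polynomial_coord_fun P" "polynomial_coord_fun Q" "Q 0 \<noteq> 0" "\<And>a. Q a \<noteq> 0 \<Longrightarrow> F a = P a / Q a"
      unfolding rational_at_zero_def by blast
    then show thesis using that[of P Q] by (simp add: F_def)
  qed
  have "rational_at_zero (\<lambda>a. \<Prod>j<n. lu (H a) j j)" by (intro rational_prod) (use lur in auto)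
  then obtain PR QR where R: "polynomial_coord_fun PR" "polynomial_coord_fun QR" "QR 0 \<noteq> 0"
    "\<And>a. QR a \<noteq> 0 \<Longrightarrow> (\<Prod>j<n. lu (H a) j j) = PR a / QR a"
  proof -
    define F where "F = (\<lambda>a. \<Prod>j<n. lu (H a) j j)"
    assume "rational_at_zero (\<lambda>a. \<Prod>j<n. lu (H a) j j)"
    then have "rational_at_zero F" unfolding F_def .
    then obtain P Q where "polynomial_coord_fun P" "polynomial_coord_fun Q" "Q 0 \<noteq> 0" "\<And>a. Q a \<noteq> 0 \<Longrightarrow> F a = P a / Q a"
      unfolding rational_at_zero_def by blast
    then show thesis using that[of P Q] by (simp add: F_def)
  qed
  have "(\<Prod>j<n. lu (H 0) j j) = 1" by (intro prod.neutral) (use lur in auto)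
  then have PR0: "PR 0 \<noteq> 0" using R(3) R(4)[OF R(3)] by auto
  \<comment> \<open>K collects the denominators: where it is nonzero, all pivots are nonzero, so the
    decomposition exists, and the pullback of f is P/Q.\<close>
  let ?K = "\<lambda>a. PR a * QR a * Q a"
  have vanish: "?K a * P a = 0" if a: "a \<in> chart_part n g Z" for a
  proof (cases "?K a = 0")
    case False
    then have "PR a \<noteq> 0" "QR a \<noteq> 0" "Q a \<noteq> 0" by auto
    then have "(\<Prod>j<n. lu (H a) j j) \<noteq> 0" using R(4) by simp
    then have "lu (H a) j j \<noteq> 0" if "j < n" for j using that by simp
    from lu_decomposition[of n "H a", OF this] obtain U where
      U: "U \<in> borel_subgroup n" "mat n n (\<lambda>(i, j). H a i j) = lower_unipotent n (\<gamma> a) * U"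
      unfolding \<gamma>_def by blast
    have "mat n n (\<lambda>(i, j). H a i j) = h * lower_unipotent n a * b"
      by (rule eq_matI) (use c in \<open>auto simp: H_def\<close>)
    then have hu: "h * lower_unipotent n a * b = lower_unipotent n (\<gamma> a) * U" using U(2) by simp
    have "g * lower_unipotent n a * b = g * (b * h) * (lower_unipotent n a * b)"
      using c b(3) by (simp add: assoc_mult_mat[of _ n n _ n _ n] mult_carrier_mat[of _ n n _ n])
    also have "\<dots> = g * b * (h * lower_unipotent n a * b)"
      using c by (simp add: assoc_mult_mat[of _ n n _ n _ n] mult_carrier_mat[of _ n n _ n])
    also have "\<dots> = g * b * lower_unipotent n (\<gamma> a) * U"
      unfolding hu using c borel_carrier[OF U(1)]
      by (simp add: assoc_mult_mat[of _ n n _ n _ n] mult_carrier_mat[of _ n n _ n])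
    finally have "flag_of n (g * lower_unipotent n a * b) = flag_of n (g * b * lower_unipotent n (\<gamma> a) * U)" by simp
    then have "chart n (g * b) (\<gamma> a) = chart n g a"
      unfolding chart_def using c
      by (simp add: flag_of_mult_borel[OF _ b(1)] flag_of_mult_borel[OF _ U(1)] mult_carrier_mat[of _ n n _ n])
    then have "\<gamma> a \<in> chart_part n (g * b) Z" using a \<gamma>_affine by (simp add: chart_part_def)
    then have "P a / Q a = 0" using f(2) PQ(4) \<open>Q a \<noteq> 0\<close> by metis
    then show ?thesis using \<open>Q a \<noteq> 0\<close> by simp
  qed simp
  have "polynomial_coord_fun (\<lambda>a. ?K a * P a)" by (intro polynomial_coord_fun.mult R PQ)
  then have dK: "((\<lambda>s. ?K (coord_scale s V) * P (coord_scale s V)) has_field_derivative 0) (at 0)"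
    using V vanish unfolding tangent_space_def by blast
  have der: "\<exists>D. ((\<lambda>s. F (coord_scale s V)) has_field_derivative D) (at 0)" if F: "polynomial_coord_fun F" for F
  proof -
    obtain D where "\<And>a v. ((\<lambda>s. F (\<lambda>p. a p + s * v p)) has_field_derivative D a v) (at 0)"
      using polynomial_directional_derivative[OF F] by blast
    from this[of 0 V] show ?thesis by (auto simp: coord_scale_def)
  qed
  have s0: "coord_scale 0 v = 0" for v by (auto simp: coord_scale_def fun_eq_iff)
  \<comment> \<open>The centre lies in Z, so P vanishes at 0, and the derivative of
    \<open>K * P\<close> there is K(0) times that of P with K(0) \<noteq> 0.\<close>
  have "flag_of n (g * b) \<in> Z" using mem flag_of_mult_borel[OF c(3) b(1)] by simp
  then have "f 0 = 0" using f(2) zero_in_chart_part[OF GL_mult[OF g borel_GL[OF b(1)]]] by simp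
  then have P0: "P 0 = 0" using PQ(3) PQ(4)[OF PQ(3)] \<gamma>_zero by simp
  obtain DP where DP: "((\<lambda>s. P (coord_scale s V)) has_field_derivative DP) (at 0)" using der[OF PQ(1)] by blast
  obtain DQ where DQ: "((\<lambda>s. Q (coord_scale s V)) has_field_derivative DQ) (at 0)" using der[OF PQ(2)] by blast
  obtain DK where DK: "((\<lambda>s. ?K (coord_scale s V)) has_field_derivative DK) (at 0)"
    using der[of ?K] polynomial_coord_fun.mult R PQ by blast
  have "DP * ?K 0 = 0" using DERIV_unique[OF DERIV_mult[OF DK DP] dK] P0 by (simp add: s0)
  then have DP0: "DP = 0" using PR0 R(3) PQ(3) by simp
  have quot: "((\<lambda>s. P (coord_scale s V) / Q (coord_scale s V)) has_field_derivative 0) (at 0)"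
    using DERIV_divide[OF DP DQ] P0 DP0 PQ(3) by (simp add: s0)
  have "isCont (\<lambda>s. Q (coord_scale s V)) 0" by (rule DERIV_isCont[OF DQ])
  then have "\<forall>\<^sub>F s in nhds 0. Q (coord_scale s V) \<noteq> 0"
  proof -
    assume cont: "isCont (\<lambda>s. Q (coord_scale s V)) 0"
    have "\<forall>\<^sub>F s in at 0. Q (coord_scale s V) \<noteq> 0"
      by (rule tendsto_imp_eventually_ne[OF cont[unfolded isCont_def]]) (use PQ(3) in \<open>simp add: s0\<close>)
    then show ?thesis unfolding eventually_nhds_conv_at using PQ(3) by (simp add: s0)
  qed
  \<comment> \<open>The identity with P/Q holds in a neighbourhood of 0, which suffices for
    derivatives.\<close>
  then have ev: "\<forall>\<^sub>F s in nhds 0. f (\<gamma> (coord_scale s V)) = P (coord_scale s V) / Q (coord_scale s V)"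
    by eventually_elim (rule PQ(4))
  have df: "((\<lambda>s. f (\<gamma> (coord_scale s V))) has_field_derivative 0) (at 0)"
    by (rule iffD2[OF DERIV_cong_ev[OF refl ev refl] quot])
  let ?d = "frame_change n h b V"
  \<comment> \<open>The curve \<gamma>(sV) and the straight line in direction
    \<open>frame_change n h b V\<close> have the same position and velocity at 0.\<close>
  have "\<exists>D. ((\<lambda>s. f (\<gamma> (coord_scale s V))) has_field_derivative D) (at 0) \<and>
      ((\<lambda>s. f (coord_scale s ?d)) has_field_derivative D) (at 0)"
  proof (rule polynomial_curves[OF f(1)])
    show "\<gamma> (coord_scale 0 V) p = coord_scale 0 ?d p" for p by (simp add: s0 \<gamma>_zero)
    show "((\<lambda>s. coord_scale s ?d p) has_field_derivative ?d p) (at 0)" for p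
      unfolding coord_scale_def by (auto intro!: derivative_eq_intros)
    show "((\<lambda>s. \<gamma> (coord_scale s V) p) has_field_derivative ?d p) (at 0)" for p
    proof (cases p)
      case (Pair i j)
      show ?thesis
      proof (cases "j < i \<and> i < n")
        case True
        let ?h = "\<lambda>i j. (h * strict_lower n V * b) $$ (i, j)"
        have "((\<lambda>s. lu (H (coord_scale s V)) i j) has_field_derivative ?h i j) (at 0)"
        proof (rule conjunct1[OF lu_derivative[of n "\<lambda>s. H (coord_scale s V)" ?h i j]])
          fix i j assume ij: "i < n" "j < n"
          show "((\<lambda>s. H (coord_scale s V) i j) has_field_derivative ?h i j) (at 0)"
            unfolding H_line[OF ij] by (auto intro!: derivative_eq_intros)
          show "H (coord_scale 0 V) i j = (if i = j then 1 else 0)" unfolding s0 by (rule H_zero[OF ij])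
        qed (use True in auto)
        then show ?thesis using True by (simp add: Pair \<gamma>_def frame_change_def)
      next
        case False
        then have "(\<lambda>s. \<gamma> (coord_scale s V) p) = (\<lambda>s. 0)" "?d p = 0"
          by (auto simp: Pair \<gamma>_def frame_change_def)
        then show ?thesis by simp
      qed
    qed
  qed
  then show "((\<lambda>s. f (coord_scale s ?d)) has_field_derivative 0) (at 0)"
    using DERIV_unique[OF _ df] by blast
qed

lemma tangent_dim_mult_borel_le:
  assumes g: "g \<in> GL n" and b: "b \<in> borel_subgroup n" and mem: "flag_of n g \<in> Z"
  shows "tangent_dim n Z g \<le> tangent_dim n Z (g * b)"
proof -
  obtain h where h: "h \<in> borel_subgroup n" "b * h = 1\<^sub>m n" "h * b = 1\<^sub>m n" using borel_inverse[OF b] by blast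
  show ?thesis
    unfolding tangent_dim_def
  proof (rule dim_le_injective[OF subspace_tangent_space tangent_space_supported finite_low])
    show "Vector_Spaces.linear coord_scale coord_scale (frame_change n h b)"
      by (rule linear_frame_change[OF borel_carrier[OF h(1)] borel_carrier[OF b]])
    show "frame_change n h b ` tangent_space n Z g \<subseteq> tangent_space n Z (g * b)"
      using frame_change_tangent[OF g b h mem] by blast
    show "V = 0" if "V \<in> tangent_space n Z g" "frame_change n h b V = 0" for V
      using frame_change_injective[OF b h(1,2) _ that(2)] that(1) by (simp add: tangent_space_def)
  qed
qed

lemma tangent_dim_mult_borel:
  assumes g: "g \<in> GL n" and b: "b \<in> borel_subgroup n" and mem: "flag_of n g \<in> Z"
  shows "tangent_dim n Z (g * b) = tangent_dim n Z g"
proof (rule antisym)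
  obtain h where h: "h \<in> borel_subgroup n" "b * h = 1\<^sub>m n" using borel_inverse[OF b] by blast
  have "g * b * h = g"
    using assoc3[OF GL_carrier[OF g] borel_carrier[OF b] borel_carrier[OF h(1)]] h(2) GL_carrier[OF g] by simp
  moreover have "flag_of n (g * b) \<in> Z" using mem flag_of_mult_borel[OF GL_carrier[OF g] b] by simp
  ultimately show "tangent_dim n Z (g * b) \<le> tangent_dim n Z g"
    using tangent_dim_mult_borel_le[OF GL_mult[OF g borel_GL[OF b]] h(1)] by simp
qed (rule tangent_dim_mult_borel_le[OF assms])

section \<open>Tangent spaces at the fixed points of the torus\<close>

text \<open>If the step up from v leaves the interval below w, there is a corner
  \<open>(p, q)\<close> where v already has the rank of w and the step exceeds it. Minors one size
  larger then vanish on the Schubert variety. The identity minor of v, bordered by row i and column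
  j, is such a minor, and its differential at 0 is the coordinate \<open>(i, j)\<close>.\<close>

lemma tangent_space_perm_bound:
  assumes w: "w permutes {1..n}" and v: "bruhat_le n v w" and ij: "j < i" "i < n" "v (Suc j) < v (Suc i)"
    and V: "V \<in> tangent_space n (schubert_variety n w) (perm_mat n v)" "V (i, j) \<noteq> 0"
  shows "bruhat_le n (v \<circ> T (Suc j) (Suc i)) w"
proof (rule ccontr)
  let ?u = "v \<circ> T (Suc j) (Suc i)"
  let ?X = "schubert_variety n w"
  assume nle: "\<not> ?thesis"
  have vp: "v permutes {1..n}" using v by (simp add: bruhat_le_def)
  have up: "?u permutes {1..n}" by (rule permutes_comp_T[OF vp]) (use ij in auto)
  obtain p q where pq: "rk w p q < rk ?u p q"
    using nle bruhat_le_iff_rk[OF up w] by (meson not_le_imp_less)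
  let ?C = "Suc j \<le> p \<and> p < Suc i \<and> v (Suc j) \<le> q \<and> q < v (Suc i)"
  have u_rk: "rk ?u p q = rk v p q + of_bool ?C"
    by (rule rk_comp_T) (use ij in auto)
  have v_rk: "rk v p q \<le> rk w p q" by (rule bruhat_le_rk_le[OF v])
  have C: ?C
  proof (rule ccontr)
    assume "\<not> ?C"
    then have "rk ?u p q = rk v p q" unfolding u_rk by (simp only: of_bool_eq add_0_right)
    then show False using pq v_rk by linarith
  qed
  then have "rk ?u p q = rk v p q + 1" unfolding u_rk by (simp only: of_bool_eq simp_thms)
  then have rk: "rk w p q = rk v p q" using pq v_rk by linarith
  have p: "j < p" "p \<le> i" and q: "v (Suc j) \<le> q" "q < v (Suc i)" using C by auto
  have pn: "p \<le> n" using p ij by simp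
  let ?K = "{k. k < p \<and> q \<le> w0 v k}"
  have v0: "w0 v j < q" "q \<le> w0 v i" using w0(1)[OF vp, of j] w0(1)[OF vp, of i] ij q by auto
  have cardK: "card ?K = rk w p q" using card_w0_eq_rk[OF vp pn, of q] rk by simp
  have "finite ?K" by simp
  then obtain e where e: "bij_betw e {..<card ?K} ?K"
    using ex_bij_betw_nat_finite by (metis atLeast0LessThan)
  have eK: "e t < p" "q \<le> w0 v (e t)" if "t < card ?K" for t
    using bij_betwE[OF e] that by auto
  have inj: "e s = e t \<longleftrightarrow> s = t" if "s < card ?K" "t < card ?K" for s t
    using bij_betw_imp_inj_on[OF e] that by (auto simp: inj_on_def)
  let ?m = "Suc (card ?K)"
  \<comment> \<open>Index 0 is the border, row i here and column j for \<open>\<kappa>\<close>; the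
    other indices enumerate the identity minor.\<close>
  define r where "r s = (case s of 0 \<Rightarrow> i | Suc s \<Rightarrow> e s)" for s
  define \<kappa> where "\<kappa> t = (case t of 0 \<Rightarrow> j | Suc t \<Rightarrow> e t)" for t
  have rn: "r s < n" "q \<le> w0 v (r s)" if "s < ?m" for s
    using that eK v0 ij pn unfolding r_def by (auto split: nat.splits intro: less_le_trans)
  have \<kappa>p: "\<kappa> t < p" if "t < ?m" for t
    using that eK p unfolding \<kappa>_def by (auto split: nat.splits)
  have \<kappa>n: "\<kappa> t < n" if "t < ?m" for t using \<kappa>p[OF that] pn by simp
  let ?f = "\<lambda>a. det (mat ?m ?m (\<lambda>(s, t). lower_unipotent n a $$ (r s, \<kappa> t)))"
  have g: "perm_mat n v \<in> GL n" by (rule perm_mat_GL[OF vp])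
  have f_poly: "polynomial_coord_fun ?f"
    by (rule polynomial_det) (rule polynomial_lower_unipotent_entry; use rn \<kappa>n in blast)
  have f_zero: "?f a = 0" if a: "a \<in> chart_part n (perm_mat n v) ?X" for a
  proof -
    let ?h = "perm_mat n v * lower_unipotent n a"
    have h: "?h \<in> GL n" by (rule chart_GL[OF g])
    have "flag_of n ?h \<in> rank_locus n p q ?m"
      using a schubert_variety_rank_locus[OF w pn, of q ?m] card_w0_eq_rk[OF w pn, of q] cardK
      by (auto simp: chart_part_def chart_def)
    then have "det (mat ?m ?m (\<lambda>(s, t). (?h *\<^sub>v unit_vec n (\<kappa> t)) $ w0 v (r s))) = 0"
      unfolding rank_locus_iff[OF h]
    proof (elim allE impE)
      show "(\<forall>t<?m. unit_vec n (\<kappa> t) \<in> std_flag n p) \<and> (\<forall>s<?m. q \<le> w0 v (r s) \<and> w0 v (r s) < n)"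
        using std_unit_vec[OF _ pn] \<kappa>p rn w0(2)[OF vp] by blast
    qed
    moreover have "mat ?m ?m (\<lambda>(s, t). (?h *\<^sub>v unit_vec n (\<kappa> t)) $ w0 v (r s)) =
        mat ?m ?m (\<lambda>(s, t). lower_unipotent n a $$ (r s, \<kappa> t))"
    proof (rule eq_matI)
      fix s t assume "s < dim_row (mat ?m ?m (\<lambda>(s, t). lower_unipotent n a $$ (r s, \<kappa> t)))"
        "t < dim_col (mat ?m ?m (\<lambda>(s, t). lower_unipotent n a $$ (r s, \<kappa> t)))"
      then have st: "s < ?m" "t < ?m" by auto
      have "(?h *\<^sub>v unit_vec n (\<kappa> t)) $ w0 v (r s) = ?h $$ (w0 v (r s), \<kappa> t)"
        by (rule mat_unit_vec_entry[OF GL_carrier[OF h] w0(2)[OF vp rn(1)[OF st(1)]] \<kappa>n[OF st(2)]])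
      also have "\<dots> = lower_unipotent n a $$ (r s, \<kappa> t)"
        by (rule perm_mat_mult_entry[OF vp lower_unipotent_carrier rn(1)[OF st(1)] \<kappa>n[OF st(2)]])
      finally show "mat ?m ?m (\<lambda>(s, t). (?h *\<^sub>v unit_vec n (\<kappa> t)) $ w0 v (r s)) $$ (s, t) =
          mat ?m ?m (\<lambda>(s, t). lower_unipotent n a $$ (r s, \<kappa> t)) $$ (s, t)" using st by simp
    qed auto
    ultimately show ?thesis by simp
  qed
  have df: "((\<lambda>s. ?f (coord_scale s V)) has_field_derivative 0) (at 0)"
    using V(1) f_poly f_zero unfolding tangent_space_def by blast
  let ?N = "\<lambda>a. mat ?m ?m (\<lambda>(s, t). if s = 0 then V (i, \<kappa> t) else lower_unipotent n a $$ (r s, \<kappa> t))"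
  have ki: "\<kappa> t < i" if "t < ?m" for t using \<kappa>p[OF that] p by simp
  \<comment> \<open>All columns chosen are smaller than i, so the border row lies strictly below the
    diagonal and is homogeneous in s. After pulling out the factor s, the derivative at 0 is the
    remaining determinant at 0.\<close>
  have fN: "?f (coord_scale s V) = s * det (?N (coord_scale s V))" for s
  proof -
    have "mat ?m ?m (\<lambda>(s', t). lower_unipotent n (coord_scale s V) $$ (r s', \<kappa> t)) = multrow 0 s (?N (coord_scale s V))"
      by (rule eq_matI) (use ki \<kappa>n ij in \<open>auto simp: r_def lower_unipotent_def coord_scale_def\<close>)
    then show ?thesis using det_multrow[of 0 ?m "?N (coord_scale s V)" s] by simp
  qed
  have N_poly: "polynomial_coord_fun (\<lambda>a. det (?N a))"
  proof (rule polynomial_det)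
    fix s t assume st: "s < ?m" "t < ?m"
    show "polynomial_coord_fun (\<lambda>a. if s = 0 then V (i, \<kappa> t) else lower_unipotent n a $$ (r s, \<kappa> t))"
      using polynomial_lower_unipotent_entry[OF rn(1)[OF st(1)] \<kappa>n[OF st(2)]]
      by (cases "s = 0") (auto intro: polynomial_coord_fun.const)
  qed
  obtain D where dN': "\<And>a v. ((\<lambda>s. det (?N (\<lambda>p. a p + s * v p))) has_field_derivative D a v) (at 0)"
    using polynomial_directional_derivative[OF N_poly] by blast
  have "(\<lambda>p. (0 :: coords) p + s * V p) = coord_scale s V" for s by (auto simp: coord_scale_def)
  then have dN: "((\<lambda>s. det (?N (coord_scale s V))) has_field_derivative D 0 V) (at 0)"
    using dN'[of 0 V] by (simp only:)
  have "((\<lambda>s. s * det (?N (coord_scale s V))) has_field_derivative 1 * det (?N (coord_scale 0 V)) + D 0 V * 0) (at 0)"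
    by (rule DERIV_mult[OF DERIV_ident dN])
  then have "det (?N (coord_scale 0 V)) = 0" using DERIV_unique[OF df] unfolding fN by fastforce
  moreover have "det (?N (coord_scale 0 V)) = V (i, j)"
  proof -
    let ?M = "?N (coord_scale 0 V)"
    have z: "lower_unipotent n (coord_scale 0 V) $$ (a, b) = (if a = b then 1 else 0)" if "a < n" "b < n" for a b
      using that by (auto simp: lower_unipotent_def coord_scale_def)
    have ejn: "e s \<noteq> j" if "s < card ?K" for s using eK[OF that] v0 by auto
    have ent: "?M $$ (Suc s, t) = (if t = Suc s then 1 else 0)" if "s < card ?K" "t < ?m" for s t
      using that z[of "e s" "\<kappa> t"] eK[of s] pn \<kappa>n[of t] inj ejn
      by (cases t) (auto simp: r_def \<kappa>_def)
    \<comment> \<open>At 0 all rows but the border are unit vectors, so only the diagonal entry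
      \<open>V (i, j)\<close> matters.\<close>
    have "upper_triangular ?M"
    proof (rule upper_triangularI)
      fix a b assume ab: "b < a" "a < dim_row ?M"
      then obtain s where "a = Suc s" by (cases a) auto
      then show "?M $$ (a, b) = 0" using ent[of s b] ab by auto
    qed
    then have "det ?M = prod_list (diag_mat ?M)" by (rule det_upper_triangular[where n = ?m]) (rule mat_carrier)
    also have "diag_mat ?M = V (i, j) # replicate (card ?K) 1"
    proof (rule nth_equalityI)
      fix a assume "a < length (diag_mat ?M)"
      then have a: "a < ?m" by (simp add: diag_mat_def)
      show "diag_mat ?M ! a = (V (i, j) # replicate (card ?K) 1) ! a"
        using a ent[of "a - 1" a] by (cases a) (auto simp: diag_mat_def \<kappa>_def simp del: upt_Suc)
    qed (simp add: diag_mat_def)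
    finally show ?thesis by simp
  qed
  ultimately show False using V(2) by simp
qed

section \<open>Tangent dimensions on Bruhat cells\<close>

lemma bruhat_le_id:
  assumes "v permutes {1..n}"
  shows "bruhat_le n id v"
  by (rule bruhat_le_if_rk_le[OF permutes_id assms]) (use rk_ge[OF assms] in \<open>simp add: rk_id\<close>)

definition fixed_point_dim :: "nat \<Rightarrow> perm \<Rightarrow> perm \<Rightarrow> nat" where
  "fixed_point_dim n w v = tangent_dim n (schubert_variety n w) (perm_mat n v)"

text \<open>Left multiplication by the Borel subgroup preserves the variety and does not change its
  equations in the charts; right multiplication only changes the frame.\<close>

lemma tangent_dim_cell:
  assumes w: "w permutes {1..n}" and v: "bruhat_le n v w" and g: "g \<in> bruhat_cell n v"
  shows "tangent_dim n (schubert_variety n w) g = fixed_point_dim n w v"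
proof -
  let ?X = "schubert_variety n w"
  have vp: "v permutes {1..n}" using v by (simp add: bruhat_le_def)
  obtain b b' where b: "b \<in> borel_subgroup n" "b' \<in> borel_subgroup n" "g = b * perm_mat n v * b'"
    using g by (auto simp: bruhat_cell_def)
  have P: "perm_mat n v \<in> GL n" by (rule perm_mat_GL[OF vp])
  have bP: "b * perm_mat n v \<in> GL n" by (rule GL_mult[OF borel_GL[OF b(1)] P])
  have mem: "flag_of n (perm_mat n v) \<in> ?X" by (rule bruhat_cell_in_schubert_variety[OF v perm_mat_in_cell])
  have "tangent_dim n ?X g = tangent_dim n ?X (b * perm_mat n v)"
    unfolding b(3) by (rule tangent_dim_mult_borel[OF bP b(2) schubert_variety_borel[OF w b(1) P mem]])
  also have "chart_part n (b * perm_mat n v) ?X = chart_part n (perm_mat n v) ?X"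
  proof -
    have "chart n (b * perm_mat n v) a \<in> ?X \<longleftrightarrow> chart n (perm_mat n v) a \<in> ?X" for a
      using schubert_variety_borel_iff[OF w b(1) chart_GL[OF P, of a]]
      unfolding chart_def assoc3[OF borel_carrier[OF b(1)] perm_mat_carrier lower_unipotent_carrier] .
    then show ?thesis by (simp add: chart_part_def)
  qed
  then have "tangent_dim n ?X (b * perm_mat n v) = fixed_point_dim n w v"
    by (simp add: tangent_dim_def tangent_space_def fixed_point_dim_def)
  finally show ?thesis .
qed

text \<open>For a Bruhat step from x to y, the line of lower elementary matrices at x lies in the
  cell of y except at 0, so semicontinuity along this line applies.\<close>

lemma fixed_point_dim_antimono:
  assumes w: "w permutes {1..n}" and le: "bruhat_le n u v" "bruhat_le n v w"
  shows "fixed_point_dim n w v \<le> fixed_point_dim n w u"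
proof -
  have "(bruhat_step n)\<^sup>*\<^sup>* u v" using le(1) by (simp add: bruhat_le_def)
  then show ?thesis
  proof (induction rule: converse_rtranclp_induct)
    case (step x y)
    then obtain a b where ab: "x permutes {1..n}" "1 \<le> a" "a < b" "b \<le> n" "y = x \<circ> T a b" "x a < x b"
      by (auto simp: bruhat_step_iff)
    have yv: "bruhat_le n y v"
      using step(2) le(1) bruhat_step_permutes[OF step(1)] by (simp add: bruhat_le_def)
    have yw: "bruhat_le n y w" using bruhat_le_trans[OF yv le(2)] .
    have S: "Suc (a - 1) = a" "Suc (b - 1) = b" using ab by auto
    have ij: "a - 1 < b - 1" "b - 1 < n" using ab by auto
    have "fixed_point_dim n w y \<le> tangent_dim n (schubert_variety n w) (perm_mat n x)"
    proof (rule tangent_dim_line_le[OF perm_mat_GL[OF ab(1)] ij])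
      fix c :: complex assume c: "c \<noteq> 0"
      have "perm_mat n x * addrow_mat n c (b - 1) (a - 1) \<in> bruhat_cell n y"
        using addrow_ascent_cell[OF ab(1) ij _ c] unfolding S ab(5) using ab(6) by blast
      from tangent_dim_cell[OF w yw this]
      show "fixed_point_dim n w y \<le> tangent_dim n (schubert_variety n w) (perm_mat n x * addrow_mat n c (b - 1) (a - 1))"
        by simp
    qed
    then show ?case using step.IH by (simp add: fixed_point_dim_def)
  qed simp
qed

text \<open>The whole coordinate line lies in the Schubert variety: for an inversion it stays in the
  cell of v, for an ascent it runs in the cell of \<open>v \<circ> T (Suc j) (Suc i)\<close> away
  from 0.\<close>

lemma inversion_tangent:
  assumes w: "w permutes {1..n}" and v: "bruhat_le n v w" and ij: "j < i" "i < n"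
    and h: "v (Suc i) < v (Suc j) \<or> (v (Suc j) < v (Suc i) \<and> bruhat_le n (v \<circ> T (Suc j) (Suc i)) w)"
  shows "unit_coord (i, j) \<in> tangent_space n (schubert_variety n w) (perm_mat n v)"
proof (rule line_in_tangent_space)
  have vp: "v permutes {1..n}" using v by (simp add: bruhat_le_def)
  show "perm_mat n v \<in> GL n" by (rule perm_mat_GL[OF vp])
  fix c :: complex
  have jn: "j < n" using ij by simp
  have one: "addrow_mat n 0 i j = (1\<^sub>m n :: complex mat)" by (rule eq_matI) (auto simp: addrow_mat_entry)
  show "flag_of n (perm_mat n v * addrow_mat n c i j) \<in> schubert_variety n w"
  proof (cases "v (Suc i) < v (Suc j) \<or> c = 0")
    case True
    then have "perm_mat n v * addrow_mat n c i j \<in> bruhat_cell n v"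
      using addrow_inversion_cell[OF vp ij(2) jn] perm_mat_in_cell one by auto
    then show ?thesis by (rule bruhat_cell_in_schubert_variety[OF v])
  next
    case False
    then show ?thesis
      using bruhat_cell_in_schubert_variety[OF _ addrow_ascent_cell[OF vp ij]] h by blast
  qed
qed (use ij in auto)

lemma coordinate_tangent_dim:
  assumes S: "S \<subseteq> low n" and lower: "\<And>p. p \<in> S \<Longrightarrow> unit_coord p \<in> tangent_space n Z g"
    and upper: "\<And>V p. V \<in> tangent_space n Z g \<Longrightarrow> p \<notin> S \<Longrightarrow> V p = 0"
  shows "tangent_dim n Z g = card S"
proof -
  have fin: "finite S" using S finite_subset finite_low by blast
  have "tangent_space n Z g \<subseteq> supported S" using upper by (auto simp: supported_def)
  moreover have "supported S \<subseteq> tangent_space n Z g"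
    using supported_span[OF fin] coord_space.span_minimal[OF _ subspace_tangent_space, of "unit_coord ` S"] lower by blast
  ultimately show ?thesis using dim_supported[OF fin] by (simp add: tangent_dim_def)
qed

text \<open>At w the inversions give tangent directions, and every other coordinate is killed
  because an ascent of w leads to a longer permutation, which is not below w.\<close>

lemma fixed_point_dim_top:
  assumes w: "w permutes {1..n}"
  shows "fixed_point_dim n w w = inv_count n w"
proof -
  let ?S = "{(i, j). j < i \<and> i < n \<and> w (Suc i) < w (Suc j)}"
  have "fixed_point_dim n w w = card ?S"
    unfolding fixed_point_dim_def
  proof (rule coordinate_tangent_dim)
    fix p assume "p \<in> ?S"
    then show "unit_coord p \<in> tangent_space n (schubert_variety n w) (perm_mat n w)"
      using inversion_tangent[OF w bruhat_le_refl[OF w]] by auto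
  next
    fix V p assume V: "V \<in> tangent_space n (schubert_variety n w) (perm_mat n w)" and p: "p \<notin> ?S"
    obtain i j where ij: "p = (i, j)" by (cases p)
    show "V p = 0"
    proof (cases "j < i \<and> i < n")
      case True
      then have lt: "w (Suc j) < w (Suc i)"
        using p ij permutes_neq[OF w, of "Suc i" "Suc j"] by auto
      have "inv_count n w < inv_count n (w \<circ> T (Suc j) (Suc i))"
        using inv_count_comp_T[of "Suc j" "Suc i" n w] True lt w by simp
      then have "\<not> bruhat_le n (w \<circ> T (Suc j) (Suc i)) w"
        using bruhat_le_inv_count[of n "w \<circ> T (Suc j) (Suc i)" w] by auto
      then show ?thesis using tangent_space_perm_bound[OF w bruhat_le_refl[OF w] _ _ lt V] True ij by blast
    next
      case False
      then show ?thesis using V ij by (auto simp: tangent_space_def affine_space_def)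
    qed
  qed (auto simp: low_def)
  also have "\<dots> = inv_count n w"
  proof -
    have "bij_betw (\<lambda>(i, j). (Suc j, Suc i)) ?S {(i, j) \<in> index_pairs n. w j < w i}"
      by (rule bij_betwI[where g = "\<lambda>(i, j). (j - 1, i - 1)"]) (auto simp: index_pairs_def)
    then show ?thesis unfolding inv_count_def by (rule bij_betw_same_card)
  qed
  finally show ?thesis .
qed

text \<open>At the identity every pair is an ascent, so a coordinate direction is tangent exactly
  when its transposition is below w.\<close>

lemma fixed_point_dim_bottom:
  assumes w: "w permutes {1..n}"
  shows "fixed_point_dim n w id = card (CT_below n w)"
proof -
  let ?S = "{(i, j). j < i \<and> i < n \<and> bruhat_le n (T (Suc j) (Suc i)) w}"
  have id_le: "bruhat_le n id w" by (rule bruhat_le_id[OF w])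
  have "fixed_point_dim n w id = card ?S"
    unfolding fixed_point_dim_def
  proof (rule coordinate_tangent_dim)
    fix p assume "p \<in> ?S"
    then show "unit_coord p \<in> tangent_space n (schubert_variety n w) (perm_mat n id)"
      using inversion_tangent[OF w id_le] by auto
  next
    fix V p assume V: "V \<in> tangent_space n (schubert_variety n w) (perm_mat n id)" and p: "p \<notin> ?S"
    obtain i j where ij: "p = (i, j)" by (cases p)
    show "V p = 0"
    proof (cases "j < i \<and> i < n")
      case True
      then show ?thesis using tangent_space_perm_bound[OF w id_le _ _ _ V, of j i] p ij by auto
    next
      case False
      then show ?thesis using V ij by (auto simp: tangent_space_def affine_space_def)
    qed
  qed (auto simp: low_def)
  also have "\<dots> = card (CT_below n w)"
  proof (rule bij_betw_same_card)
    show "bij_betw (\<lambda>(i, j). T (Suc j) (Suc i)) ?S (CT_below n w)"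
      unfolding bij_betw_def
    proof
      show "inj_on (\<lambda>(i, j). T (Suc j) (Suc i)) ?S" by (auto simp: inj_on_def T_eq_iff)
      show "(\<lambda>(i, j). T (Suc j) (Suc i)) ` ?S = CT_below n w"
      proof (intro equalityI subsetI)
        fix t assume "t \<in> (\<lambda>(i, j). T (Suc j) (Suc i)) ` ?S"
        then obtain i j where t: "t = T (Suc j) (Suc i)" "j < i" "i < n" "bruhat_le n (T (Suc j) (Suc i)) w" by auto
        then have "T (Suc j) (Suc i) \<in> transpositions n"
          unfolding transpositions_def by (intro CollectI exI[of _ "Suc j"] exI[of _ "Suc i"]) simp
        then show "t \<in> CT_below n w" using t by (simp add: CT_below_def)
      next
        fix t assume "t \<in> CT_below n w"
        then obtain i j where t: "t = T i j" "1 \<le> i" "i < j" "j \<le> n" "bruhat_le n (T i j) w"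
          by (auto simp: CT_below_def transpositions_def)
        then have S: "Suc (i - 1) = i" "Suc (j - 1) = j" and lt: "i - 1 < j - 1" "j - 1 < n" by auto
        have "(j - 1, i - 1) \<in> ?S" using t(5) lt by (simp only: mem_Collect_eq prod.case S simp_thms)
        moreover have "t = (\<lambda>(i, j). T (Suc j) (Suc i)) (j - 1, i - 1)" unfolding t(1) prod.case S ..
        ultimately show "t \<in> (\<lambda>(i, j). T (Suc j) (Suc i)) ` ?S" by (rule rev_image_eqI)
      qed
    qed
  qed
  finally show ?thesis .
qed

text \<open>Every flag of the variety lies in the cell of some v between the identity and w, so its
  tangent dimension lies between those at w and at the identity. Both bounds are attained, and the
  lower one is \<open>variety_dim\<close>; all dimensions agree exactly when the two bounds
  do.\<close>

theorem smooth_perm_iff_tight: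
  assumes w: "w permutes {1..n}"
  shows "smooth_perm n w \<longleftrightarrow> tight n w"
proof -
  let ?X = "schubert_variety n w"
  let ?A = "{g \<in> GL n. flag_of n g \<in> ?X}"
  have le: "bruhat_le n w w" "bruhat_le n id w" using bruhat_le_refl[OF w] bruhat_le_id[OF w] by auto
  have bounds: "inv_count n w \<le> tangent_dim n ?X g \<and> tangent_dim n ?X g \<le> card (CT_below n w)" if g: "g \<in> ?A" for g
  proof -
    obtain v where v: "v permutes {1..n}" "g \<in> bruhat_cell n v" using bruhat_decomposition g by blast
    have vw: "bruhat_le n v w" using bruhat_le_of_schubert_variety[OF w v] g by blast
    show ?thesis
      using tangent_dim_cell[OF w vw v(2)] fixed_point_dim_antimono[OF w vw le(1)]
        fixed_point_dim_antimono[OF w bruhat_le_id[OF v(1)] vw] fixed_point_dim_top[OF w] fixed_point_dim_bottom[OF w]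
      by simp
  qed
  have mem: "perm_mat n v \<in> ?A" if "bruhat_le n v w" for v
    using that perm_mat_GL bruhat_cell_in_schubert_variety[OF that perm_mat_in_cell] by (auto simp: bruhat_le_def)
  have "variety_dim n ?X = inv_count n w"
    unfolding variety_dim_def
  proof (rule cInf_eq_minimum)
    show "inv_count n w \<in> tangent_dim n ?X ` ?A"
    proof (rule image_eqI[where x = "perm_mat n w"])
      show "inv_count n w = tangent_dim n ?X (perm_mat n w)"
        using fixed_point_dim_top[OF w] unfolding fixed_point_dim_def by (rule sym)
    qed (rule mem[OF le(1)])
    show "inv_count n w \<le> x" if x: "x \<in> tangent_dim n ?X ` ?A" for x
    proof -
      obtain g where "x = tangent_dim n ?X g" "g \<in> ?A" using x by blast
      then show ?thesis using bounds[of g] by simp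
    qed
  qed
  then have "smooth_perm n w \<longleftrightarrow> (\<forall>g \<in> ?A. tangent_dim n ?X g = inv_count n w)"
    unfolding smooth_perm_def smooth_variety_def by auto
  also have "\<dots> \<longleftrightarrow> card (CT_below n w) = inv_count n w"
  proof
    assume "\<forall>g \<in> ?A. tangent_dim n ?X g = inv_count n w"
    then show "card (CT_below n w) = inv_count n w"
      using mem[OF le(2)] fixed_point_dim_bottom[OF w] unfolding fixed_point_dim_def by simp
  next
    assume "card (CT_below n w) = inv_count n w"
    then show "\<forall>g \<in> ?A. tangent_dim n ?X g = inv_count n w" using bounds by fastforce
  qed
  also have "\<dots> \<longleftrightarrow> tight n w" by (simp add: tight_def card_CT_below[OF w])
  finally show ?thesis .
qed

theorem theorem1p2:
  fixes n :: nat and w :: "nat \<Rightarrow> nat"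
  assumes "n \<ge> 1" and "w permutes {1..n}"
  shows "(smooth_perm n w \<longleftrightarrow>
            (\<exists>ts. distinct ts \<and> set ts = CT_below n w \<and> chain_property n w ts)) \<and>
         (smooth_perm n w \<longrightarrow>
            (\<forall>prec ts. compatible_order n (C_below n w) prec \<and>
               set ts = CT_below n w \<and> sorted_wrt prec ts \<longrightarrow> chain_property n w ts))"
  unfolding smooth_perm_iff_tight[OF assms(2)]
  using tight_chain_exists[OF assms(2)] chain_tight[OF assms(2)] tight_compatible_chain[OF assms(2)] by blast

end
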